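(* Let $\lambda\in\sum_{i\in I_0}\mathbb{Z}_{\ge 0}\varpi_i$ be a level-zero dominant integral weight, $\Lambda=\mathrm{cl}(\lambda)$, and $J=\{j\in I_0\mid \langle\Lambda,\alpha_j^\vee\rangle=0\}$. Then, identifying quantum LS paths with piecewise-linear maps as described in the context, $$\widetilde{\mathbb{B}}(\lambda)_{\mathrm{cl}}=\widehat{\mathbb{B}}(\lambda)_{\mathrm{cl}}=\mathbb{B}(\lambda)_{\mathrm{cl}}.$$
   Context: Affine data: $\mathfrak{g}$ is an untwisted affine Lie algebra over $\mathbb{C}$ with Cartan matrix $(a_{ij})_{i,j\in I}$ (nodes numbered as in Kac's book), $0\in I$ the distinguished node, $I_0=I\setminus\{0\}$. Its Cartan subalgebra is $\mathfrak{h}=\bigoplus_{j\in I}\mathbb{C}\alpha_j^\vee\oplus\mathbb{C}d$ with simple coroots $\alpha_j^\vee$ and degree operator $d$; $\alpha_j\in\mathfrak{h}^*$ are the simple roots, $\Lambda_j$ the fundamental weights, $\delta=\sum_j a_j\alpha_j$ the null root, $c=\sum_j a_j^\vee\alpha_j^\vee$ the canonical central element, $P=\bigoplus_{j\in I}\mathbb{Z}\Lambda_j\oplus\mathbb{Z}\delta$ the weight lattice. $W$ is the Weyl group generated by the simple reflections $r_j$ ($j\in I$), $r_\beta$ the reflection in a real root $\beta$, $\beta^\vee$ its dual root. $W_0=\langle r_j\mid j\in I_0\rangle$, $\Delta_0$ the finite root system with positive roots $\Delta_0^+$, negative roots $\Delta_0^-$ and highest root $\theta$; thus $\alpha_0=-\theta+\delta$,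 $\alpha_0^\vee=-\theta^\vee+c$. The level-zero fundamental weights are $\varpi_i=\Lambda_i-a_i^\vee\Lambda_0$ ($i\in I_0$). $\mathrm{cl}:\mathfrak{h}^*\to\mathfrak{h}^*/\mathbb{C}\delta$ is the projection, $P_{\mathrm{cl}}=\mathrm{cl}(P)$, paired with $\bigoplus_{j\in I}\mathbb{Z}\alpha_j^\vee$ via $\langle\mathrm{cl}(\mu),h\rangle=\langle\mu,h\rangle$; $W$ acts on $\mathfrak{h}^*/\mathbb{C}\delta$. Elements of the root lattice are identified with their images under cl, so $\alpha_0=-\theta$ in $P_{\mathrm{cl}}$. Parabolic quantum Bruhat graph: $W_J=\langle r_j\mid j\in J\rangle$, $\Delta_J=\Delta_0\cap\bigoplus_{j\in J}\mathbb{Z}\alpha_j$, $\Delta_J^{\pm}=\Delta_0^\pm\cap\Delta_J$, $W_0^J$ the set of minimal-length coset representatives of $W_0/W_J$, $\lfloor w\rfloor\in W_0^J$ the representative of $wW_J$, $\ell$ the length function, $\rho=\frac12\sum_{\alpha\in\Delta_0^+}\alpha$, $\rho_J=\frac12\sum_{\alpha\in\Delta_J^+}\alpha$. The parabolic quantum Bruhat graph has vertex set $W_0^J$ and an edge $\lfloor wr_\beta\rfloor\xleftarrow{\beta}w$ for $w\in W_0^J$, $\beta\in\Delta_0^+\setminus\Delta_J^+$ whenever either $\ell(\lfloor wr_\beta\rfloor)=\ell(w)+1$ (Bruhat edge) or $\ell(\lfloor wr_\beta\rfloor)=\ell(w)-2\langle\rho-\rho_J,\beta^\vee\rangle+1$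 (quantum edge). A directed path from $y$ to $x$ is a sequence $x=w_0\xleftarrow{\beta_1}w_1\xleftarrow{\beta_2}\cdots\xleftarrow{\beta_n}w_n=y$ of edges; $\ell(x\Leftarrow y)$ denotes the minimal length of such a path. For rational $0<\sigma<1$, a directed $\sigma$-path is a directed path with $\sigma\langle\Lambda,\beta_k^\vee\rangle\in\mathbb{Z}$ for all $k$. Quantum LS paths: $\widetilde{\mathbb{B}}(\lambda)_{\mathrm{cl}}$ (resp. $\widehat{\mathbb{B}}(\lambda)_{\mathrm{cl}}$) is the set of pairs $\eta=(x_1,\dots,x_s;\sigma_0,\dots,\sigma_s)$ with $x_k\in W_0^J$, $x_k\ne x_{k+1}$, and rationals $0=\sigma_0<\sigma_1<\dots<\sigma_s=1$ such that for each $1\le k\le s-1$ there is a directed $\sigma_k$-path (resp. a directed $\sigma_k$-path of length $\ell(x_k\Leftarrow x_{k+1})$) from $x_{k+1}$ to $x_k$. Such $\eta$ is identified with the map $\eta:[0,1]\to\mathbb{R}\otimes_{\mathbb{Z}}P_{\mathrm{cl}}$, $\eta(t)=\sum_{l=1}^{k-1}(\sigma_l-\sigma_{l-1})x_l\Lambda+(t-\sigma_{k-1})x_k\Lambda$ for $\sigma_{k-1}\le t\le\sigma_k$. LS paths: for $\mu\in P$ and $\mu',\nu\in W\mu$, write $\mu'\ge\nu$ if there are $\mu'=\mu_0,\mu_1,\dots,\mu_n=\nu$ in $W\mu$ and positive real roots $\beta_1,\dots,\beta_n$ with $\mu_k=r_{\beta_k}\mu_{k-1}$ and $\langle\mu_{k-1},\beta_k^\vee\rangle<0$;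 $\mathrm{dist}(\mu',\nu)$ is the maximal such $n$. For $\mu'>\nu$ and rational $0<\sigma<1$, a $\sigma$-chain for $(\mu',\nu)$ is a sequence $\mu'=\mu_0>\mu_1>\dots>\mu_n=\nu$ in $W\mu$ with $\mathrm{dist}(\mu_{k-1},\mu_k)=1$ and $\sigma\langle\mu_{k-1},\beta_k^\vee\rangle\in\mathbb{Z}_{<0}$, where $\beta_k$ is the positive real root with $r_{\beta_k}\mu_{k-1}=\mu_k$. An LS path of shape $\mu$ is a pair $(\nu_1>\nu_2>\dots>\nu_s;\,0=\sigma_0<\sigma_1<\dots<\sigma_s=1)$ with $\nu_k\in W\mu$, $\sigma_k$ rational, such that a $\sigma_k$-chain for $(\nu_k,\nu_{k+1})$ exists for $1\le k\le s-1$; it is identified with the map $\pi(t)=\sum_{l=1}^{k-1}(\sigma_l-\sigma_{l-1})\nu_l+(t-\sigma_{k-1})\nu_k$ ($\sigma_{k-1}\le t\le\sigma_k$) into $\mathbb{R}\otimes P$. $\mathbb{B}(\mu)$ is the set of LS paths of shape $\mu$, and $\mathbb{B}(\mu)_{\mathrm{cl}}=\{\mathrm{cl}\circ\pi\mid\pi\in\mathbb{B}(\mu)\}$. *)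

theory Defs
  imports Complex_Main
begin

text \<open>The index set is I = {0..n}, I0 = {1..n}.  A generalized Cartan matrix is a function
  A :: nat => nat => int with a_ij = A i j = <alpha_j, alpha_i^vee>.
  An element of h^* (with real coefficients) is written in the basis Lambda_0,...,Lambda_n, delta:
  the pair (f, e) stands for  sum_j f j Lambda_j + e delta  (f vanishes outside I for all weights
  we construct).  Then <mu, alpha_i^vee> = fst mu i.  The quotient h^*/C delta is represented by
  the first component (coefficients of cl(Lambda_j)), so cl = fst.\<close>

type_synonym wt = "(nat \<Rightarrow> real) \<times> real"

definition Iset :: "nat \<Rightarrow> nat set" where "Iset n = {0..n}"
definition I0set :: "nat \<Rightarrow> nat set" where "I0set n = {1..n}"

definition wzero :: wt where "wzero = (\<lambda>_. 0, 0)"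
definition wadd :: "wt \<Rightarrow> wt \<Rightarrow> wt" where
  "wadd x y = (\<lambda>j. fst x j + fst y j, snd x + snd y)"
definition wscale :: "real \<Rightarrow> wt \<Rightarrow> wt" where
  "wscale c x = (\<lambda>j. c * fst x j, c * snd x)"
definition wdiff :: "wt \<Rightarrow> wt \<Rightarrow> wt" where
  "wdiff x y = wadd x (wscale (-1) y)"
definition wsum :: "('a \<Rightarrow> wt) \<Rightarrow> 'a set \<Rightarrow> wt" where
  "wsum f S = (\<lambda>j. \<Sum>s\<in>S. fst (f s) j, \<Sum>s\<in>S. snd (f s))"

definition cl :: "wt \<Rightarrow> (nat \<Rightarrow> real)" where "cl x = fst x"

section \<open>Finite root system of the Cartan submatrix on I0 (in root / coroot coordinates)\<close>

definition unitv :: "nat \<Rightarrow> nat \<Rightarrow> int" where "unitv i = (\<lambda>k. if k = i then 1 else 0)"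

definition frefl :: "nat \<Rightarrow> (nat \<Rightarrow> nat \<Rightarrow> int) \<Rightarrow> nat \<Rightarrow> (nat \<Rightarrow> int) \<Rightarrow> (nat \<Rightarrow> int)" where
  "frefl n A i c = c(i := c i - (\<Sum>j\<in>I0set n. A i j * c j))"
definition fcorefl :: "nat \<Rightarrow> (nat \<Rightarrow> nat \<Rightarrow> int) \<Rightarrow> nat \<Rightarrow> (nat \<Rightarrow> int) \<Rightarrow> (nat \<Rightarrow> int)" where
  "fcorefl n A i h = h(i := h i - (\<Sum>j\<in>I0set n. A j i * h j))"
definition fword :: "nat \<Rightarrow> (nat \<Rightarrow> nat \<Rightarrow> int) \<Rightarrow> nat list \<Rightarrow> (nat \<Rightarrow> int) \<Rightarrow> (nat \<Rightarrow> int)" where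
  "fword n A ws c = foldr (frefl n A) ws c"
definition fcoword :: "nat \<Rightarrow> (nat \<Rightarrow> nat \<Rightarrow> int) \<Rightarrow> nat list \<Rightarrow> (nat \<Rightarrow> int) \<Rightarrow> (nat \<Rightarrow> int)" where
  "fcoword n A ws h = foldr (fcorefl n A) ws h"

text \<open>Roots of the finite root system, as coefficient vectors w.r.t. alpha_1..alpha_n.\<close>
definition froots :: "nat \<Rightarrow> (nat \<Rightarrow> nat \<Rightarrow> int) \<Rightarrow> (nat \<Rightarrow> int) set" where
  "froots n A = {fword n A ws (unitv i) | ws i. set ws \<subseteq> I0set n \<and> i \<in> I0set n}"

text \<open>Dual root (coefficients w.r.t. alpha_1^vee..alpha_n^vee): (w alpha_i)^vee = w alpha_i^vee.\<close>
definition fcoroot :: "nat \<Rightarrow> (nat \<Rightarrow> nat \<Rightarrow> int) \<Rightarrow> (nat \<Rightarrow> int) \<Rightarrow> (nat \<Rightarrow> int)" where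
  "fcoroot n A b = (THE h. \<exists>ws i. set ws \<subseteq> I0set n \<and> i \<in> I0set n \<and>
       b = fword n A ws (unitv i) \<and> h = fcoword n A ws (unitv i))"

definition fheight :: "nat \<Rightarrow> (nat \<Rightarrow> int) \<Rightarrow> int" where
  "fheight n c = (\<Sum>j\<in>I0set n. c j)"

definition fhighest :: "nat \<Rightarrow> (nat \<Rightarrow> nat \<Rightarrow> int) \<Rightarrow> (nat \<Rightarrow> int)" where
  "fhighest n A = (THE t. t \<in> froots n A \<and> (\<forall>b\<in>froots n A. fheight n b \<le> fheight n t))"

definition is_GCM :: "nat set \<Rightarrow> (nat \<Rightarrow> nat \<Rightarrow> int) \<Rightarrow> bool" where
  "is_GCM S A \<longleftrightarrow> (\<forall>i\<in>S. A i i = 2) \<and> (\<forall>i\<in>S. \<forall>j\<in>S. i \<noteq> j \<longrightarrow> A i j \<le> 0)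
     \<and> (\<forall>i\<in>S. \<forall>j\<in>S. A i j = 0 \<longleftrightarrow> A j i = 0)"

definition indecomposable :: "nat set \<Rightarrow> (nat \<Rightarrow> nat \<Rightarrow> int) \<Rightarrow> bool" where
  "indecomposable S A \<longleftrightarrow> (\<forall>T. T \<subseteq> S \<longrightarrow> T \<noteq> {} \<longrightarrow> T \<noteq> S \<longrightarrow>
       (\<exists>i\<in>T. \<exists>j\<in>S - T. A i j \<noteq> 0))"

text \<open>Kac, Thm 4.3: an indecomposable GCM is of finite type iff there is u > 0 with A u > 0.\<close>
definition finite_type :: "nat set \<Rightarrow> (nat \<Rightarrow> nat \<Rightarrow> int) \<Rightarrow> bool" where
  "finite_type S A \<longleftrightarrow> is_GCM S A \<and> indecomposable S A \<and>
     (\<exists>u :: nat \<Rightarrow> real. (\<forall>i\<in>S. u i > 0) \<and> (\<forall>i\<in>S. (\<Sum>j\<in>S. of_int (A i j) * u j) > 0))"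

text \<open>A is the untwisted affine Cartan matrix X_n^(1) with distinguished node 0:
  the restriction to I0 is of finite type, and row/column 0 come from
  alpha_0 = -theta + delta, alpha_0^vee = -theta^vee + c, i.e.
  a_{0j} = -<alpha_j, theta^vee>, a_{j0} = -<theta, alpha_j^vee>.\<close>
definition untwisted_affine :: "nat \<Rightarrow> (nat \<Rightarrow> nat \<Rightarrow> int) \<Rightarrow> bool" where
  "untwisted_affine n A \<longleftrightarrow> 1 \<le> n \<and> is_GCM (Iset n) A \<and> finite_type (I0set n) A \<and>
     (let t = fhighest n A; tv = fcoroot n A t in
       (\<forall>j\<in>I0set n. A 0 j = - (\<Sum>i\<in>I0set n. tv i * A i j)) \<and>
       (\<forall>j\<in>I0set n. A j 0 = - (\<Sum>k\<in>I0set n. A j k * t k)))"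

definition sroot :: "nat \<Rightarrow> (nat \<Rightarrow> nat \<Rightarrow> int) \<Rightarrow> nat \<Rightarrow> wt" where
  "sroot n A j = (\<lambda>k. if k \<le> n then of_int (A k j) else 0, if j = 0 then 1 else 0)"

definition fundw :: "nat \<Rightarrow> wt" where
  "fundw j = (\<lambda>k. if k = j then 1 else 0, 0)"

text \<open>Dual marks a_j^vee: c = sum_j a_j^vee alpha_j^vee is central, a_0^vee = 1.\<close>
definition dualmark :: "nat \<Rightarrow> (nat \<Rightarrow> nat \<Rightarrow> int) \<Rightarrow> nat \<Rightarrow> real" where
  "dualmark n A = (THE v. v 0 = 1 \<and> (\<forall>i. n < i \<longrightarrow> v i = 0) \<and>
      (\<forall>j\<in>Iset n. (\<Sum>i\<in>Iset n. v i * of_int (A i j)) = 0))"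

definition lzfw :: "nat \<Rightarrow> (nat \<Rightarrow> nat \<Rightarrow> int) \<Rightarrow> nat \<Rightarrow> wt" where
  "lzfw n A i = wdiff (fundw i) (wscale (dualmark n A i) (fundw 0))"

definition sref :: "nat \<Rightarrow> (nat \<Rightarrow> nat \<Rightarrow> int) \<Rightarrow> nat \<Rightarrow> wt \<Rightarrow> wt" where
  "sref n A i mu = wdiff mu (wscale (fst mu i) (sroot n A i))"

definition wword :: "nat \<Rightarrow> (nat \<Rightarrow> nat \<Rightarrow> int) \<Rightarrow> nat list \<Rightarrow> wt \<Rightarrow> wt" where
  "wword n A ws = foldr (\<lambda>i f. sref n A i \<circ> f) ws id"

definition Weyl :: "nat \<Rightarrow> (nat \<Rightarrow> nat \<Rightarrow> int) \<Rightarrow> (wt \<Rightarrow> wt) set" where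
  "Weyl n A = {wword n A ws | ws. set ws \<subseteq> Iset n}"

definition Weyl0 :: "nat \<Rightarrow> (nat \<Rightarrow> nat \<Rightarrow> int) \<Rightarrow> (wt \<Rightarrow> wt) set" where
  "Weyl0 n A = {wword n A ws | ws. set ws \<subseteq> I0set n}"

definition WeylJ :: "nat \<Rightarrow> (nat \<Rightarrow> nat \<Rightarrow> int) \<Rightarrow> nat set \<Rightarrow> (wt \<Rightarrow> wt) set" where
  "WeylJ n A J = {wword n A ws | ws. set ws \<subseteq> J}"

definition realroots :: "nat \<Rightarrow> (nat \<Rightarrow> nat \<Rightarrow> int) \<Rightarrow> wt set" where
  "realroots n A = {wword n A ws (sroot n A i) | ws i. set ws \<subseteq> Iset n \<and> i \<in> Iset n}"

text \<open><mu, beta^vee> for a real root beta = w alpha_i: it equals <w^{-1} mu, alpha_i^vee>.\<close>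
definition copair :: "nat \<Rightarrow> (nat \<Rightarrow> nat \<Rightarrow> int) \<Rightarrow> wt \<Rightarrow> wt \<Rightarrow> real" where
  "copair n A mu b = (THE c. \<exists>ws i. set ws \<subseteq> Iset n \<and> i \<in> Iset n \<and>
       b = wword n A ws (sroot n A i) \<and> c = fst (wword n A (rev ws) mu) i)"

definition rrefl :: "nat \<Rightarrow> (nat \<Rightarrow> nat \<Rightarrow> int) \<Rightarrow> wt \<Rightarrow> wt \<Rightarrow> wt" where
  "rrefl n A b mu = wdiff mu (wscale (copair n A mu b) b)"

definition posroots :: "nat \<Rightarrow> (nat \<Rightarrow> nat \<Rightarrow> int) \<Rightarrow> wt set" where
  "posroots n A = {b \<in> realroots n A. \<exists>c :: nat \<Rightarrow> nat.
       b = wsum (\<lambda>j. wscale (real (c j)) (sroot n A j)) (Iset n)}"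

definition roots0 :: "nat \<Rightarrow> (nat \<Rightarrow> nat \<Rightarrow> int) \<Rightarrow> wt set" where
  "roots0 n A = {wword n A ws (sroot n A i) | ws i. set ws \<subseteq> I0set n \<and> i \<in> I0set n}"

definition posroots0 :: "nat \<Rightarrow> (nat \<Rightarrow> nat \<Rightarrow> int) \<Rightarrow> wt set" where
  "posroots0 n A = roots0 n A \<inter> posroots n A"

definition rootsJ :: "nat \<Rightarrow> (nat \<Rightarrow> nat \<Rightarrow> int) \<Rightarrow> nat set \<Rightarrow> wt set" where
  "rootsJ n A J = roots0 n A \<inter> {wsum (\<lambda>j. wscale (of_int (c j)) (sroot n A j)) J | c :: nat \<Rightarrow> int. True}"

definition posrootsJ :: "nat \<Rightarrow> (nat \<Rightarrow> nat \<Rightarrow> int) \<Rightarrow> nat set \<Rightarrow> wt set" where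
  "posrootsJ n A J = rootsJ n A J \<inter> posroots0 n A"

definition wlen :: "nat \<Rightarrow> (nat \<Rightarrow> nat \<Rightarrow> int) \<Rightarrow> (wt \<Rightarrow> wt) \<Rightarrow> nat" where
  "wlen n A w = (LEAST k. \<exists>ws. length ws = k \<and> set ws \<subseteq> I0set n \<and> w = wword n A ws)"

definition minreps :: "nat \<Rightarrow> (nat \<Rightarrow> nat \<Rightarrow> int) \<Rightarrow> nat set \<Rightarrow> (wt \<Rightarrow> wt) set" where
  "minreps n A J = {w \<in> Weyl0 n A. \<forall>u\<in>WeylJ n A J. wlen n A w \<le> wlen n A (w \<circ> u)}"

definition floorJ :: "nat \<Rightarrow> (nat \<Rightarrow> nat \<Rightarrow> int) \<Rightarrow> nat set \<Rightarrow> (wt \<Rightarrow> wt) \<Rightarrow> (wt \<Rightarrow> wt)" where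
  "floorJ n A J w = (THE u. u \<in> minreps n A J \<and> (\<exists>v\<in>WeylJ n A J. u = w \<circ> v))"

definition rho0 :: "nat \<Rightarrow> (nat \<Rightarrow> nat \<Rightarrow> int) \<Rightarrow> wt" where
  "rho0 n A = wscale (1/2) (wsum id (posroots0 n A))"

definition rhoJ :: "nat \<Rightarrow> (nat \<Rightarrow> nat \<Rightarrow> int) \<Rightarrow> nat set \<Rightarrow> wt" where
  "rhoJ n A J = wscale (1/2) (wsum id (posrootsJ n A J))"

definition qbg_edge :: "nat \<Rightarrow> (nat \<Rightarrow> nat \<Rightarrow> int) \<Rightarrow> nat set \<Rightarrow> (wt \<Rightarrow> wt) \<Rightarrow> wt \<Rightarrow> (wt \<Rightarrow> wt) \<Rightarrow> bool" where
  "qbg_edge n A J w b u \<longleftrightarrow> w \<in> minreps n A J \<and> b \<in> posroots0 n A - posrootsJ n A J \<and>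
     u = floorJ n A J (w \<circ> rrefl n A b) \<and>
     (wlen n A u = wlen n A w + 1 \<or>
      real (wlen n A u) = real (wlen n A w) - 2 * copair n A (wdiff (rho0 n A) (rhoJ n A J)) b + 1)"

text \<open>A directed path of length k from y to x: x = w_0 <-b_1- w_1 <- ... <-b_k- w_k = y.\<close>
definition qbg_path :: "nat \<Rightarrow> (nat \<Rightarrow> nat \<Rightarrow> int) \<Rightarrow> nat set \<Rightarrow> (wt \<Rightarrow> wt) \<Rightarrow> (wt \<Rightarrow> wt)
    \<Rightarrow> nat \<Rightarrow> (nat \<Rightarrow> wt \<Rightarrow> wt) \<Rightarrow> (nat \<Rightarrow> wt) \<Rightarrow> bool" where
  "qbg_path n A J x y k ws bs \<longleftrightarrow> ws 0 = x \<and> ws k = y \<and>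
     (\<forall>t\<in>{1..k}. qbg_edge n A J (ws t) (bs t) (ws (t - 1)))"

definition qbg_dist :: "nat \<Rightarrow> (nat \<Rightarrow> nat \<Rightarrow> int) \<Rightarrow> nat set \<Rightarrow> (wt \<Rightarrow> wt) \<Rightarrow> (wt \<Rightarrow> wt) \<Rightarrow> nat" where
  "qbg_dist n A J x y = (LEAST k. \<exists>ws bs. qbg_path n A J x y k ws bs)"

definition sigma_path :: "nat \<Rightarrow> (nat \<Rightarrow> nat \<Rightarrow> int) \<Rightarrow> wt \<Rightarrow> nat set \<Rightarrow> real
    \<Rightarrow> (wt \<Rightarrow> wt) \<Rightarrow> (wt \<Rightarrow> wt) \<Rightarrow> nat \<Rightarrow> bool" where
  "sigma_path n A lam J s x y k \<longleftrightarrow> (\<exists>ws bs. qbg_path n A J x y k ws bs \<and>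
      (\<forall>t\<in>{1..k}. s * copair n A lam (bs t) \<in> \<int>))"

text \<open>Action of w on h^*/C delta: w(cl mu) = cl(w mu), using the lift (v, 0).\<close>
definition cl_act :: "(wt \<Rightarrow> wt) \<Rightarrow> (nat \<Rightarrow> real) \<Rightarrow> (nat \<Rightarrow> real)" where
  "cl_act w v = cl (w (v, 0))"

definition Jset :: "nat \<Rightarrow> wt \<Rightarrow> nat set" where
  "Jset n lam = {j \<in> I0set n. cl lam j = 0}"

definition breaks_ok :: "nat \<Rightarrow> real list \<Rightarrow> bool" where
  "breaks_ok s sig \<longleftrightarrow> 1 \<le> s \<and> length sig = s + 1 \<and> sig ! 0 = 0 \<and> sig ! s = 1 \<and>
     (\<forall>k<s. sig ! k < sig ! (k + 1)) \<and> (\<forall>k\<le>s. sig ! k \<in> \<rat>)"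

text \<open>(xs; sig) with xs = [x_1,...,x_s], sig = [sig_0,...,sig_s].\<close>
definition QLS_tilde :: "nat \<Rightarrow> (nat \<Rightarrow> nat \<Rightarrow> int) \<Rightarrow> wt \<Rightarrow> ((wt \<Rightarrow> wt) list \<times> real list) set" where
  "QLS_tilde n A lam = {(xs, sig). breaks_ok (length xs) sig \<and>
     (\<forall>k<length xs. xs ! k \<in> minreps n A (Jset n lam)) \<and>
     (\<forall>k. k + 1 < length xs \<longrightarrow> xs ! k \<noteq> xs ! (k + 1)) \<and>
     (\<forall>k\<in>{1..<length xs}. \<exists>len. sigma_path n A lam (Jset n lam) (sig ! k)
          (xs ! (k - 1)) (xs ! k) len)}"

definition QLS_hat :: "nat \<Rightarrow> (nat \<Rightarrow> nat \<Rightarrow> int) \<Rightarrow> wt \<Rightarrow> ((wt \<Rightarrow> wt) list \<times> real list) set" where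
  "QLS_hat n A lam = {(xs, sig). breaks_ok (length xs) sig \<and>
     (\<forall>k<length xs. xs ! k \<in> minreps n A (Jset n lam)) \<and>
     (\<forall>k. k + 1 < length xs \<longrightarrow> xs ! k \<noteq> xs ! (k + 1)) \<and>
     (\<forall>k\<in>{1..<length xs}. sigma_path n A lam (Jset n lam) (sig ! k)
          (xs ! (k - 1)) (xs ! k) (qbg_dist n A (Jset n lam) (xs ! (k - 1)) (xs ! k)))}"

text \<open>The piecewise-linear map [0,1] -> R (x) P_cl of (vs; sig) with vs = [v_1,...,v_s]:
  for sig_{k-1} <= t <= sig_k it is sum_{l<k} (sig_l - sig_{l-1}) v_l + (t - sig_{k-1}) v_k.
  (Value 0 outside [0,1].)\<close>
definition clpath :: "(nat \<Rightarrow> real) list \<Rightarrow> real list \<Rightarrow> real \<Rightarrow> (nat \<Rightarrow> real)" where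
  "clpath vs sig t = (if 0 \<le> t \<and> t \<le> 1 then
      (let k = (LEAST k. 1 \<le> k \<and> t \<le> sig ! k) in
        (\<lambda>j. (\<Sum>l\<in>{1..<k}. (sig ! l - sig ! (l - 1)) * (vs ! (l - 1)) j)
             + (t - sig ! (k - 1)) * (vs ! (k - 1)) j))
     else (\<lambda>_. 0))"

definition wtpath :: "wt list \<Rightarrow> real list \<Rightarrow> real \<Rightarrow> wt" where
  "wtpath vs sig t = (if 0 \<le> t \<and> t \<le> 1 then
      (let k = (LEAST k. 1 \<le> k \<and> t \<le> sig ! k) in
        wadd (wsum (\<lambda>l. wscale (sig ! l - sig ! (l - 1)) (vs ! (l - 1))) {1..<k})
             (wscale (t - sig ! (k - 1)) (vs ! (k - 1))))
     else wzero)"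

definition QLS_tilde_cl :: "nat \<Rightarrow> (nat \<Rightarrow> nat \<Rightarrow> int) \<Rightarrow> wt \<Rightarrow> (real \<Rightarrow> (nat \<Rightarrow> real)) set" where
  "QLS_tilde_cl n A lam = {clpath (map (\<lambda>x. cl_act x (cl lam)) xs) sig | xs sig.
      (xs, sig) \<in> QLS_tilde n A lam}"

definition QLS_hat_cl :: "nat \<Rightarrow> (nat \<Rightarrow> nat \<Rightarrow> int) \<Rightarrow> wt \<Rightarrow> (real \<Rightarrow> (nat \<Rightarrow> real)) set" where
  "QLS_hat_cl n A lam = {clpath (map (\<lambda>x. cl_act x (cl lam)) xs) sig | xs sig.
      (xs, sig) \<in> QLS_hat n A lam}"

definition orbit :: "nat \<Rightarrow> (nat \<Rightarrow> nat \<Rightarrow> int) \<Rightarrow> wt \<Rightarrow> wt set" where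
  "orbit n A mu = {w mu | w. w \<in> Weyl n A}"

definition ls_chain :: "nat \<Rightarrow> (nat \<Rightarrow> nat \<Rightarrow> int) \<Rightarrow> wt \<Rightarrow> wt \<Rightarrow> wt \<Rightarrow> nat \<Rightarrow> bool" where
  "ls_chain n A mu a b k \<longleftrightarrow> (\<exists>ms :: nat \<Rightarrow> wt. \<exists>bs :: nat \<Rightarrow> wt.
     ms 0 = a \<and> ms k = b \<and> (\<forall>t\<le>k. ms t \<in> orbit n A mu) \<and>
     (\<forall>t\<in>{1..k}. bs t \<in> posroots n A \<and> ms t = rrefl n A (bs t) (ms (t - 1)) \<and>
                  copair n A (ms (t - 1)) (bs t) < 0))"

definition ls_ge :: "nat \<Rightarrow> (nat \<Rightarrow> nat \<Rightarrow> int) \<Rightarrow> wt \<Rightarrow> wt \<Rightarrow> wt \<Rightarrow> bool" where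
  "ls_ge n A mu a b \<longleftrightarrow> a \<in> orbit n A mu \<and> b \<in> orbit n A mu \<and> (\<exists>k. ls_chain n A mu a b k)"

definition ls_gt :: "nat \<Rightarrow> (nat \<Rightarrow> nat \<Rightarrow> int) \<Rightarrow> wt \<Rightarrow> wt \<Rightarrow> wt \<Rightarrow> bool" where
  "ls_gt n A mu a b \<longleftrightarrow> ls_ge n A mu a b \<and> a \<noteq> b"

definition ls_dist1 :: "nat \<Rightarrow> (nat \<Rightarrow> nat \<Rightarrow> int) \<Rightarrow> wt \<Rightarrow> wt \<Rightarrow> wt \<Rightarrow> bool" where
  "ls_dist1 n A mu a b \<longleftrightarrow> ls_chain n A mu a b 1 \<and> (\<forall>k. ls_chain n A mu a b k \<longrightarrow> k \<le> 1)"

definition sigma_chain :: "nat \<Rightarrow> (nat \<Rightarrow> nat \<Rightarrow> int) \<Rightarrow> wt \<Rightarrow> real \<Rightarrow> wt \<Rightarrow> wt \<Rightarrow> bool" where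
  "sigma_chain n A mu s a b \<longleftrightarrow> ls_gt n A mu a b \<and>
     (\<exists>k. \<exists>ms :: nat \<Rightarrow> wt. \<exists>bs :: nat \<Rightarrow> wt. ms 0 = a \<and> ms k = b \<and>
        (\<forall>t\<in>{1..k}. ls_gt n A mu (ms (t - 1)) (ms t) \<and> ls_dist1 n A mu (ms (t - 1)) (ms t) \<and>
           bs t \<in> posroots n A \<and> rrefl n A (bs t) (ms (t - 1)) = ms t \<and>
           s * copair n A (ms (t - 1)) (bs t) \<in> \<int> \<and> s * copair n A (ms (t - 1)) (bs t) < 0))"

definition LS :: "nat \<Rightarrow> (nat \<Rightarrow> nat \<Rightarrow> int) \<Rightarrow> wt \<Rightarrow> (wt list \<times> real list) set" where
  "LS n A mu = {(nus, sig). breaks_ok (length nus) sig \<and>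
     (\<forall>k<length nus. nus ! k \<in> orbit n A mu) \<and>
     (\<forall>k. k + 1 < length nus \<longrightarrow> ls_gt n A mu (nus ! k) (nus ! (k + 1))) \<and>
     (\<forall>k\<in>{1..<length nus}. sigma_chain n A mu (sig ! k) (nus ! (k - 1)) (nus ! k))}"

definition LS_cl :: "nat \<Rightarrow> (nat \<Rightarrow> nat \<Rightarrow> int) \<Rightarrow> wt \<Rightarrow> (real \<Rightarrow> (nat \<Rightarrow> real)) set" where
  "LS_cl n A mu = {(\<lambda>t. cl (wtpath nus sig t)) | nus sig. (nus, sig) \<in> LS n A mu}"

end

theory Submission
  imports Defs
begin

text \<open>
  Everything is transported to the finite orbit \<open>W\<^sub>0\<Lambda>\<close>, which is in bijection with the vertices \<open>W\<^sub>0\<^sup>J\<close>.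
  For a weight \<open>u\<close> in it and an affine root \<open>g + k\<delta>\<close> let \<open>v\<close> be the reflection of \<open>u\<close> in \<open>g\<close>; the excess
  \<open>D = N u - N v + k \<langle>S v, g\<^sup>\<or>\<rangle>\<close>, with \<open>N\<close> the number of positive roots pairing negatively and \<open>S\<close> the sum
  of all roots pairing positively, changes under a simultaneous simple affine reflection \<open>r\<^sub>j\<close> exactly
  by \<open>sgn \<langle>v, \<alpha>\<^sub>j\<^sup>\<or>\<rangle> - sgn \<langle>u, \<alpha>\<^sub>j\<^sup>\<or>\<rangle>\<close>, and equals \<open>1\<close> for simple roots. Induction on the height of \<open>g + k\<delta>\<close>
  shows that \<open>D \<ge> 1\<close> on all steps of the level-zero order and that \<open>D = 1\<close> exactly on its covers, whereas
  comparing with the length formulas shows that \<open>D = 1\<close> describes the edges of the parabolic quantum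
  Bruhat graph. Hence \<open>\<sigma>\<close>-chains project to directed \<open>\<sigma>\<close>-paths and directed \<open>\<sigma>\<close>-paths lift to \<open>\<sigma>\<close>-chains.
  Along an edge that is not a step in direction \<open>\<alpha>\<^sub>j\<close> the sign of \<open>\<langle>\<cdot>, \<alpha>\<^sub>j\<^sup>\<or>\<rangle>\<close> is weakly increasing, so such
  steps can be moved to either end of a \<open>\<sigma>\<close>-path; induction on the height of a root separating the
  endpoints then turns any directed \<open>\<sigma>\<close>-path into one of minimal length.
\<close>

section \<open>Cartan matrices of finite type\<close>

text \<open>Lengths of coset representatives cannot grade the level-zero order, because the
  stabilizer of a level-zero weight in the affine Weyl group is infinite in general. The excess
  takes their place: it is attached to a single reflection and never summed along a chain, and its
  behaviour under simple reflections is all that the inductions need. At level zero the pairing with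
  the coroot of \<open>g + k delta\<close> does not depend on \<open>k\<close>. Passing to the
  finite orbit therefore keeps all sign and integrality conditions and loses only the integer
  \<open>k\<close>; the equation \<open>D = 1\<close> determines it again, which is why paths can be
  lifted edge by edge from any starting weight. Chains descend in the order while directed paths run
  towards the greater weight, so the two are read in opposite directions. Projection may identify
  neighbouring directions that differ by a multiple of delta; such segments are merged. Finite type
  supplies only a positive vector and indecomposability, so symmetrizability, the sign of roots,
  finiteness and the highest root are derived from these.\<close>

text \<open>Scaling the off-diagonal entries to \<open>b\<^sub>i\<^sub>j = - a\<^sub>i\<^sub>j u\<^sub>j / u\<^sub>i\<close> makes every row sum less than \<open>2\<close>, while
  \<open>b\<^sub>i\<^sub>j + b\<^sub>j\<^sub>i \<ge> 2\<close> for every edge, so the diagram has fewer edges than vertices.\<close>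

lemma gcm_leaf:
  fixes u :: "nat \<Rightarrow> real"
  assumes fin: "finite S" and ne: "S \<noteq> {}" and gcm: "is_GCM S A"
    and u: "\<forall>i\<in>S. u i > 0" and Au: "\<forall>i\<in>S. (\<Sum>j\<in>S. of_int (A i j) * u j) > 0"
  shows "\<exists>i\<in>S. card {j\<in>S. j \<noteq> i \<and> A i j \<noteq> 0} \<le> 1"
proof (rule ccontr)
  assume "\<not> ?thesis"
  then have deg: "2 \<le> card {j\<in>S. j \<noteq> i \<and> A i j \<noteq> 0}" if "i \<in> S" for i
    using that by force
  define b where "b i j = (if j = i then 0 else - of_int (A i j) * u j / u i)" for i j
  have row: "(\<Sum>j\<in>S. b i j) < 2" if i: "i \<in> S" for i
  proof -
    have Aii: "A i i = 2" using gcm i by (auto simp: is_GCM_def)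
    have "(\<Sum>j\<in>S. b i j) = (\<Sum>j\<in>S-{i}. b i j)"
      by (rule sum.mono_neutral_right) (use fin in \<open>auto simp: b_def\<close>)
    also have "\<dots> = (\<Sum>j\<in>S-{i}. - (of_int (A i j) * u j)) / u i"
      unfolding sum_divide_distrib by (rule sum.cong) (auto simp: b_def)
    also have "\<dots> < 2"
    proof -
      have "(\<Sum>j\<in>S. of_int (A i j) * u j) = 2 * u i + (\<Sum>j\<in>S-{i}. of_int (A i j) * u j)"
        using fin i Aii by (simp add: sum.remove)
      then show ?thesis using u i Au by (auto simp: field_simps sum_negf)
    qed
    finally show ?thesis .
  qed
  have pair: "b i j + b j i \<ge> 2 * (if j \<noteq> i \<and> A i j \<noteq> 0 then 1 else 0)"
    if i: "i \<in> S" and j: "j \<in> S" for i j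
  proof (cases "j \<noteq> i \<and> A i j \<noteq> 0")
    case True
    then have "A j i \<noteq> 0" using gcm i j unfolding is_GCM_def by blast
    moreover have "A i j \<le> 0" "A j i \<le> 0" using True gcm i j by (auto simp: is_GCM_def)
    ultimately have neg: "A i j < 0" "A j i < 0" using True by auto
    then have p: "b i j > 0" "b j i > 0" using u i j True
      by (auto simp: b_def divide_neg_pos mult_neg_pos)
    have "b i j * b j i = of_int (A i j * A j i)" using u i j True
      by (auto simp: b_def field_simps)
    moreover have "A i j * A j i \<ge> 1" using neg mult_neg_neg[of "A i j" "A j i"] by linarith
    ultimately have "b i j * b j i \<ge> 1" by (metis of_int_1_le_iff)
    then have "4 \<le> (b i j + b j i)\<^sup>2"
      using zero_le_power2[of "b i j - b j i"] by (simp add: power2_eq_square algebra_simps)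
    then have "2 \<le> b i j + b j i" using p power2_le_imp_le[of 2 "b i j + b j i"] by simp
    then show ?thesis using True by simp
  next
    case False
    then have "b i j \<ge> 0 \<and> b j i \<ge> 0" using gcm i j u unfolding b_def is_GCM_def
      by (auto simp: divide_nonneg_pos)
    then show ?thesis using False by auto
  qed
  have "2 * real (card S) \<le> (\<Sum>i\<in>S. real (card {j\<in>S. j \<noteq> i \<and> A i j \<noteq> 0}))"
    using sum_mono[of S "\<lambda>_. 2::real" "\<lambda>i. real (card {j\<in>S. j \<noteq> i \<and> A i j \<noteq> 0})"] deg by simp
  also have "\<dots> = (\<Sum>i\<in>S. \<Sum>j\<in>S. if j \<noteq> i \<and> A i j \<noteq> 0 then 1 else 0)"
    using fin by (intro sum.cong) (auto simp: sum.If_cases Int_def)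
  also have "\<dots> \<le> (\<Sum>i\<in>S. \<Sum>j\<in>S. (b i j + b j i) / 2)"
    using pair by (intro sum_mono) fastforce
  also have "\<dots> = (\<Sum>i\<in>S. \<Sum>j\<in>S. b i j) / 2 + (\<Sum>i\<in>S. \<Sum>j\<in>S. b j i) / 2"
    by (simp add: sum.distrib add_divide_distrib sum_divide_distrib)
  also have "(\<Sum>i\<in>S. \<Sum>j\<in>S. b j i) = (\<Sum>i\<in>S. \<Sum>j\<in>S. b i j)"
    by (rule sum.swap)
  also have "(\<Sum>i\<in>S. \<Sum>j\<in>S. b i j) / 2 + (\<Sum>i\<in>S. \<Sum>j\<in>S. b i j) / 2 = (\<Sum>i\<in>S. \<Sum>j\<in>S. b i j)"
    by simp
  also have "\<dots> < (\<Sum>i\<in>S. 2)"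
    using row by (intro sum_strict_mono) (use fin ne in auto)
  finally show False by simp
qed

text \<open>A leaf has at most one edge, so at most one condition fixes its multiplier, and
  multipliers extend from the diagram without the leaf. Deleting a vertex preserves positivity of
  \<open>A u\<close>, because the deleted off-diagonal entries are nonpositive.\<close>

lemma gcm_symmetrizable:
  fixes u :: "nat \<Rightarrow> real"
  assumes "finite S" "is_GCM S A" "\<forall>i\<in>S. u i > 0" "\<forall>i\<in>S. (\<Sum>j\<in>S. of_int (A i j) * u j) > 0"
  shows "\<exists>d :: nat \<Rightarrow> real. (\<forall>i\<in>S. d i > 0) \<and> (\<forall>i\<in>S. \<forall>j\<in>S. d i * of_int (A i j) = d j * of_int (A j i))"
  using assms
proof (induction "card S" arbitrary: S)
  case 0
  then show ?case by simp
next
  case (Suc k)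
  then have "S \<noteq> {}" by auto
  from gcm_leaf[OF Suc.prems(1) this Suc.prems(2-4)]
  obtain i where i: "i \<in> S" "card {j\<in>S. j \<noteq> i \<and> A i j \<noteq> 0} \<le> 1" by blast
  let ?T = "S - {i}"
  have gT: "is_GCM ?T A" using Suc.prems(2) by (auto simp: is_GCM_def)
  have uT: "\<forall>l\<in>?T. (\<Sum>j\<in>?T. of_int (A l j) * u j) > 0"
  proof
    fix l assume l: "l \<in> ?T"
    have "0 < (\<Sum>j\<in>S. of_int (A l j) * u j)" using Suc.prems(4) l by blast
    also have "\<dots> = of_int (A l i) * u i + (\<Sum>j\<in>?T. of_int (A l j) * u j)"
      using Suc.prems(1) i(1) by (simp add: sum.remove)
    also have "of_int (A l i) * u i \<le> 0"
      using Suc.prems(2,3) l i(1) by (auto simp: is_GCM_def mult_nonpos_nonneg less_imp_le)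
    finally show "(\<Sum>j\<in>?T. of_int (A l j) * u j) > 0" by simp
  qed
  have "\<exists>d :: nat \<Rightarrow> real. (\<forall>i\<in>?T. d i > 0) \<and> (\<forall>i\<in>?T. \<forall>j\<in>?T. d i * of_int (A i j) = d j * of_int (A j i))"
    by (rule Suc.hyps(1)) (use Suc.hyps(2) Suc.prems(1,3) i(1) gT uT in auto)
  then obtain d :: "nat \<Rightarrow> real" where d: "\<forall>i\<in>?T. d i > 0"
    "\<forall>i\<in>?T. \<forall>j\<in>?T. d i * of_int (A i j) = d j * of_int (A j i)" by blast
  have zero: "A i j = 0 \<longleftrightarrow> A j i = 0" if "j \<in> S" for j
    using Suc.prems(2) i(1) that by (auto simp: is_GCM_def)
  show ?case
  proof (cases "{j\<in>S. j \<noteq> i \<and> A i j \<noteq> 0} = {}")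
    case True
    then show ?thesis using d i zero by (intro exI[of _ "d(i := 1)"]) auto
  next
    case False
    then have "card {j\<in>S. j \<noteq> i \<and> A i j \<noteq> 0} = 1"
    proof -
      have "finite {j\<in>S. j \<noteq> i \<and> A i j \<noteq> 0}" using Suc.prems(1) by auto
      then have "card {j\<in>S. j \<noteq> i \<and> A i j \<noteq> 0} \<noteq> 0" using False by (simp only: card_eq_0_iff) simp
      then show ?thesis using i(2) by linarith
    qed
    then obtain j where j: "{j\<in>S. j \<noteq> i \<and> A i j \<noteq> 0} = {j}" by (auto simp: card_1_singleton_iff)
    then have jS: "j \<in> S" "j \<noteq> i" "A i j \<noteq> 0" "A j i \<noteq> 0" using zero by auto
    then have "A i j \<le> 0" "A j i \<le> 0" using Suc.prems(2) i(1) by (auto simp: is_GCM_def)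
    then have neg: "A i j < 0" "A j i < 0" using jS by auto
    define d' where "d' = d(i := d j * of_int (A j i) / of_int (A i j))"
    have "d' i > 0" using d jS neg by (auto simp: d'_def zero_less_divide_iff mult_less_0_iff)
    moreover have "d' i * of_int (A i l) = d' l * of_int (A l i)" if "l \<in> ?T" for l
    proof (cases "l = j")
      case True then show ?thesis using jS by (simp add: d'_def)
    next
      case False
      then have "A i l = 0" using j that by auto
      then show ?thesis using zero[of l] that by auto
    qed
    ultimately show ?thesis using d
      by (intro exI[of _ d']) (auto simp: d'_def)
  qed
qed

text \<open>For \<open>i \<noteq> j\<close> the term
  \<open>- s i j * u i * u j * (x i / u i - x j / u j)^2\<close> is nonnegative, and half the sum of
  these terms is the difference of the two sides.\<close>

lemma symmetrized_form_lower_bound: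
  fixes s :: "nat \<Rightarrow> nat \<Rightarrow> real" and u x :: "nat \<Rightarrow> real"
  assumes "finite S" and sym: "\<And>i j. i \<in> S \<Longrightarrow> j \<in> S \<Longrightarrow> s i j = s j i"
    and neg: "\<And>i j. i \<in> S \<Longrightarrow> j \<in> S \<Longrightarrow> i \<noteq> j \<Longrightarrow> s i j \<le> 0"
    and u: "\<And>i. i \<in> S \<Longrightarrow> u i > 0"
  shows "(\<Sum>i\<in>S. (\<Sum>j\<in>S. s i j * u j) / u i * (x i)\<^sup>2) \<le> (\<Sum>i\<in>S. \<Sum>j\<in>S. s i j * x i * x j)"
proof -
  have a: "(\<Sum>i\<in>S. (\<Sum>j\<in>S. s i j * u j) / u i * (x i)\<^sup>2) = (\<Sum>i\<in>S. \<Sum>j\<in>S. s i j * u j / u i * (x i)\<^sup>2)"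
    by (simp add: sum_distrib_right sum_divide_distrib)
  have b: "(\<Sum>i\<in>S. \<Sum>j\<in>S. s i j * u j / u i * (x i)\<^sup>2) = (\<Sum>i\<in>S. \<Sum>j\<in>S. s i j * u i / u j * (x j)\<^sup>2)"
    by (subst sum.swap) (intro sum.cong refl, simp add: sym)
  have c: "s i j * u j / u i * (x i)\<^sup>2 + s i j * u i / u j * (x j)\<^sup>2 \<le> 2 * (s i j * x i * x j)"
    if "i \<in> S" "j \<in> S" for i j
  proof (cases "i = j")
    case True then show ?thesis using u[of i] that by (simp add: power2_eq_square)
  next
    case False
    have "s i j * (u i * u j * (x i / u i - x j / u j)\<^sup>2) \<le> 0"
      using neg[of i j] False that u[of i] u[of j] by (intro mult_nonpos_nonneg) auto
    moreover have "u i * u j * (x i / u i - x j / u j)\<^sup>2 = u j / u i * (x i)\<^sup>2 + u i / u j * (x j)\<^sup>2 - 2 * x i * x j"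
      using u[of i] u[of j] that by (simp add: field_simps power2_eq_square)
    ultimately have "s i j * (u j / u i * (x i)\<^sup>2 + u i / u j * (x j)\<^sup>2 - 2 * x i * x j) \<le> 0" by simp
    then show ?thesis by (simp add: distrib_left right_diff_distrib mult.assoc mult.left_commute)
  qed
  have "2 * (\<Sum>i\<in>S. \<Sum>j\<in>S. s i j * u j / u i * (x i)\<^sup>2)
      = (\<Sum>i\<in>S. \<Sum>j\<in>S. s i j * u j / u i * (x i)\<^sup>2 + s i j * u i / u j * (x j)\<^sup>2)"
    using b by (simp add: sum.distrib)
  also have "\<dots> \<le> (\<Sum>i\<in>S. \<Sum>j\<in>S. 2 * (s i j * x i * x j))"
    using c by (intro sum_mono) auto
  also have "\<dots> = 2 * (\<Sum>i\<in>S. \<Sum>j\<in>S. s i j * x i * x j)"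
    by (simp add: sum_distrib_left)
  finally show ?thesis using a by linarith
qed


text \<open>Off-diagonal terms occur twice. This parity turns a positive integer into one that is at
  least 2 in the proof that roots have a sign.\<close>

lemma even_symmetric_sum:
  fixes f :: "nat \<Rightarrow> nat \<Rightarrow> int"
  assumes "finite S" "\<And>i j. i \<in> S \<Longrightarrow> j \<in> S \<Longrightarrow> f i j = f j i" "\<And>i. i \<in> S \<Longrightarrow> even (f i i)"
  shows "even (\<Sum>i\<in>S. \<Sum>j\<in>S. f i j)"
  using assms
proof (induction S rule: finite_induct)
  case (insert x F)
  have "(\<Sum>i\<in>F. f i x) = (\<Sum>i\<in>F. f x i)" by (rule sum.cong) (auto simp: insert)
  then have "(\<Sum>i\<in>insert x F. \<Sum>j\<in>insert x F. f i j)
      = f x x + 2 * (\<Sum>i\<in>F. f x i) + (\<Sum>i\<in>F. \<Sum>j\<in>F. f i j)"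
    using insert.hyps by (simp add: sum.distrib)
  then show ?case using insert by simp
qed simp

section \<open>The invariant form and the finite root system\<close>

locale finite_cartan =
  fixes n :: nat and A :: "nat \<Rightarrow> nat \<Rightarrow> int"
  assumes n1: "1 \<le> n" and ft: "finite_type (I0set n) A"
begin

abbreviation I0 :: "nat set" where "I0 \<equiv> I0set n"
abbreviation \<Delta> :: "(nat \<Rightarrow> int) set" where "\<Delta> \<equiv> froots n A"

lemma fin_I0 [simp]: "finite I0" by (simp add: I0set_def)
lemma I0_le: "i \<in> I0 \<Longrightarrow> i \<le> n" "i \<in> I0 \<Longrightarrow> 0 < i" by (auto simp: I0set_def)
lemma zero_notin_I0 [simp]: "0 \<notin> I0" by (simp add: I0set_def)
lemma one_in_I0: "1 \<in> I0" using n1 by (simp add: I0set_def)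
lemma A_diag [simp]: "i \<in> I0 \<Longrightarrow> A i i = 2"
  and A_nonpos: "i \<in> I0 \<Longrightarrow> j \<in> I0 \<Longrightarrow> i \<noteq> j \<Longrightarrow> A i j \<le> 0"
  and A_zero: "i \<in> I0 \<Longrightarrow> j \<in> I0 \<Longrightarrow> A i j = 0 \<longleftrightarrow> A j i = 0"
  using ft by (auto simp: finite_type_def is_GCM_def)

definition uu :: "nat \<Rightarrow> real" where
  "uu = (SOME u. (\<forall>i\<in>I0. u i > 0) \<and> (\<forall>i\<in>I0. (\<Sum>j\<in>I0. of_int (A i j) * u j) > 0))"
text \<open>In the form \<open>bil\<close> built from this symmetrizer, \<open>dd i\<close> is half
  the squared length of the simple root \<open>i\<close>.\<close>

definition dd :: "nat \<Rightarrow> real" where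
  "dd = (SOME d. (\<forall>i\<in>I0. d i > 0) \<and> (\<forall>i\<in>I0. \<forall>j\<in>I0. d i * of_int (A i j) = d j * of_int (A j i)))"

lemma uu: "\<forall>i\<in>I0. uu i > 0" "\<forall>i\<in>I0. (\<Sum>j\<in>I0. of_int (A i j) * uu j) > 0"
proof -
  have "\<exists>u :: nat \<Rightarrow> real. (\<forall>i\<in>I0. u i > 0) \<and> (\<forall>i\<in>I0. (\<Sum>j\<in>I0. of_int (A i j) * u j) > 0)"
    using ft by (simp add: finite_type_def)
  from someI_ex[OF this] show "\<forall>i\<in>I0. uu i > 0" "\<forall>i\<in>I0. (\<Sum>j\<in>I0. of_int (A i j) * uu j) > 0"
    unfolding uu_def by auto
qed

lemma dd: "i \<in> I0 \<Longrightarrow> dd i > 0" "i \<in> I0 \<Longrightarrow> j \<in> I0 \<Longrightarrow> dd i * of_int (A i j) = dd j * of_int (A j i)"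
proof -
  have "is_GCM I0 A" using ft by (simp add: finite_type_def)
  from gcm_symmetrizable[OF fin_I0 this uu]
  have "\<exists>d :: nat \<Rightarrow> real. (\<forall>i\<in>I0. d i > 0) \<and> (\<forall>i\<in>I0. \<forall>j\<in>I0. d i * of_int (A i j) = d j * of_int (A j i))" .
  from someI_ex[OF this] show "i \<in> I0 \<Longrightarrow> dd i > 0"
    "i \<in> I0 \<Longrightarrow> j \<in> I0 \<Longrightarrow> dd i * of_int (A i j) = dd j * of_int (A j i)"
    unfolding dd_def by auto
qed

text \<open>Here \<open>rt c\<close> is the weight of \<open>\<Sum> c\<^sub>j\<alpha>\<^sub>j\<close> in fundamental weight coordinates, \<open>ip v c\<close> and \<open>bil c c'\<close> are the
  invariant form, \<open>pr v c = \<langle>v, c\<^sup>\<or>\<rangle>\<close>, \<open>cf c g = \<langle>c, g\<^sup>\<or>\<rangle>\<close> (the floor is redundant when \<open>g\<close> is a root)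
  and \<open>rf g\<close> is the reflection in \<open>g\<close>.\<close>

definition ip :: "(nat \<Rightarrow> real) \<Rightarrow> (nat \<Rightarrow> int) \<Rightarrow> real" where
  "ip v c = (\<Sum>i\<in>I0. dd i * of_int (c i) * v i)"
definition rt :: "(nat \<Rightarrow> int) \<Rightarrow> nat \<Rightarrow> real" where
  "rt c = (\<lambda>i. if i \<le> n then \<Sum>j\<in>I0. of_int (A i j) * of_int (c j) else 0)"
definition bil :: "(nat \<Rightarrow> int) \<Rightarrow> (nat \<Rightarrow> int) \<Rightarrow> real" where
  "bil c c' = ip (rt c) c'"
definition pr :: "(nat \<Rightarrow> real) \<Rightarrow> (nat \<Rightarrow> int) \<Rightarrow> real" where
  "pr v c = 2 * ip v c / bil c c"
definition cf :: "(nat \<Rightarrow> int) \<Rightarrow> (nat \<Rightarrow> int) \<Rightarrow> int" where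
  "cf c g = \<lfloor>pr (rt c) g\<rfloor>"
definition rf :: "(nat \<Rightarrow> int) \<Rightarrow> (nat \<Rightarrow> int) \<Rightarrow> (nat \<Rightarrow> int)" where
  "rf g c = (\<lambda>k. c k - cf c g * g k)"

lemma ip_sub: "ip v (\<lambda>k. c k - m * c' k) = ip v c - of_int m * ip v c'"
  by (simp add: ip_def algebra_simps sum_subtractf sum_distrib_left)
lemma ip_neg: "ip v (\<lambda>k. - c k) = - ip v c"
  by (simp add: ip_def sum_negf)
lemma ip_vsub: "ip (\<lambda>k. v k - x * w k) c = ip v c - x * ip w c"
  by (simp add: ip_def algebra_simps sum_subtractf sum_distrib_left)
lemma rt_sub: "rt (\<lambda>k. c k - m * c' k) = (\<lambda>i. rt c i - of_int m * rt c' i)"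
  by (auto simp: rt_def algebra_simps sum_subtractf sum_distrib_left)
lemma rt_neg: "rt (\<lambda>k. - c k) = (\<lambda>i. - rt c i)"
  by (auto simp: rt_def sum_negf)

lemma bil_expand: "bil c c' = (\<Sum>i\<in>I0. \<Sum>j\<in>I0. dd i * of_int (A i j) * of_int (c' i) * of_int (c j))"
  unfolding bil_def ip_def
  by (intro sum.cong refl) (auto simp: rt_def I0_le sum_distrib_left algebra_simps intro!: sum.cong)

lemma bil_sym: "bil c c' = bil c' c"
  unfolding bil_expand by (subst sum.swap) (intro sum.cong refl, simp add: dd(2))

lemma bil_sub1: "bil (\<lambda>k. c k - m * c' k) e = bil c e - of_int m * bil c' e"
  by (simp add: bil_def rt_sub ip_vsub)
lemma bil_sub2: "bil e (\<lambda>k. c k - m * c' k) = bil e c - of_int m * bil e c'"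
  by (simp add: bil_def ip_sub)
lemma bil_neg [simp]: "bil (\<lambda>k. - c k) e = - bil c e" "bil e (\<lambda>k. - c k) = - bil e c"
proof -
  show "bil e (\<lambda>k. - c k) = - bil e c" for c e by (simp add: bil_def ip_neg)
  then show "bil (\<lambda>k. - c k) e = - bil c e" by (metis bil_sym)
qed

text \<open>The diagonal coefficients in \<open>symmetrized_form_lower_bound\<close> for the matrix
  \<open>dd i * A i j\<close>. They make positive definiteness quantitative, which also bounds the
  coefficients of roots.\<close>

definition eps :: "nat \<Rightarrow> real" where
  "eps i = (\<Sum>j\<in>I0. dd i * of_int (A i j) * uu j) / uu i"

lemma eps_pos: "i \<in> I0 \<Longrightarrow> eps i > 0"
proof -
  assume i: "i \<in> I0"
  have "(\<Sum>j\<in>I0. dd i * of_int (A i j) * uu j) = dd i * (\<Sum>j\<in>I0. of_int (A i j) * uu j)"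
    by (simp add: sum_distrib_left mult.assoc)
  then show ?thesis using uu dd(1)[OF i] i by (simp add: eps_def)
qed

lemma bil_lower: "(\<Sum>i\<in>I0. eps i * (of_int (c i))\<^sup>2) \<le> bil c c"
  unfolding bil_expand eps_def
  by (rule symmetrized_form_lower_bound)
    (use uu dd A_nonpos in \<open>auto simp: mult_nonneg_nonpos less_imp_le\<close>)

lemma bil_pos: assumes "k \<in> I0" "c k \<noteq> 0" shows "bil c c > 0"
proof -
  have "0 < eps k * (of_int (c k))\<^sup>2" using assms eps_pos by simp
  also have "\<dots> \<le> (\<Sum>i\<in>I0. eps i * (of_int (c i))\<^sup>2)"
    by (rule member_le_sum) (use assms eps_pos in \<open>auto simp: less_imp_le\<close>)
  also have "\<dots> \<le> bil c c" by (rule bil_lower)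
  finally show ?thesis .
qed

lemma unitv_simps [simp]: "unitv i i = 1" "k \<noteq> i \<Longrightarrow> unitv i k = 0" by (auto simp: unitv_def)

lemma ip_unitv: "i \<in> I0 \<Longrightarrow> ip v (unitv i) = dd i * v i"
proof -
  assume i: "i \<in> I0"
  have "ip v (unitv i) = (\<Sum>k\<in>I0. if k = i then dd i * v i else 0)"
    unfolding ip_def by (intro sum.cong) (auto simp: unitv_def)
  then show ?thesis using i by simp
qed

lemma rt_unitv: "i \<in> I0 \<Longrightarrow> rt (unitv i) = (\<lambda>k. if k \<le> n then of_int (A k i) else 0)"
proof -
  assume i: "i \<in> I0"
  have "(\<Sum>j\<in>I0. of_int (A k j) * of_int (unitv i j)) = (\<Sum>j\<in>I0. if j = i then of_int (A k j) else (0::real))" for k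
    by (intro sum.cong) (auto simp: unitv_def)
  then show ?thesis using i by (auto simp: rt_def)
qed

lemma bil_unitv: "i \<in> I0 \<Longrightarrow> bil c (unitv i) = dd i * rt c i"
  "i \<in> I0 \<Longrightarrow> bil (unitv i) c = dd i * rt c i"
  "i \<in> I0 \<Longrightarrow> bil (unitv i) (unitv i) = 2 * dd i"
  by (simp_all add: bil_sym[of _ c] del: One_nat_def) (simp_all add: bil_def ip_unitv rt_unitv I0_le)

lemma pr_unitv: "i \<in> I0 \<Longrightarrow> pr v (unitv i) = v i"
  using dd(1)[of i] by (simp add: pr_def bil_unitv(3) ip_unitv)

lemma rt_int: "i \<in> I0 \<Longrightarrow> rt c i = of_int (\<Sum>j\<in>I0. A i j * c j)"
  by (simp add: rt_def I0_le)

lemma frefl_eq: assumes "i \<in> I0" shows "frefl n A i c = rf (unitv i) c"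
proof -
  have "cf c (unitv i) = (\<Sum>j\<in>I0. A i j * c j)"
    unfolding cf_def pr_unitv[OF assms] rt_int[OF assms] by (rule floor_of_int)
  then show ?thesis by (auto simp: frefl_def rf_def unitv_def)
qed

lemma frefl_apply: "i \<in> I0 \<Longrightarrow> frefl n A i c = (\<lambda>k. c k - (\<Sum>j\<in>I0. A i j * c j) * unitv i k)"
  by (auto simp: frefl_def unitv_def)

lemma bil_frefl: assumes "i \<in> I0"
  shows "bil (frefl n A i c) (frefl n A i c') = bil c c'"
proof -
  define m where "m e = (\<Sum>j\<in>I0. A i j * e j)" for e
  have m: "real_of_int (m e) = rt e i" for e using rt_int[OF assms] by (simp add: m_def)
  show ?thesis
    unfolding frefl_apply[OF assms] bil_sub1 bil_sub2 m_def[symmetric] m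
    using assms by (simp add: bil_unitv rt_unitv I0_le algebra_simps)
qed

lemma frefl_invol: assumes "i \<in> I0" shows "frefl n A i (frefl n A i c) = c"
proof -
  have "(\<Sum>j\<in>I0. A i j * frefl n A i c j) = - (\<Sum>j\<in>I0. A i j * c j)"
  proof -
    have "rt (frefl n A i c) i = - rt c i"
      using assms rt_int[OF assms, of c] by (simp add: frefl_apply rt_sub rt_unitv I0_le)
    then show ?thesis unfolding rt_int[OF assms] by linarith
  qed
  then show ?thesis using assms by (subst frefl_apply) (auto simp: frefl_def unitv_def)
qed

lemma unitv_root: "i \<in> I0 \<Longrightarrow> unitv i \<in> \<Delta>"
  unfolding froots_def by (auto intro!: exI[of _ "[]"] exI[of _ i] simp: fword_def)

lemma frefl_root: assumes "c \<in> \<Delta>" "i \<in> I0" shows "frefl n A i c \<in> \<Delta>"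
proof -
  obtain ws j where "c = fword n A ws (unitv j)" "set ws \<subseteq> I0" "j \<in> I0"
    using assms by (auto simp: froots_def)
  then show ?thesis using assms(2) unfolding froots_def
    by (auto intro!: exI[of _ "i # ws"] exI[of _ j] simp: fword_def)
qed

lemma root_induct [consumes 1, case_names unit refl]:
  assumes "c \<in> \<Delta>" "\<And>i. i \<in> I0 \<Longrightarrow> P (unitv i)"
    "\<And>c i. c \<in> \<Delta> \<Longrightarrow> i \<in> I0 \<Longrightarrow> P c \<Longrightarrow> P (frefl n A i c)"
  shows "P c"
proof -
  have "fword n A ws (unitv j) \<in> \<Delta> \<and> P (fword n A ws (unitv j))" if "set ws \<subseteq> I0" "j \<in> I0" for ws j
    using that
  proof (induction ws)
    case Nil
    then show ?case using assms(2) unitv_root by (simp add: fword_def)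
  next
    case (Cons a ws)
    then show ?case using assms(3)[of "fword n A ws (unitv j)" a] frefl_root by (simp add: fword_def)
  qed
  then show ?thesis using assms(1) by (auto simp: froots_def)
qed

lemma root_supp: "c \<in> \<Delta> \<Longrightarrow> k \<notin> I0 \<Longrightarrow> c k = 0"
proof (induction rule: root_induct)
  case (unit i) then show ?case by (auto simp: unitv_def)
next
  case (refl c i) then show ?case by (auto simp: frefl_def)
qed

lemma root_norm: "c \<in> \<Delta> \<Longrightarrow> \<exists>i\<in>I0. bil c c = 2 * dd i"
proof (induction rule: root_induct)
  case (unit i) then show ?case using bil_unitv(3) by blast
next
  case (refl c i) then show ?case by (simp add: bil_frefl)
qed

lemma root_bil_pos: "c \<in> \<Delta> \<Longrightarrow> bil c c > 0"
  using root_norm dd(1) by fastforce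

lemma root_nz: "c \<in> \<Delta> \<Longrightarrow> \<exists>k\<in>I0. c k \<noteq> 0"
proof (rule ccontr)
  assume "c \<in> \<Delta>" "\<not> (\<exists>k\<in>I0. c k \<noteq> 0)"
  then show False using root_bil_pos[of c] by (simp add: bil_expand)
qed

text \<open>The coroot is \<open>2 c / (c, c)\<close> up to rescaling the coordinates by
  \<open>dd\<close>, an expression that depends on the root alone. Hence the definite description in
  \<open>fcoroot\<close> is well defined.\<close>

lemma fcoword_eq:
  assumes "set ws \<subseteq> I0" "i \<in> I0"
  shows "of_int (fcoword n A ws (unitv i) k) = 2 * dd k * of_int (fword n A ws (unitv i) k) / bil (fword n A ws (unitv i)) (fword n A ws (unitv i))"
  using assms
proof (induction ws arbitrary: k)
  case Nil
  then show ?case using dd(1)[of i] by (cases "k = i") (simp_all add: fword_def fcoword_def bil_unitv(3))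
next
  case (Cons j ws)
  let ?c = "fword n A ws (unitv i)" and ?h = "fcoword n A ws (unitv i)"
  have j: "j \<in> I0" and IH: "of_int (?h k) = 2 * dd k * of_int (?c k) / bil ?c ?c" for k
    using Cons by auto
  have s: "(\<Sum>l\<in>I0. of_int (A l j) * of_int (?h l)) = 2 * dd j * (\<Sum>l\<in>I0. of_int (A j l) * of_int (?c l)) / bil ?c ?c"
  proof -
    have "of_int (A l j) * (of_int (?h l) :: real) = 2 * dd j * (of_int (A j l) * of_int (?c l)) / bil ?c ?c"
      if "l \<in> I0" for l
    proof -
      have "of_int (A l j) * (of_int (?h l) :: real) = 2 * (dd l * of_int (A l j)) * of_int (?c l) / bil ?c ?c"
        by (simp add: IH)
      then show ?thesis using dd(2)[OF that j] by simp
    qed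
    then have "(\<Sum>l\<in>I0. of_int (A l j) * of_int (?h l)) = (\<Sum>l\<in>I0. 2 * dd j * (of_int (A j l) * of_int (?c l)) / bil ?c ?c)"
      by (intro sum.cong) auto
    then show ?thesis by (simp add: sum_distrib_left sum_divide_distrib)
  qed
  have b: "bil (frefl n A j ?c) (frefl n A j ?c) = bil ?c ?c" using bil_frefl[OF j] .
  have "of_int (fcorefl n A j ?h k) = 2 * dd k * of_int (frefl n A j ?c k) / bil ?c ?c"
  proof (cases "k = j")
    case True
    then show ?thesis using s by (simp add: fcorefl_def frefl_def IH right_diff_distrib diff_divide_distrib)
  next
    case False
    then show ?thesis by (simp add: fcorefl_def frefl_def IH)
  qed
  then show ?case using b by (simp add: fword_def fcoword_def)
qed

lemma fcoroot_eq:
  assumes "c \<in> \<Delta>"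
  shows "of_int (fcoroot n A c k) = 2 * dd k * of_int (c k) / bil c c"
proof -
  obtain ws j where ws: "c = fword n A ws (unitv j)" "set ws \<subseteq> I0" "j \<in> I0"
    using assms by (auto simp: froots_def)
  have "fcoroot n A c = fcoword n A ws (unitv j)"
    unfolding fcoroot_def
  proof (rule the_equality)
    show "\<exists>ws' i. set ws' \<subseteq> I0 \<and> i \<in> I0 \<and> c = fword n A ws' (unitv i) \<and> fcoword n A ws (unitv j) = fcoword n A ws' (unitv i)"
      using ws by blast
  next
    fix h assume "\<exists>ws i. set ws \<subseteq> I0 \<and> i \<in> I0 \<and> c = fword n A ws (unitv i) \<and> h = fcoword n A ws (unitv i)"
    then obtain ws' i where "set ws' \<subseteq> I0" "i \<in> I0" "c = fword n A ws' (unitv i)" "h = fcoword n A ws' (unitv i)" by blast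
    then have "real_of_int (h k) = of_int (fcoword n A ws (unitv j) k)" for k
      using fcoword_eq[of ws j] fcoword_eq[of ws' i] ws by metis
    then show "h = fcoword n A ws (unitv j)" by auto
  qed
  then show ?thesis using fcoword_eq[of ws j] ws by simp
qed

lemma pr_coroot: "c \<in> \<Delta> \<Longrightarrow> pr v c = (\<Sum>i\<in>I0. of_int (fcoroot n A c i) * v i)"
  by (simp add: pr_def ip_def fcoroot_eq sum_distrib_left sum_divide_distrib algebra_simps)

lemma cf: assumes "g \<in> \<Delta>" shows "pr (rt c) g = of_int (cf c g)"
proof -
  have "pr (rt c) g = of_int (\<Sum>i\<in>I0. fcoroot n A g i * (\<Sum>j\<in>I0. A i j * c j))"
    unfolding pr_coroot[OF assms] of_int_sum of_int_mult
    by (intro sum.cong refl) (simp add: rt_def I0_le)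
  then show ?thesis unfolding cf_def by (simp only: floor_of_int)
qed

lemma bil_cf: "g \<in> \<Delta> \<Longrightarrow> 2 * bil c g = of_int (cf c g) * bil g g"
  using cf[of g c] root_bil_pos[of g] by (simp add: pr_def bil_def field_simps)

text \<open>Split \<open>c = p - q\<close> into its positive and negative parts. Since both \<open>c\<close> and \<open>c\<^sup>\<or>\<close> are integral,
  \<open>2 (p,p)/(c,c)\<close> and \<open>2 (q,q)/(c,c)\<close> are even positive integers if \<open>p, q \<noteq> 0\<close>, and \<open>(p,q) \<le> 0\<close>; so \<open>(c,c) \<ge> 2 (c,c)\<close>.\<close>

lemma root_sign: assumes c: "c \<in> \<Delta>" shows "(\<forall>k. 0 \<le> c k) \<or> (\<forall>k. c k \<le> 0)"
proof (rule ccontr)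
  assume "\<not> ?thesis"
  then obtain k l where kl: "c k < 0" "c l > 0" by (meson not_le)
  then have klI: "k \<in> I0" "l \<in> I0" using root_supp[OF c] by fastforce+
  define p where "p i = max (c i) 0" for i
  define q where "q i = max (- c i) 0" for i
  have cpq: "c = (\<lambda>i. p i - 1 * q i)" by (auto simp: p_def q_def)
  have B: "bil c c > 0" using root_bil_pos[OF c] .
  have large: "bil e e \<ge> bil c c" if e: "\<And>i. e i = 0 \<or> e i = s * c i" "\<bar>s\<bar> = 1" "e m \<noteq> 0" "m \<in> I0" for e s m
  proof -
    define h where "h i = (if e i = 0 then 0 else s * fcoroot n A c i)" for i
    have h: "2 * dd i * of_int (e i) = bil c c * of_int (h i)" for i
      using e(1)[of i] B fcoroot_eq[OF c, of i] by (auto simp: h_def field_simps)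
    define f where "f i j = h i * A i j * e j" for i j
    have ff: "2 * (dd i * of_int (A i j) * of_int (e i) * of_int (e j)) = bil c c * of_int (f i j)" for i j
      using h[of i] by (simp add: f_def algebra_simps)
    have "f i j = f j i" if "i \<in> I0" "j \<in> I0" for i j
    proof -
      have "bil c c * of_int (f i j) = bil c c * of_int (f j i)"
        unfolding ff[symmetric] dd(2)[OF that] by (simp add: mult_ac)
      then show ?thesis using B by simp
    qed
    then have "even (\<Sum>i\<in>I0. \<Sum>j\<in>I0. f i j)"
      by (intro even_symmetric_sum) (auto simp: f_def)
    moreover
    have eq: "2 * bil e e = bil c c * of_int (\<Sum>i\<in>I0. \<Sum>j\<in>I0. f i j)"
      unfolding bil_expand[of e] of_int_sum sum_distrib_left ff ..
    have "bil e e > 0" using bil_pos[where k=m and c=e] e(3,4) by blast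
    then have "0 < bil c c * of_int (\<Sum>i\<in>I0. \<Sum>j\<in>I0. f i j)" using eq by linarith
    then have "0 < (\<Sum>i\<in>I0. \<Sum>j\<in>I0. f i j)"
      using B by (simp only: zero_less_mult_iff of_int_0_less_iff) linarith
    ultimately have "2 \<le> (\<Sum>i\<in>I0. \<Sum>j\<in>I0. f i j)" by (intro zdvd_imp_le)
    then have "bil c c * 2 \<le> bil c c * of_int (\<Sum>i\<in>I0. \<Sum>j\<in>I0. f i j)"
      using B by (intro mult_left_mono) linarith+
    then show ?thesis using eq by simp
  qed
  have 1: "bil p p \<ge> bil c c" by (rule large[of p 1 l]) (use kl klI in \<open>auto simp: p_def\<close>)
  have 2: "bil q q \<ge> bil c c" by (rule large[of q "-1" k]) (use kl klI in \<open>auto simp: q_def\<close>)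
  have 3: "bil p q \<le> 0" unfolding bil_expand
  proof (intro sum_nonpos)
    fix i j assume ij: "i \<in> I0" "j \<in> I0"
    show "dd i * of_int (A i j) * of_int (q i) * of_int (p j) \<le> 0"
    proof (cases "i = j")
      case True
      then have "q i * p j = 0" by (auto simp: p_def q_def max_def)
      then show ?thesis by auto
    next
      case False
      then have "dd i * of_int (A i j) \<le> 0" using A_nonpos[OF ij] dd(1)[OF ij(1)]
        by (simp add: mult_nonneg_nonpos)
      moreover have "0 \<le> real_of_int (q i)" "0 \<le> real_of_int (p j)" by (auto simp: p_def q_def)
      ultimately show ?thesis by (simp add: mult_nonpos_nonneg)
    qed
  qed
  have "bil c c = bil p p - 2 * bil p q + bil q q"
    by (subst (1 2) cpq, subst bil_sub1, subst (1 2) bil_sub2) (simp add: bil_sym[of q p])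
  then show False using 1 2 3 B by linarith
qed

lemma finite_roots: "finite \<Delta>"
proof -
  \<comment> \<open>Every root has the norm of some simple root, so \<open>M\<close> bounds all
    norms. Sums of nonnegative terms stand in for maxima in \<open>M\<close> and
    \<open>K\<close>.\<close>
  define M where "M = (\<Sum>i\<in>I0. 2 * dd i)"
  define K where "K = (\<Sum>i\<in>I0. M / eps i)"
  have dM: "2 * dd i \<le> M" if "i \<in> I0" for i unfolding M_def
    by (rule member_le_sum[where f="\<lambda>i. 2 * dd i"]) (use that dd(1) in \<open>auto simp: less_imp_le\<close>)
  have M0: "0 \<le> M" unfolding M_def using dd(1) by (intro sum_nonneg) (auto simp: less_imp_le)
  have "c \<in> {f. \<forall>x. (x \<in> I0 \<longrightarrow> f x \<in> {-\<lceil>K\<rceil>..\<lceil>K\<rceil>}) \<and> (x \<notin> I0 \<longrightarrow> f x = 0)}" if c: "c \<in> \<Delta>" for c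
  proof -
    have "c x \<in> {-\<lceil>K\<rceil>..\<lceil>K\<rceil>}" if x: "x \<in> I0" for x
    proof -
      have "eps x * (of_int (c x))\<^sup>2 \<le> (\<Sum>i\<in>I0. eps i * (of_int (c i))\<^sup>2)"
        by (rule member_le_sum[where f="\<lambda>i. eps i * (of_int (c i))\<^sup>2"]) (use x eps_pos in \<open>auto simp: less_imp_le\<close>)
      also have "\<dots> \<le> M" using bil_lower[of c] root_norm[OF c] dM by fastforce
      finally have "(of_int (c x))\<^sup>2 \<le> M / eps x" using eps_pos[OF x] by (simp add: field_simps)
      also have "\<dots> \<le> K" unfolding K_def
        by (rule member_le_sum[where f="\<lambda>i. M / eps i"]) (use x eps_pos M0 in \<open>auto simp: less_imp_le\<close>)
      finally have "real_of_int ((c x)\<^sup>2) \<le> K" by simp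
      then have "(c x)\<^sup>2 \<le> \<lceil>K\<rceil>" by linarith
      moreover have "\<bar>c x\<bar> \<le> (c x)\<^sup>2"
      proof (cases "c x = 0")
        case False
        then have "\<bar>c x\<bar> * 1 \<le> \<bar>c x\<bar> * \<bar>c x\<bar>" by (intro mult_left_mono) auto
        then show ?thesis by (simp add: power2_eq_square)
      qed simp
      ultimately show ?thesis by auto
    qed
    then show ?thesis using root_supp[OF c] by auto
  qed
  then have "\<Delta> \<subseteq> {f. \<forall>x. (x \<in> I0 \<longrightarrow> f x \<in> {-\<lceil>K\<rceil>..\<lceil>K\<rceil>}) \<and> (x \<notin> I0 \<longrightarrow> f x = 0)}" by blast
  then show ?thesis by (rule finite_subset) (intro finite_set_of_finite_funs, auto)
qed

lemma rt_rf: "g \<in> \<Delta> \<Longrightarrow> rt (rf g c) = (\<lambda>i. rt c i - pr (rt c) g * rt g i)"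
  by (simp add: rf_def rt_sub cf)

lemma bil_rf:
  assumes "g \<in> \<Delta>" shows "bil (rf g c) (rf g c') = bil c c'"
proof -
  have g: "bil g g > 0" using root_bil_pos[OF assms] .
  have a: "of_int (cf e g) = 2 * bil e g / bil g g" for e
    using bil_cf[OF assms, of e] g by (simp add: field_simps)
  have "bil (rf g c) (rf g c') = bil c c' - of_int (cf c' g) * bil c g - of_int (cf c g) * (bil c' g - of_int (cf c' g) * bil g g)"
    unfolding rf_def bil_sub1 bil_sub2 bil_sym[of g c'] by (simp add: algebra_simps)
  also have "\<dots> = bil c c'" unfolding a using g by (simp add: field_simps)
  finally show ?thesis .
qed

lemma cf_eq_bil: "g \<in> \<Delta> \<Longrightarrow> of_int (cf c g) = 2 * bil c g / bil g g"
  using bil_cf[of g c] root_bil_pos[of g] by (simp add: field_simps)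

lemma cf_self [simp]: "g \<in> \<Delta> \<Longrightarrow> cf g g = 2"
  using cf_eq_bil[of g g] root_bil_pos[of g] by simp

lemma cf_neg1: "g \<in> \<Delta> \<Longrightarrow> cf (\<lambda>k. - c k) g = - cf c g"
proof -
  assume "g \<in> \<Delta>"
  then have "real_of_int (cf (\<lambda>k. - c k) g) = of_int (- cf c g)" by (simp add: cf_eq_bil)
  then show ?thesis by linarith
qed

lemma rf_self: "g \<in> \<Delta> \<Longrightarrow> rf g g = (\<lambda>k. - g k)" by (auto simp: rf_def)

lemma cf_sub1: "g \<in> \<Delta> \<Longrightarrow> cf (\<lambda>k. c k - m * c' k) g = cf c g - m * cf c' g"
proof -
  assume g: "g \<in> \<Delta>"
  then have "real_of_int (cf (\<lambda>k. c k - m * c' k) g) = of_int (cf c g - m * cf c' g)"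
    by (simp add: cf_eq_bil bil_sub1 diff_divide_distrib)
  then show ?thesis by linarith
qed

lemma rf_invol: "g \<in> \<Delta> \<Longrightarrow> rf g (rf g c) = c"
  unfolding rf_def cf_sub1 by (simp add: algebra_simps)

text \<open>Conjugation of reflections: it carries stability of the set of roots from simple
  reflections to reflections in arbitrary roots.\<close>

lemma rf_rf_eq:
  assumes "g \<in> \<Delta>" "h \<in> \<Delta>" "rf g h \<in> \<Delta>"
  shows "rf (rf g h) c = rf g (rf h (rf g c))"
proof -
  have "bil c (rf g h) = bil (rf g c) h"
    using bil_rf[OF assms(1), of "rf g c" h] rf_invol[OF assms(1)] by simp
  moreover have "bil (rf g h) (rf g h) = bil h h" using bil_rf[OF assms(1)] .
  ultimately have "real_of_int (cf c (rf g h)) = of_int (cf (rf g c) h)"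
    by (simp add: cf_eq_bil assms)
  then have e: "cf c (rf g h) = cf (rf g c) h" by linarith
  have "rf h (rf g c) = (\<lambda>k. rf g c k - cf (rf g c) h * h k)" by (simp add: rf_def)
  then have "rf g (rf h (rf g c)) = (\<lambda>k. (rf g c k - cf (rf g c) h * h k) - (cf (rf g c) g - cf (rf g c) h * cf h g) * g k)"
    unfolding rf_def[of g "rf h (rf g c)"] by (simp only: cf_sub1[OF assms(1)])
  also have "\<dots> = (\<lambda>k. rf g (rf g c) k - cf (rf g c) h * rf g h k)"
    unfolding rf_def[of g "rf g c"] rf_def[of g h] by (auto simp: algebra_simps)
  finally show ?thesis using e rf_invol[OF assms(1)] by (simp add: rf_def[of "rf g h"])
qed

lemma rf_root: "g \<in> \<Delta> \<Longrightarrow> c \<in> \<Delta> \<Longrightarrow> rf g c \<in> \<Delta>"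
proof (induction g arbitrary: c rule: root_induct)
  case (unit i) then show ?case using frefl_root[of c i] by (simp add: frefl_eq)
next
  case (refl g i)
  note i = \<open>i \<in> I0\<close>
  have u: "unitv i \<in> \<Delta>" using unitv_root[OF i] .
  have r: "rf (unitv i) g \<in> \<Delta>" using frefl_root[OF refl(1) i] frefl_eq[OF i] by simp
  have "rf (frefl n A i g) c = frefl n A i (rf g (frefl n A i c))"
    using rf_rf_eq[OF u refl(1) r] by (simp add: frefl_eq[OF i])
  then show ?case using refl i frefl_root by simp
qed

lemma neg_root: "g \<in> \<Delta> \<Longrightarrow> (\<lambda>k. - g k) \<in> \<Delta>"
  using rf_root[of g g] rf_self by metis

lemma cf_neg2: "g \<in> \<Delta> \<Longrightarrow> cf c (\<lambda>k. - g k) = - cf c g"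
proof -
  assume g: "g \<in> \<Delta>"
  then have "real_of_int (cf c (\<lambda>k. - g k)) = of_int (- cf c g)" by (simp add: cf_eq_bil neg_root)
  then show ?thesis by linarith
qed

lemma rf_neg: "g \<in> \<Delta> \<Longrightarrow> rf (\<lambda>k. - g k) = rf g"
  by (auto simp: rf_def cf_neg2 fun_eq_iff)

lemma rf_neg2: "g \<in> \<Delta> \<Longrightarrow> rf g (\<lambda>k. - c k) = (\<lambda>k. - rf g c k)"
  by (auto simp: rf_def cf_neg1 fun_eq_iff)

definition \<Delta>p :: "(nat \<Rightarrow> int) set" where "\<Delta>p = {c \<in> \<Delta>. \<forall>k. 0 \<le> c k}"

lemma \<Delta>p_root: "c \<in> \<Delta>p \<Longrightarrow> c \<in> \<Delta>" by (simp add: \<Delta>p_def)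
lemma finite_\<Delta>p: "finite \<Delta>p" using finite_roots by (simp add: \<Delta>p_def)

lemma \<Delta>p_cases: "c \<in> \<Delta> \<Longrightarrow> c \<in> \<Delta>p \<or> (\<lambda>k. - c k) \<in> \<Delta>p"
  using root_sign[of c] neg_root by (auto simp: \<Delta>p_def)

lemma \<Delta>p_exc: "c \<in> \<Delta>p \<Longrightarrow> (\<lambda>k. - c k) \<notin> \<Delta>p"
  using root_nz[of c] by (auto simp: \<Delta>p_def) (metis order_antisym)

lemma unitv_pos: "i \<in> I0 \<Longrightarrow> unitv i \<in> \<Delta>p"
  using unitv_root by (auto simp: \<Delta>p_def unitv_def)

text \<open>A multiple \<open>m\<close> of a simple root would have coroot coefficient
  \<open>1 / m\<close>, which must be an integer.\<close>

lemma root_multiple_unitv: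
  assumes c: "c \<in> \<Delta>" and i: "i \<in> I0" and z: "\<And>k. k \<noteq> i \<Longrightarrow> c k = 0" and p: "c i \<ge> 0"
  shows "c = unitv i"
proof -
  have ci: "c i > 0" using root_nz[OF c] z p by (metis order_le_less)
  have eq: "c = (\<lambda>k. 0 - (- c i) * unitv i k)" using z by (auto simp: unitv_def)
  have "bil c c = (of_int (c i))\<^sup>2 * bil (unitv i) (unitv i)"
  proof -
    have zero: "bil (\<lambda>k. 0) e = 0" "bil e (\<lambda>k. 0) = 0" for e by (simp_all add: bil_expand)
    show ?thesis by (subst (1 2) eq, simp only: bil_sub1 bil_sub2 zero) (simp add: power2_eq_square)
  qed
  then have "of_int (fcoroot n A c i) = 1 / real_of_int (c i)"
    using ci dd(1)[OF i] by (simp add: fcoroot_eq[OF c] bil_unitv(3)[OF i] power2_eq_square)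
  then have "real_of_int (fcoroot n A c i * c i) = 1" using ci by simp
  then have "fcoroot n A c i * c i = 1" by linarith
  then have "c i = 1" using ci zmult_eq_1_iff[of "fcoroot n A c i" "c i"] by auto
  then show ?thesis using z by (auto simp: unitv_def)
qed

text \<open>Only the coefficient at \<open>i\<close> changes. Some other coefficient is positive and
  stays so, and a root has constant sign.\<close>

lemma frefl_pos: assumes c: "c \<in> \<Delta>p" and i: "i \<in> I0" and ne: "c \<noteq> unitv i"
  shows "rf (unitv i) c \<in> \<Delta>p"
proof -
  have cR: "c \<in> \<Delta>" "\<And>k. 0 \<le> c k" using c by (auto simp: \<Delta>p_def)
  obtain k where k: "k \<noteq> i" "c k \<noteq> 0" using root_multiple_unitv[OF cR(1) i] cR(2) ne by blast
  then have "rf (unitv i) c k > 0" using cR(2)[of k] by (simp add: rf_def)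
  moreover have "rf (unitv i) c \<in> \<Delta>" using rf_root[OF unitv_root[OF i] cR(1)] .
  ultimately show ?thesis using root_sign[of "rf (unitv i) c"] by (auto simp: \<Delta>p_def not_less[symmetric])
qed

text \<open>Otherwise the difference would be a nonzero vector in the radical of a positive definite
  form.\<close>

lemma rt_inj:
  assumes "\<And>i. i \<in> I0 \<Longrightarrow> rt c i = rt c' i" "\<And>k. k \<notin> I0 \<Longrightarrow> c k = c' k"
  shows "c = c'"
proof (rule ccontr)
  assume "c \<noteq> c'"
  then obtain k where k: "c k \<noteq> c' k" by auto
  then have "k \<in> I0" using assms(2) by blast
  then have "bil (\<lambda>k. c k - 1 * c' k) (\<lambda>k. c k - 1 * c' k) > 0" using k by (intro bil_pos[of k]) auto
  moreover have "bil (\<lambda>k. c k - 1 * c' k) e = 0" for e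
    unfolding bil_def ip_def rt_sub using assms(1) by simp
  ultimately show False by simp
qed

lemma root_rt_inj: "c \<in> \<Delta> \<Longrightarrow> c' \<in> \<Delta> \<Longrightarrow> rt c = rt c' \<Longrightarrow> c = c'"
  using rt_inj[of c c'] root_supp by metis

section \<open>The highest root\<close>

abbreviation ht :: "(nat \<Rightarrow> int) \<Rightarrow> int" where "ht c \<equiv> fheight n c"

lemma ht_sub: "ht (\<lambda>k. c k - m * c' k) = ht c - m * ht c'"
  by (simp add: fheight_def sum_subtractf sum_distrib_left)
lemma ht_neg: "ht (\<lambda>k. - c k) = - ht c"
  by (simp add: fheight_def sum_negf)
lemma ht_unitv: "i \<in> I0 \<Longrightarrow> ht (unitv i) = 1"
  by (simp add: fheight_def unitv_def)

lemma ht_pos: assumes "c \<in> \<Delta>p" shows "ht c > 0"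
proof -
  obtain k where "k \<in> I0" "c k \<noteq> 0" using root_nz[OF \<Delta>p_root[OF assms]] by blast
  then show ?thesis unfolding fheight_def
    using assms by (intro sum_pos2[of _ k]) (auto simp: \<Delta>p_def order_less_le)
qed

lemma pos_iff_ht: "c \<in> \<Delta> \<Longrightarrow> c \<in> \<Delta>p \<longleftrightarrow> ht c > 0"
  using \<Delta>p_cases[of c] ht_pos[of c] ht_pos[of "\<lambda>k. - c k"] by (auto simp: ht_neg)

lemma ht_nz: "c \<in> \<Delta> \<Longrightarrow> ht c \<noteq> 0"
  using \<Delta>p_cases[of c] ht_pos[of c] ht_pos[of "\<lambda>k. - c k"] by (auto simp: ht_neg)

text \<open>If both pairings were at least 2, then \<open>s - t\<close> would have nonpositive norm.
  So one of them is 1, and the corresponding reflection yields the difference up to sign.\<close>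

lemma sub_root:
  assumes s: "s \<in> \<Delta>" and t: "t \<in> \<Delta>" and p: "bil s t > 0" and ne: "s \<noteq> t"
  shows "(\<lambda>k. s k - t k) \<in> \<Delta>"
proof -
  have ps: "cf s t > 0"
  proof -
    have "real_of_int (cf s t) > 0" using p root_bil_pos[OF t] by (simp add: cf_eq_bil t)
    then show ?thesis by linarith
  qed
  have pt: "cf t s > 0"
  proof -
    have "real_of_int (cf t s) > 0" using p root_bil_pos[OF s] by (simp add: cf_eq_bil s bil_sym[of t s])
    then show ?thesis by linarith
  qed
  have "cf s t = 1 \<or> cf t s = 1"
  proof (rule ccontr)
    assume "\<not> ?thesis"
    then have "2 \<le> cf s t" "2 \<le> cf t s" using ps pt by linarith+
    then have "2 * bil t t \<le> of_int (cf s t) * bil t t" "2 * bil s s \<le> of_int (cf t s) * bil s s"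
      using root_bil_pos[OF s] root_bil_pos[OF t] by (auto intro!: mult_right_mono)
    then have "bil t t \<le> bil s t" "bil s s \<le> bil s t"
      using bil_cf[OF t, of s] bil_cf[OF s, of t] by (auto simp: bil_sym[of t s])
    then have le: "bil (\<lambda>k. s k - 1 * t k) (\<lambda>k. s k - 1 * t k) \<le> 0"
      by (simp only: bil_sub1 bil_sub2) (simp add: bil_sym[of t s])
    obtain k where k: "s k \<noteq> t k" using ne by auto
    then have "k \<in> I0" using root_supp[OF s] root_supp[OF t] by metis
    then have "bil (\<lambda>k. s k - 1 * t k) (\<lambda>k. s k - 1 * t k) > 0"
      using k by (intro bil_pos[of k]) auto
    then show False using le by simp
  qed
  then show ?thesis
  proof
    assume "cf s t = 1"
    then show ?thesis using rf_root[OF t s] by (simp add: rf_def)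
  next
    assume "cf t s = 1"
    then have "(\<lambda>k. t k - s k) \<in> \<Delta>" using rf_root[OF s t] by (simp add: rf_def)
    from neg_root[OF this] show ?thesis by simp
  qed
qed

lemma dominant_bil_pos:
  assumes "s \<in> \<Delta>" "\<And>i. i \<in> I0 \<Longrightarrow> rt s i \<ge> 0" "\<And>i. i \<in> I0 \<Longrightarrow> t i > 0"
  shows "bil s t > 0"
proof -
  have "\<exists>i\<in>I0. rt s i \<noteq> 0"
  proof (rule ccontr)
    assume "\<not> ?thesis"
    then have "bil s s = 0" by (simp add: bil_def ip_def)
    then show False using root_bil_pos[OF assms(1)] by simp
  qed
  then obtain i where "i \<in> I0" "rt s i > 0" using assms(2) by (metis order_less_le)
  then show ?thesis unfolding bil_def ip_def
    using assms dd(1) by (intro sum_pos2[of _ i]) (auto simp: less_imp_le)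
qed

lemma ht_frefl: "i \<in> I0 \<Longrightarrow> real_of_int (ht (rf (unitv i) c)) = ht c - rt c i"
proof -
  assume i: "i \<in> I0"
  have "real_of_int (cf c (unitv i)) = rt c i" using cf[OF unitv_root[OF i], of c] pr_unitv[OF i] by simp
  then show ?thesis using i by (simp add: rf_def ht_sub ht_unitv)
qed

text \<open>A simple reflection cannot raise the height, which gives dominance. If the support were
  proper, indecomposability would give an adjacent node outside it, and there the pairing would be
  negative.\<close>

lemma max_root:
  assumes t: "t \<in> \<Delta>" and mx: "\<And>b. b \<in> \<Delta> \<Longrightarrow> ht b \<le> ht t"
  shows "\<And>i. i \<in> I0 \<Longrightarrow> rt t i \<ge> 0" "\<And>i. i \<in> I0 \<Longrightarrow> t i > 0" "t \<in> \<Delta>p"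
proof -
  show dom: "rt t i \<ge> 0" if "i \<in> I0" for i
  proof -
    have "ht (rf (unitv i) t) \<le> ht t" using mx rf_root[OF unitv_root[OF that] t] by blast
    then show ?thesis using ht_frefl[OF that, of t] by linarith
  qed
  have "ht t \<ge> 0" using mx[OF neg_root[OF t]] by (simp add: ht_neg)
  then show tp: "t \<in> \<Delta>p" using pos_iff_ht[OF t] ht_nz[OF t] by linarith
  then have t0: "\<And>k. t k \<ge> 0" by (simp add: \<Delta>p_def)
  define T where "T = {i\<in>I0. t i > 0}"
  have "T = I0"
  proof (rule ccontr)
    assume "T \<noteq> I0"
    moreover have "T \<noteq> {}" using root_nz[OF t] t0 unfolding T_def by (metis (mono_tags, lifting) empty_iff mem_Collect_eq order_less_le)
    moreover have "T \<subseteq> I0" by (auto simp: T_def)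
    ultimately obtain i j where ij: "i \<in> T" "j \<in> I0 - T" "A i j \<noteq> 0"
      using ft unfolding finite_type_def indecomposable_def by blast
    have ijI: "i \<in> I0" "j \<in> I0" "i \<noteq> j" using ij by (auto simp: T_def)
    have tj: "t j = 0" using ij t0[of j] by (auto simp: T_def)
    have "A j i < 0" using A_nonpos[of j i] A_zero[of i j] ijI ij(3) by force
    have "rt t j = (\<Sum>k\<in>I0. of_int (A j k * t k))" using ijI by (simp add: rt_def I0_le)
    also have "\<dots> < (\<Sum>k\<in>I0. 0)"
    proof (rule sum_strict_mono_ex1)
      show "\<forall>k\<in>I0. real_of_int (A j k * t k) \<le> 0"
      proof
        fix k assume k: "k \<in> I0"
        show "real_of_int (A j k * t k) \<le> 0"
          using tj t0[of k] A_nonpos[OF ijI(2) k] by (cases "k = j") (auto intro: mult_nonpos_nonneg)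
      qed
      show "\<exists>k\<in>I0. real_of_int (A j k * t k) < 0"
        using ijI ij \<open>A j i < 0\<close> by (intro bexI[of _ i]) (auto simp: T_def mult_neg_pos)
    qed simp
    finally show False using dom[OF ijI(2)] by simp
  qed
  then show "\<And>i. i \<in> I0 \<Longrightarrow> t i > 0" by (auto simp: T_def)
qed

definition \<theta> :: "nat \<Rightarrow> int" where "\<theta> = fhighest n A"

text \<open>Two roots of maximal height have positive inner product, by dominance and full support,
  so their difference would be a root of height 0. This uniqueness is what evaluates
  \<open>fhighest\<close>.\<close>

lemma theta: "\<theta> \<in> \<Delta>" "\<And>b. b \<in> \<Delta> \<Longrightarrow> ht b \<le> ht \<theta>"
proof -
  have "\<Delta> \<noteq> {}" using unitv_root[OF one_in_I0] by blast
  then obtain t where t: "t \<in> \<Delta>" "\<And>b. b \<in> \<Delta> \<Longrightarrow> ht b \<le> ht t"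
  proof -
    assume a: "\<And>t. t \<in> \<Delta> \<Longrightarrow> (\<And>b. b \<in> \<Delta> \<Longrightarrow> ht b \<le> ht t) \<Longrightarrow> thesis"
    have "Max (ht ` \<Delta>) \<in> ht ` \<Delta>" using finite_roots \<open>\<Delta> \<noteq> {}\<close> by (intro Max_in) auto
    then obtain t where t: "t \<in> \<Delta>" "ht t = Max (ht ` \<Delta>)" by auto
    have "ht b \<le> ht t" if "b \<in> \<Delta>" for b unfolding t(2) using finite_roots that by (intro Max_ge) auto
    then show thesis using a t(1) by blast
  qed
  have "\<theta> = t" unfolding \<theta>_def fhighest_def
  proof (rule the_equality)
    show "t \<in> \<Delta> \<and> (\<forall>b\<in>\<Delta>. ht b \<le> ht t)" using t by blast
  next
    fix s assume s: "s \<in> \<Delta> \<and> (\<forall>b\<in>\<Delta>. ht b \<le> ht s)"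
    show "s = t"
    proof (rule ccontr)
      assume ne: "s \<noteq> t"
      have "bil s t > 0" using max_root[of s] max_root[of t] s t by (intro dominant_bil_pos) auto
      from sub_root[OF _ t(1) this ne] s have "(\<lambda>k. s k - t k) \<in> \<Delta>" by blast
      moreover have "ht (\<lambda>k. s k - t k) = 0" using ht_sub[of s 1 t] s t by (simp add: order_antisym)
      ultimately show False using ht_nz by blast
    qed
  qed
  then show "\<theta> \<in> \<Delta>" "\<And>b. b \<in> \<Delta> \<Longrightarrow> ht b \<le> ht \<theta>" using t by auto
qed

lemma theta_dom: "i \<in> I0 \<Longrightarrow> rt \<theta> i \<ge> 0" and theta_full: "i \<in> I0 \<Longrightarrow> \<theta> i > 0" and theta_pos: "\<theta> \<in> \<Delta>p"
  using max_root[OF theta] by auto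

text \<open>The induction climbs: a non-dominant root is raised by a simple reflection, and a
  dominant root other than \<open>\<theta>\<close> differs from it by a positive root.\<close>

lemma theta_ge: "g \<in> \<Delta> \<Longrightarrow> g k \<le> \<theta> k"
proof (induction "nat (ht \<theta> - ht g)" arbitrary: g rule: less_induct)
  case less
  show ?case
  proof (cases "\<forall>i\<in>I0. rt g i \<ge> 0")
    case True
    show ?thesis
    proof (cases "g = \<theta>")
      case False
      have "bil \<theta> g > 0" using dominant_bil_pos[of g \<theta>] True theta_full less.prems bil_sym by metis
      then have r: "(\<lambda>k. \<theta> k - g k) \<in> \<Delta>" using sub_root theta(1) less.prems False by metis
      have "ht (\<lambda>k. \<theta> k - g k) \<ge> 0" using theta(2)[OF less.prems] ht_sub[of \<theta> 1 g] by simp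
      then have "(\<lambda>k. \<theta> k - g k) \<in> \<Delta>p" using r pos_iff_ht ht_nz by (metis order_less_le)
      then show ?thesis by (simp add: \<Delta>p_def)
    qed simp
  next
    case False
    then obtain i where i: "i \<in> I0" "rt g i < 0" by force
    have r: "rf (unitv i) g \<in> \<Delta>" using rf_root[OF unitv_root[OF i(1)] less.prems] .
    have "ht (rf (unitv i) g) > ht g" using ht_frefl[OF i(1), of g] i(2) by linarith
    moreover have "ht (rf (unitv i) g) \<le> ht \<theta>" using theta(2)[OF r] .
    ultimately have "rf (unitv i) g k \<le> \<theta> k" using less.hyps[OF _ r] by simp
    moreover have "cf g (unitv i) < 0"
      using cf[OF unitv_root[OF i(1)], of g] pr_unitv[OF i(1)] i(2) by simp
    then have "g k \<le> rf (unitv i) g k" by (simp add: rf_def unitv_def)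
    ultimately show ?thesis by simp
  qed
qed

lemma theta_cf_nonneg: assumes "g \<in> \<Delta>p" shows "cf g \<theta> \<ge> 0"
proof -
  have "bil g \<theta> = bil \<theta> g" by (rule bil_sym)
  also have "\<dots> \<ge> 0" unfolding bil_def ip_def
    using assms theta_dom dd(1) by (intro sum_nonneg) (auto simp: \<Delta>p_def less_imp_le)
  finally have "real_of_int (cf g \<theta>) \<ge> 0" using root_bil_pos[OF theta(1)] by (simp add: cf_eq_bil theta)
  then show ?thesis by linarith
qed

text \<open>The root \<open>- rf \<theta> g\<close> is bounded by \<open>\<theta>\<close>, which
  gives the inequality opposite to \<open>theta_ge\<close>. Hence the other positive roots have only
  the pairings 0 and 1, and the reflection in \<open>\<theta>\<close> becomes explicit.\<close>

lemma theta_cf_ge2: assumes g: "g \<in> \<Delta>" and c: "cf g \<theta> \<ge> 2" shows "g = \<theta>"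
proof
  fix k
  have "(\<lambda>k. - rf \<theta> g k) \<in> \<Delta>" using neg_root rf_root theta(1) g by blast
  from theta_ge[OF this, of k] have "cf g \<theta> * \<theta> k - \<theta> k \<le> g k" by (simp add: rf_def)
  moreover have "2 * \<theta> k \<le> cf g \<theta> * \<theta> k" using c theta_pos by (intro mult_right_mono) (auto simp: \<Delta>p_def)
  ultimately show "g k = \<theta> k" using theta_ge[OF g, of k] by linarith
qed

lemma theta_cf_cases: assumes g: "g \<in> \<Delta>p" "g \<noteq> \<theta>" shows "cf g \<theta> = 0 \<or> cf g \<theta> = 1"
  using theta_cf_nonneg[OF g(1)] theta_cf_ge2[OF \<Delta>p_root[OF g(1)]] g(2) by force

end

section \<open>Affine real roots\<close>

locale affine_cartan =
  fixes n :: nat and A :: "nat \<Rightarrow> nat \<Rightarrow> int"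
  assumes ua: "untwisted_affine n A"

sublocale affine_cartan \<subseteq> finite_cartan n A
  using ua by unfold_locales (auto simp: untwisted_affine_def)

context affine_cartan
begin

abbreviation II :: "nat set" where "II \<equiv> Iset n"

lemma II_eq: "II = insert 0 I0" and fin_II [simp]: "finite II" and zero_II [simp]: "0 \<in> II"
  by (auto simp: Iset_def I0set_def)
lemma I0_II: "i \<in> I0 \<Longrightarrow> i \<in> II" by (simp add: II_eq)

lemma A00 [simp]: "A 0 0 = 2"
  using ua by (auto simp: untwisted_affine_def is_GCM_def)
lemma A0j: "j \<in> I0 \<Longrightarrow> A 0 j = - (\<Sum>i\<in>I0. fcoroot n A \<theta> i * A i j)"
  and Aj0: "j \<in> I0 \<Longrightarrow> A j 0 = - (\<Sum>k\<in>I0. A j k * \<theta> k)"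
  using ua by (auto simp: untwisted_affine_def Let_def \<theta>_def)

text \<open>The affine root \<open>g + k\<delta>\<close> is encoded by the pair \<open>(g, k)\<close>, and \<open>ar g k\<close> is its weight. The simple root
  \<open>\<alpha>\<^sub>j\<close> is \<open>(bb j, ee j)\<close>, and its reflection maps \<open>(g, k)\<close> to \<open>(rf (bb j) g, rk j g k)\<close>. The pairing of
  a weight with \<open>(g + k\<delta>)\<^sup>\<or>\<close> is \<open>cp\<close>, where \<open>lev\<close> is the level; \<open>rr g k\<close> is the reflection.\<close>

definition bb :: "nat \<Rightarrow> nat \<Rightarrow> int" where "bb j = (if j = 0 then (\<lambda>k. - \<theta> k) else unitv j)"
definition ee :: "nat \<Rightarrow> int" where "ee j = (if j = 0 then 1 else 0)"
definition ar :: "(nat \<Rightarrow> int) \<Rightarrow> int \<Rightarrow> wt" where "ar g k = (rt g, of_int k)"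

lemma bb_simps [simp]: "bb 0 = (\<lambda>k. - \<theta> k)" "j \<in> I0 \<Longrightarrow> bb j = unitv j" "ee 0 = 1" "j \<in> I0 \<Longrightarrow> ee j = 0"
  by (auto simp: bb_def ee_def I0_le)

lemma bb_root: "j \<in> II \<Longrightarrow> bb j \<in> \<Delta>"
  using unitv_root neg_root theta(1) by (auto simp: II_eq)

lemma pr_neg: "pr v (\<lambda>k. - c k) = - pr v c" by (simp add: pr_def ip_neg)
lemma pr_vsub: "pr (\<lambda>k. v k - x * w k) c = pr v c - x * pr w c"
  by (simp add: pr_def ip_vsub algebra_simps diff_divide_distrib)

lemma rt0: "rt c 0 = - pr (rt c) \<theta>"
proof -
  have "rt c 0 = (\<Sum>j\<in>I0. - (\<Sum>i\<in>I0. of_int (fcoroot n A \<theta> i) * of_int (A i j) * of_int (c j)))"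
    unfolding rt_def by (simp add: A0j sum_distrib_right)
  also have "\<dots> = - (\<Sum>i\<in>I0. \<Sum>j\<in>I0. of_int (fcoroot n A \<theta> i) * of_int (A i j) * of_int (c j))"
    by (subst sum.swap) (simp add: sum_negf)
  also have "\<dots> = - pr (rt c) \<theta>"
    unfolding pr_coroot[OF theta(1)]
    by (intro arg_cong[where f=uminus] sum.cong refl) (simp add: rt_def I0_le sum_distrib_left mult.assoc)
  finally show ?thesis .
qed

lemma sroot_eq: assumes "j \<in> II" shows "sroot n A j = ar (bb j) (ee j)"
proof (cases "j = 0")
  case True
  have "rt (\<lambda>k. - \<theta> k) k = (if k \<le> n then of_int (A k 0) else 0)" for k
  proof -
    have "k = 0 \<or> k \<in> I0 \<or> k > n" by (auto simp: I0set_def)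
    then consider "k = 0" | "k \<in> I0" | "k > n" by blast
    then show ?thesis
    proof cases
      case 1
      have "rt (\<lambda>k. - \<theta> k) 0 = 2" by (simp add: rt_neg rt0 cf theta)
      then show ?thesis using 1 by simp
    next
      case 2
      then show ?thesis by (simp add: Aj0 I0_le rt_neg) (simp add: rt_def I0_le)
    next
      case 3 then show ?thesis by (simp add: rt_def)
    qed
  qed
  then show ?thesis using True by (auto simp: sroot_def ar_def)
next
  case False
  then have "j \<in> I0" using assms II_eq by auto
  then show ?thesis using False by (auto simp: sroot_def ar_def rt_unitv)
qed

text \<open>The central element \<open>c\<close> is the sum of the coroots of \<open>alpha_0\<close>
  and \<open>\<theta>\<close>; the equation says that it pairs to zero with
  \<open>v\<close>.\<close>

definition lz :: "(nat \<Rightarrow> real) \<Rightarrow> bool" where "lz v \<longleftrightarrow> v 0 = - pr v \<theta>"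

lemma lz_rt [simp]: "lz (rt c)" by (simp add: lz_def rt0)
lemma lz_sub: "lz v \<Longrightarrow> lz w \<Longrightarrow> lz (\<lambda>i. v i - x * w i)"
  by (simp add: lz_def pr_vsub algebra_simps)
lemma lz_pr: "lz v \<Longrightarrow> j \<in> II \<Longrightarrow> pr v (bb j) = v j"
  by (auto simp: II_eq lz_def pr_neg pr_unitv)

lemma rt_cf: "j \<in> II \<Longrightarrow> rt g j = of_int (cf g (bb j))"
  using lz_pr[OF lz_rt, of j g] cf[OF bb_root, of j g] by simp

lemma wdiff_eq: "wdiff x (wscale c y) = (\<lambda>j. fst x j - c * fst y j, snd x - c * snd y)"
  by (simp add: wdiff_def wadd_def wscale_def)

lemma sref_eq: "j \<in> II \<Longrightarrow> sref n A j mu = (\<lambda>i. fst mu i - fst mu j * rt (bb j) i, snd mu - fst mu j * of_int (ee j))"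
  by (simp add: sref_def wdiff_eq sroot_eq ar_def)

definition rk :: "nat \<Rightarrow> (nat \<Rightarrow> int) \<Rightarrow> int \<Rightarrow> int" where "rk j g k = k - cf g (bb j) * ee j"

lemma sref_ar: "j \<in> II \<Longrightarrow> sref n A j (ar g k) = ar (rf (bb j) g) (rk j g k)"
  by (simp add: sref_eq) (simp add: ar_def rt_rf bb_root lz_pr rt_cf rk_def)

lemma rt_bb: "j \<in> II \<Longrightarrow> rt (bb j) j = 2"
  by (simp add: rt_cf bb_root)

lemma sref_invol: "j \<in> II \<Longrightarrow> sref n A j (sref n A j mu) = mu"
  by (simp add: sref_eq rt_bb prod_eq_iff)

lemma lz_sref: "lz (fst mu) \<Longrightarrow> j \<in> II \<Longrightarrow> lz (fst (sref n A j mu))"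
  by (simp add: sref_eq lz_sub)

lemma wword_Nil [simp]: "wword n A [] = id" by (simp add: wword_def)
lemma wword_Cons [simp]: "wword n A (i # ws) = sref n A i \<circ> wword n A ws" by (simp add: wword_def)
lemma wword_append: "wword n A (xs @ ys) = wword n A xs \<circ> wword n A ys"
  by (induction xs) (auto simp: o_assoc)
lemma wword_rev: "set ws \<subseteq> II \<Longrightarrow> wword n A (rev ws) (wword n A ws mu) = mu"
  by (induction ws arbitrary: mu) (auto simp: wword_append sref_invol)
lemma wword_rev2: "set ws \<subseteq> II \<Longrightarrow> wword n A ws (wword n A (rev ws) mu) = mu"
  using wword_rev[of "rev ws"] by simp
lemma wword_linear: "set ws \<subseteq> II \<Longrightarrow> wword n A ws (wdiff a (wscale x b)) = wdiff (wword n A ws a) (wscale x (wword n A ws b))"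
  by (induction ws) (auto simp: sref_eq wdiff_eq algebra_simps)
lemma lz_wword: "set ws \<subseteq> II \<Longrightarrow> lz (fst mu) \<Longrightarrow> lz (fst (wword n A ws mu))"
  by (induction ws) (auto simp: lz_sref)

section \<open>Pairings with affine coroots and affine reflections\<close>

definition lev :: "(nat \<Rightarrow> real) \<Rightarrow> real" where "lev v = v 0 + pr v \<theta>"
text \<open>The factor comes from
  \<open>(g + k delta)^vee = g^vee + k (theta, theta) / (g, g) c\<close>.\<close>

definition cp :: "(nat \<Rightarrow> real) \<Rightarrow> (nat \<Rightarrow> int) \<Rightarrow> int \<Rightarrow> real" where
  "cp v g k = pr v g + of_int k * bil \<theta> \<theta> / bil g g * lev v"

lemma lz_lev: "lz v \<longleftrightarrow> lev v = 0" by (auto simp: lz_def lev_def)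
lemma cp_lz: "lz v \<Longrightarrow> cp v g k = pr v g" by (simp add: cp_def lz_lev)
lemma cp_0 [simp]: "cp v g 0 = pr v g" by (simp add: cp_def)

lemma pr_rf: assumes "g \<in> \<Delta>" "c \<in> \<Delta>" shows "pr v (rf g c) = pr v c - pr (rt g) c * pr v g"
proof -
  have "of_int (cf c g) * bil g g = pr (rt g) c * bil c c"
    using bil_cf[OF assms(1), of c] bil_cf[OF assms(2), of g] cf[OF assms(2), of g] bil_sym[of c g] by simp
  then have a: "of_int (cf c g) = pr (rt g) c * bil c c / bil g g"
    using root_bil_pos[OF assms(1)] by (simp add: field_simps)
  have b: "pr v (rf g c) = (2 * ip v c - 2 * of_int (cf c g) * ip v g) / bil c c"
    unfolding pr_def bil_rf[OF assms(1)] unfolding rf_def ip_sub by (simp add: algebra_simps)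
  show ?thesis unfolding b a pr_def[of v c] pr_def[of v g]
    using root_bil_pos[OF assms(1)] root_bil_pos[OF assms(2)] by (simp add: field_simps)
qed

text \<open>For \<open>j = 0\<close> the coordinate \<open>v 0\<close> and the pairing with
  \<open>bb 0\<close> differ exactly by the level, and the second term of \<open>cp\<close>
  compensates for this.\<close>

lemma cp_sref:
  assumes g: "g \<in> \<Delta>" and j: "j \<in> II"
  shows "cp (fst (sref n A j mu)) g k = cp (fst mu) (rf (bb j) g) (rk j g k)"
proof -
  let ?b = "bb j" and ?v = "fst mu"
  have b: "?b \<in> \<Delta>" using bb_root[OF j] .
  have lv: "lev (fst (sref n A j mu)) = lev ?v"
    using lz_rt[of ?b] j by (simp add: lev_def lz_def sref_eq pr_vsub algebra_simps)
  have l: "pr (fst (sref n A j mu)) g = pr ?v g - ?v j * pr (rt ?b) g"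
    using j by (simp add: sref_eq pr_vsub)
  have x: "of_int (cf g ?b) * bil ?b ?b = pr (rt ?b) g * bil g g"
    using bil_cf[OF b, of g] bil_cf[OF g, of ?b] cf[OF g, of ?b] bil_sym[of g ?b] by simp
  have "of_int (ee j) * (of_int (cf g ?b) * bil \<theta> \<theta> / bil g g) * lev ?v = pr (rt ?b) g * (?v j - pr ?v ?b)"
  proof (cases "j = 0")
    case True
    then have "of_int (cf g ?b) * bil \<theta> \<theta> / bil g g = pr (rt ?b) g"
      using x root_bil_pos[OF g] by (simp add: field_simps)
    then show ?thesis using True by (simp add: lev_def pr_neg)
  next
    case False
    then have "j \<in> I0" using j II_eq by auto
    then show ?thesis by (simp add: pr_unitv)
  qed
  then show ?thesis
    unfolding cp_def l lv pr_rf[OF b g] bil_rf[OF b] rk_def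
    by (simp add: algebra_simps diff_divide_distrib)
qed

text \<open>Weight, finite part and pairing are followed through one and the same word. With
  \<open>ar_inj\<close> this shows that the value described in \<open>copair\<close> does not depend
  on the word.\<close>

lemma root_word:
  assumes "set ws \<subseteq> II" "i \<in> II"
  shows "\<exists>g k. g \<in> \<Delta> \<and> wword n A ws (sroot n A i) = ar g k \<and> (\<forall>mu. fst (wword n A (rev ws) mu) i = cp (fst mu) g k)"
  using assms
proof (induction ws)
  case Nil
  have "fst mu i = cp (fst mu) (bb i) (ee i)" for mu :: wt
  proof (cases "i = 0")
    case True
    then show ?thesis using root_bil_pos[OF theta(1)] by (simp add: cp_def lev_def pr_neg)
  next
    case False
    then have "i \<in> I0" using Nil II_eq by auto
    then show ?thesis by (simp add: pr_unitv)
  qed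
  then show ?case using Nil bb_root sroot_eq
    by (intro exI[of _ "bb i"] exI[of _ "ee i"]) auto
next
  case (Cons j ws)
  then obtain g k where gk: "g \<in> \<Delta>" "wword n A ws (sroot n A i) = ar g k"
    "\<And>mu. fst (wword n A (rev ws) mu) i = cp (fst mu) g k" by auto
  have j: "j \<in> II" using Cons by auto
  show ?case
    using gk j sref_ar[OF j] cp_sref[OF gk(1) j] rf_root[OF bb_root[OF j] gk(1)]
    by (intro exI[of _ "rf (bb j) g"] exI[of _ "rk j g k"]) (auto simp: wword_append)
qed

lemma ar_inj: "g \<in> \<Delta> \<Longrightarrow> h \<in> \<Delta> \<Longrightarrow> ar g k = ar h l \<longleftrightarrow> g = h \<and> k = l"
  using root_rt_inj by (auto simp: ar_def)

lemma realroots_ar: "b \<in> realroots n A \<Longrightarrow> \<exists>g\<in>\<Delta>. \<exists>k. b = ar g k"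
  unfolding realroots_def using root_word by blast

lemma copair_eq: assumes "ar g k \<in> realroots n A" "g \<in> \<Delta>"
  shows "copair n A mu (ar g k) = cp (fst mu) g k"
  unfolding copair_def
proof (rule the_equality)
  obtain ws i where w: "ar g k = wword n A ws (sroot n A i)" "set ws \<subseteq> II" "i \<in> II"
    using assms(1) by (auto simp: realroots_def)
  then show "\<exists>ws i. set ws \<subseteq> II \<and> i \<in> II \<and> ar g k = wword n A ws (sroot n A i) \<and> cp (fst mu) g k = fst (wword n A (rev ws) mu) i"
    using root_word[OF w(2,3)] ar_inj[OF assms(2)] by metis
next
  fix c assume "\<exists>ws i. set ws \<subseteq> II \<and> i \<in> II \<and> ar g k = wword n A ws (sroot n A i) \<and> c = fst (wword n A (rev ws) mu) i"
  then show "c = cp (fst mu) g k" using root_word ar_inj[OF assms(2)] by metis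
qed

definition rr :: "(nat \<Rightarrow> int) \<Rightarrow> int \<Rightarrow> wt \<Rightarrow> wt" where
  "rr g k mu = wdiff mu (wscale (cp (fst mu) g k) (ar g k))"

lemma rr_eq: "rr g k mu = (\<lambda>i. fst mu i - cp (fst mu) g k * rt g i, snd mu - cp (fst mu) g k * of_int k)"
  by (simp add: rr_def wdiff_eq ar_def)

lemma rrefl_eq: "ar g k \<in> realroots n A \<Longrightarrow> g \<in> \<Delta> \<Longrightarrow> rrefl n A (ar g k) = rr g k"
  by (auto simp: rrefl_def rr_def copair_eq)

lemma rr_word:
  assumes "set ws \<subseteq> II" "i \<in> II" "ar g k = wword n A ws (sroot n A i)" "g \<in> \<Delta>"
  shows "rr g k = wword n A (ws @ i # rev ws)"
proof
  fix mu
  have c: "fst (wword n A (rev ws) mu) i = cp (fst mu) g k"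
    using root_word[OF assms(1,2)] ar_inj assms(3,4) by metis
  have "wword n A (ws @ i # rev ws) mu = wword n A ws (sref n A i (wword n A (rev ws) mu))"
    by (simp add: wword_append)
  also have "\<dots> = wdiff (wword n A ws (wword n A (rev ws) mu)) (wscale (cp (fst mu) g k) (wword n A ws (sroot n A i)))"
    unfolding sref_def by (simp add: wword_linear assms c)
  also have "\<dots> = rr g k mu" using assms wword_rev2 by (simp add: rr_def)
  finally show "rr g k mu = wword n A (ws @ i # rev ws) mu" ..
qed

section \<open>Positive real affine roots and induction on their height\<close>

definition apos :: "(nat \<Rightarrow> int) \<Rightarrow> int \<Rightarrow> bool" where
  "apos g k \<longleftrightarrow> g \<in> \<Delta> \<and> (0 < k \<or> k = 0 \<and> g \<in> \<Delta>p)"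

lemma apos_root: "apos g k \<Longrightarrow> g \<in> \<Delta>" by (simp add: apos_def)
lemma apos_simple: "j \<in> II \<Longrightarrow> apos (bb j) (ee j)"
  using bb_root unitv_pos by (auto simp: apos_def II_eq)

lemma theta_nonpos_cf: assumes "g \<in> \<Delta>" "(\<lambda>k. - g k) \<in> \<Delta>p" "g \<noteq> (\<lambda>k. - \<theta> k)"
  shows "cf g \<theta> = 0 \<or> cf g \<theta> = -1"
proof -
  have "(\<lambda>k. - g k) \<noteq> \<theta>"
  proof
    assume e: "(\<lambda>k. - g k) = \<theta>"
    have "g = (\<lambda>k. - \<theta> k)" unfolding e[symmetric] by simp
    then show False using assms(3) by simp
  qed
  from theta_cf_cases[OF assms(2) this] show ?thesis using cf_neg1[OF theta(1), of g] by auto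
qed

text \<open>For \<open>j = 0\<close> the integer \<open>k\<close> is shifted by
  \<open>cf g \<theta>\<close>, which is -1, 0 or 1 unless \<open>g\<close> is
  \<open>\<theta>\<close> or its negative. A shift from 1 to 0 ends at a positive finite root
  because no root exceeds \<open>\<theta>\<close>.\<close>

lemma apos_refl:
  assumes p: "apos g k" and j: "j \<in> II" and ne: "\<not> (g = bb j \<and> k = ee j)"
  shows "apos (rf (bb j) g) (rk j g k)"
proof (cases "j = 0")
  case False
  then have j0: "j \<in> I0" using j II_eq by auto
  then show ?thesis using p ne frefl_pos[of g j] rf_root[OF unitv_root[OF j0]] by (auto simp: apos_def rk_def)
next
  case True
  have g: "g \<in> \<Delta>" using p apos_root by blast
  have r: "rf \<theta> g \<in> \<Delta>" using rf_root[OF theta(1) g] .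
  have eqr: "rf (bb j) g = rf \<theta> g" "rk j g k = k + cf g \<theta>"
    using True by (simp_all add: rf_neg theta rk_def cf_neg2)
  consider "g = \<theta>" | "g = (\<lambda>k. - \<theta> k)" | "g \<in> \<Delta>p" "g \<noteq> \<theta>" | "(\<lambda>k. - g k) \<in> \<Delta>p" "g \<noteq> (\<lambda>k. - \<theta> k)"
    using \<Delta>p_cases[OF g] by blast
  then show ?thesis
  proof cases
    case 1 then show ?thesis unfolding eqr using p r by (auto simp: apos_def theta)
  next
    case 2
    then have "g \<notin> \<Delta>p" using \<Delta>p_exc[OF theta_pos] by simp
    then have "k \<ge> 1" "k \<noteq> 1" using p ne True 2 by (auto simp: apos_def)
    moreover have "rf \<theta> g = \<theta>" using 2 by (simp add: rf_neg2 theta rf_self)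
    ultimately show ?thesis unfolding eqr using 2 theta theta_pos by (auto simp: apos_def cf_neg1)
  next
    case 3
    from theta_cf_cases[OF this] show ?thesis
      unfolding eqr using p r 3 by (auto simp: apos_def rf_def)
  next
    case 4
    then have "g \<notin> \<Delta>p" using \<Delta>p_exc by force
    then have k: "k \<ge> 1" using p by (auto simp: apos_def)
    from theta_nonpos_cf[OF g 4] show ?thesis
    proof
      assume "cf g \<theta> = 0" then show ?thesis unfolding eqr using k r by (auto simp: apos_def)
    next
      assume c: "cf g \<theta> = -1"
      have "rf \<theta> g k \<ge> 0" for k using theta_ge[OF neg_root[OF g], of k] c by (simp add: rf_def)
      then have "rf \<theta> g \<in> \<Delta>p" using r by (simp add: \<Delta>p_def)
      then show ?thesis unfolding eqr using k c r by (auto simp: apos_def)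
    qed
  qed
qed

lemma fcoroot_theta_pos: "i \<in> I0 \<Longrightarrow> fcoroot n A \<theta> i > 0"
proof -
  assume i: "i \<in> I0"
  have "real_of_int (fcoroot n A \<theta> i) > 0"
    unfolding fcoroot_eq[OF theta(1)] using theta_full[OF i] dd(1)[OF i] root_bil_pos[OF theta(1)] by simp
  then show ?thesis by linarith
qed

text \<open>The coordinates of a root, weighted with the positive dual marks, sum to zero. If none
  were positive, all would vanish and the root would be isotropic.\<close>

lemma root_ex_pos: assumes g: "g \<in> \<Delta>" shows "\<exists>j\<in>II. rt g j > 0"
proof (rule ccontr)
  assume "\<not> ?thesis"
  then have le: "\<And>j. j \<in> II \<Longrightarrow> rt g j \<le> 0" by force
  have "(\<Sum>i\<in>I0. of_int (fcoroot n A \<theta> i) * rt g i) \<ge> 0"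
    using le[of 0] rt0[of g] pr_coroot[OF theta(1), of "rt g"] by simp
  moreover have term_le: "of_int (fcoroot n A \<theta> i) * rt g i \<le> 0" if "i \<in> I0" for i
    using le[OF I0_II[OF that]] fcoroot_theta_pos[OF that] by (simp add: mult_nonneg_nonpos)
  ultimately have "\<forall>i\<in>I0. - (of_int (fcoroot n A \<theta> i) * rt g i) = 0"
    by (subst sum_nonneg_eq_0_iff[symmetric]) (auto simp: sum_negf intro: antisym sum_nonpos)
  then have "\<forall>i\<in>I0. rt g i = 0" using fcoroot_theta_pos by fastforce
  then have "bil g g = 0" by (simp add: bil_def ip_def)
  then show False using root_bil_pos[OF g] by simp
qed

text \<open>The height with respect to the affine simple roots: delta is \<open>alpha_0\<close> plus
  \<open>\<theta>\<close>, hence has height \<open>ht \<theta> + 1\<close>.\<close>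

definition ah :: "(nat \<Rightarrow> int) \<Rightarrow> int \<Rightarrow> int" where "ah g k = ht g + k * (ht \<theta> + 1)"

lemma ah_simple: "j \<in> II \<Longrightarrow> ah (bb j) (ee j) = 1"
  by (auto simp: II_eq ah_def ht_neg ht_unitv)

lemma ah_refl: "j \<in> II \<Longrightarrow> ah (rf (bb j) g) (rk j g k) = ah g k - cf g (bb j)"
proof -
  assume j: "j \<in> II"
  have "ah (rf (bb j) g) (rk j g k) = ah g k - cf g (bb j) * ah (bb j) (ee j)"
    unfolding ah_def rf_def rk_def ht_sub by (simp add: algebra_simps)
  then show ?thesis using ah_simple[OF j] by simp
qed

lemma ah_pos: assumes "apos g k" shows "ah g k > 0"
proof (cases "k = 0")
  case True then show ?thesis using assms ht_pos by (simp add: ah_def apos_def)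
next
  case False
  then have k: "k \<ge> 1" using assms by (auto simp: apos_def)
  have "ht \<theta> + 1 \<le> k * (ht \<theta> + 1)" using k ht_pos[OF theta_pos] by simp
  moreover have "ht g \<ge> - ht \<theta>" using theta(2)[OF neg_root[OF apos_root[OF assms]]] by (simp add: ht_neg)
  ultimately show ?thesis by (simp add: ah_def)
qed

text \<open>Reflection in a simple root with positive pairing lowers the height and keeps the root
  positive unless it is that simple root. The fact \<open>rt g j > 0\<close> is handed to the step
  because later arguments compare the \<open>j\<close>-th coordinates of a weight and its
  reflection.\<close>

lemma apos_induct [consumes 1, case_names simple step]:
  assumes "apos g k"
    and simple: "\<And>j. j \<in> II \<Longrightarrow> P (bb j) (ee j)"
    and step: "\<And>g k j. apos g k \<Longrightarrow> j \<in> II \<Longrightarrow> \<not> (g = bb j \<and> k = ee j) \<Longrightarrow> rt g j > 0 \<Longrightarrow>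
        apos (rf (bb j) g) (rk j g k) \<Longrightarrow> P (rf (bb j) g) (rk j g k) \<Longrightarrow> P g k"
  shows "P g k"
  using assms(1)
proof (induction "nat (ah g k)" arbitrary: g k rule: less_induct)
  case less
  obtain j where j: "j \<in> II" "rt g j > 0" using root_ex_pos apos_root[OF less.prems] by blast
  show ?case
  proof (cases "g = bb j \<and> k = ee j")
    case True then show ?thesis using simple[OF j(1)] by simp
  next
    case False
    have p: "apos (rf (bb j) g) (rk j g k)" using apos_refl[OF less.prems j(1) False] .
    have "cf g (bb j) > 0" using j rt_cf[OF j(1), of g] by simp
    then have "nat (ah (rf (bb j) g) (rk j g k)) < nat (ah g k)"
      using ah_refl[OF j(1), of g k] ah_pos[OF less.prems] by linarith
    then show ?thesis using less.hyps p step[OF less.prems j(1) False j(2)] by blast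
  qed
qed

lemma sroot_real: "j \<in> II \<Longrightarrow> sroot n A j \<in> realroots n A"
  unfolding realroots_def by (auto intro!: exI[of _ "[]"] exI[of _ j])

lemma sref_real: "b \<in> realroots n A \<Longrightarrow> j \<in> II \<Longrightarrow> sref n A j b \<in> realroots n A"
proof -
  assume "b \<in> realroots n A" "j \<in> II"
  then obtain ws i where "b = wword n A ws (sroot n A i)" "set ws \<subseteq> II" "i \<in> II" by (auto simp: realroots_def)
  then show ?thesis using \<open>j \<in> II\<close> unfolding realroots_def
    by (auto intro!: exI[of _ "j # ws"] exI[of _ i])
qed

lemma apos_real: "apos g k \<Longrightarrow> ar g k \<in> realroots n A"
proof (induction rule: apos_induct)
  case (simple j) then show ?case using sroot_real sroot_eq by metis
next
  case (step g k j)
  then show ?case using sref_real[OF step(6,2)] sref_ar[OF step(2)] sref_invol[OF step(2)] by metis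
qed

lemma sum_II: "(\<Sum>j\<in>II. f j) = f 0 + (\<Sum>j\<in>I0. f j)" for f :: "nat \<Rightarrow> 'a :: comm_monoid_add"
  by (simp add: II_eq)

lemma wsum_simple:
  "wsum (\<lambda>j. wscale (c j) (sroot n A j)) II
    = (\<lambda>i. if i \<le> n then (\<Sum>j\<in>I0. of_int (A i j) * c j) - c 0 * rt \<theta> i else 0, c 0)"
proof -
  have "(\<Sum>j\<in>II. fst (wscale (c j) (sroot n A j)) i) = (if i \<le> n then (\<Sum>j\<in>I0. of_int (A i j) * c j) - c 0 * rt \<theta> i else 0)" for i
  proof -
    have "(\<Sum>j\<in>II. fst (wscale (c j) (sroot n A j)) i) = c 0 * rt (\<lambda>k. - \<theta> k) i + (\<Sum>j\<in>I0. c j * rt (unitv j) i)"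
      by (simp add: sum_II wscale_def sroot_eq I0_II ar_def)
    then show ?thesis by (auto simp: rt_neg rt_unitv mult.commute) (simp add: rt_def)
  qed
  moreover have "(\<Sum>j\<in>II. snd (wscale (c j) (sroot n A j))) = c 0"
    by (simp add: sum_II wscale_def sroot_eq I0_II ar_def)
  ultimately show ?thesis by (simp add: wsum_def)
qed

lemma posroots_eq: "b \<in> posroots n A \<longleftrightarrow> (\<exists>g k. b = ar g k \<and> apos g k)"
proof
  assume b: "b \<in> posroots n A"
  then have "b \<in> realroots n A" by (simp add: posroots_def)
  then obtain g k where g: "g \<in> \<Delta>" "b = ar g k" using realroots_ar by blast
  obtain c :: "nat \<Rightarrow> nat" where c: "b = wsum (\<lambda>j. wscale (real (c j)) (sroot n A j)) II"
    using b by (auto simp: posroots_def)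
  have k: "k = int (c 0)" and r: "rt g = (\<lambda>i. if i \<le> n then (\<Sum>j\<in>I0. of_int (A i j) * real (c j)) - real (c 0) * rt \<theta> i else 0)"
    using g(2) c unfolding wsum_simple ar_def by auto
  have "apos g k"
  proof (cases "c 0 = 0")
    case True
    define h where "h j = (if j \<in> I0 then int (c j) else 0)" for j
    have "g = h"
      by (rule rt_inj) (use r True in \<open>auto simp: rt_def I0_le h_def root_supp[OF g(1)]\<close>)
    then have "g \<in> \<Delta>p" using g(1) by (auto simp: \<Delta>p_def h_def)
    then show ?thesis using g k True by (simp add: apos_def)
  next
    case False then show ?thesis using g k by (simp add: apos_def)
  qed
  then show "\<exists>g k. b = ar g k \<and> apos g k" using g by blast
next
  assume "\<exists>g k. b = ar g k \<and> apos g k"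
  then obtain g k where b: "b = ar g k" "apos g k" by blast
  have g: "g \<in> \<Delta>" using apos_root b by blast
  have k: "k \<ge> 0" using b(2) by (auto simp: apos_def)
  \<comment> \<open>Since delta is \<open>alpha_0 + \<theta>\<close>, the root
    \<open>g + k delta\<close> has coefficient \<open>k\<close> at \<open>alpha_0\<close> and
    \<open>g j + k * \<theta> j\<close> at \<open>alpha_j\<close>.\<close>
  define c where "c j = (if j = 0 then nat k else nat (g j + k * \<theta> j))" for j
  have nn: "g j + k * \<theta> j \<ge> 0" for j
  proof (cases "k = 0")
    case True then show ?thesis using b by (auto simp: apos_def \<Delta>p_def)
  next
    case False
    then have "\<theta> j \<le> k * \<theta> j" using k theta_pos mult_right_mono[of 1 k "\<theta> j"] by (auto simp: \<Delta>p_def)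
    then show ?thesis using theta_ge[OF neg_root[OF g], of j] by simp
  qed
  have cj: "real (c j) = of_int (g j) + of_int k * of_int (\<theta> j)" if "j \<in> I0" for j
    using nn[of j] I0_le(2)[OF that] by (simp add: c_def)
  have e: "(\<Sum>j\<in>I0. of_int (A i j) * real (c j)) - real (c 0) * rt \<theta> i = rt g i" if "i \<le> n" for i
  proof -
    have "(\<Sum>j\<in>I0. of_int (A i j) * real (c j)) = (\<Sum>j\<in>I0. of_int (A i j) * (of_int (g j) + of_int k * of_int (\<theta> j)))"
      by (intro sum.cong) (simp_all add: cj)
    moreover have "real (c 0) = of_int k" using k by (simp add: c_def)
    ultimately show ?thesis using that by (simp add: rt_def algebra_simps sum.distrib sum_distrib_left)
  qed
  have "rt g i = (if i \<le> n then (\<Sum>j\<in>I0. of_int (A i j) * real (c j)) - real (c 0) * rt \<theta> i else 0)" for i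
    using e[of i] by (cases "i \<le> n") (simp_all add: rt_def[of g])
  moreover have "real (c 0) = of_int k" using k by (simp add: c_def)
  ultimately have "b = wsum (\<lambda>j. wscale (real (c j)) (sroot n A j)) II"
    unfolding wsum_simple b(1) ar_def by (intro prod_eqI ext) (simp_all only: fst_conv snd_conv)
  then show "b \<in> posroots n A" using apos_real[OF b(2)] b(1) by (auto simp: posroots_def)
qed

section \<open>Finite and parabolic root sets and dual marks in these coordinates\<close>

lemma fword_root: "set ws \<subseteq> I0 \<Longrightarrow> c \<in> \<Delta> \<Longrightarrow> fword n A ws c \<in> \<Delta>"
  by (induction ws) (auto simp: fword_def frefl_root)

lemma I0_sub_II: "set ws \<subseteq> I0 \<Longrightarrow> set ws \<subseteq> II" by (auto simp: II_eq)

lemma wword_ar0: "set ws \<subseteq> I0 \<Longrightarrow> wword n A ws (ar c k) = ar (fword n A ws c) k"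
  by (induction ws) (auto simp: fword_def sref_ar I0_II frefl_eq rk_def)

lemma roots0_eq: "roots0 n A = {ar g 0 | g. g \<in> \<Delta>}"
proof -
  have "wword n A ws (sroot n A i) = ar (fword n A ws (unitv i)) 0" if "set ws \<subseteq> I0" "i \<in> I0" for ws i
    using that by (simp add: sroot_eq I0_II wword_ar0)
  then show ?thesis unfolding roots0_def froots_def by force
qed

lemma ar0_real: "g \<in> \<Delta> \<Longrightarrow> ar g 0 \<in> realroots n A"
proof -
  assume "g \<in> \<Delta>"
  then have "ar g 0 \<in> roots0 n A" by (auto simp: roots0_eq)
  then show ?thesis unfolding roots0_def realroots_def using I0_sub_II I0_II by blast
qed

lemma posroots0_eq: "posroots0 n A = {ar g 0 | g. g \<in> \<Delta>p}"
proof (intro set_eqI iffI)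
  fix b assume "b \<in> posroots0 n A"
  then obtain g h k where "g \<in> \<Delta>" "b = ar g 0" "b = ar h k" "apos h k"
    by (auto simp: posroots0_def roots0_eq posroots_eq)
  then have "apos g 0" using ar_inj[of g h 0 k] apos_root by auto
  then show "b \<in> {ar g 0 | g. g \<in> \<Delta>p}" using \<open>b = ar g 0\<close> by (auto simp: apos_def)
next
  fix b assume "b \<in> {ar g 0 | g. g \<in> \<Delta>p}"
  then obtain g where g: "b = ar g 0" "g \<in> \<Delta>p" by blast
  then have "apos g 0" using \<Delta>p_root by (simp add: apos_def)
  then show "b \<in> posroots0 n A" using g \<Delta>p_root unfolding posroots0_def roots0_eq
    by (auto simp: posroots_eq)
qed

lemma rootsJ_eq: assumes J: "J \<subseteq> I0" shows "rootsJ n A J = {ar g 0 | g. g \<in> \<Delta> \<and> (\<forall>k. k \<notin> J \<longrightarrow> g k = 0)}"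
proof -
  have fJ: "finite J" using finite_subset[OF J] by simp
  have w: "wsum (\<lambda>j. wscale (of_int (c j)) (sroot n A j)) J = ar (\<lambda>j. if j \<in> J then c j else 0) 0" for c
  proof -
    have "(\<Sum>j\<in>J. of_int (c j) * rt (unitv j) i) = rt (\<lambda>j. if j \<in> J then c j else 0) i" for i
    proof -
      have "(\<Sum>j\<in>J. of_int (c j) * rt (unitv j) i) = (\<Sum>j\<in>J. of_int (A i j) * of_int (c j))" if "i \<le> n"
        using that J by (intro sum.cong) (auto simp: rt_unitv subset_iff)
      also have "\<dots> = (\<Sum>j\<in>I0. of_int (A i j) * of_int (if j \<in> J then c j else 0))"
        by (rule sum.mono_neutral_cong_left) (use J in auto)
      finally show ?thesis using J by (auto simp: rt_def rt_unitv subset_iff intro!: sum.neutral)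
    qed
    moreover have "snd (sroot n A j) = 0" if "j \<in> J" for j using that J I0_le(2) by (auto simp: sroot_def)
    moreover have "fst (sroot n A j) = rt (unitv j)" if "j \<in> J" for j using that J by (auto simp: sroot_eq I0_II ar_def subset_iff)
    ultimately show ?thesis by (auto simp: wsum_def wscale_def ar_def)
  qed
  show ?thesis
  proof (intro set_eqI iffI)
    fix b assume "b \<in> rootsJ n A J"
    then obtain g c where g: "g \<in> \<Delta>" "b = ar g 0" "b = ar (\<lambda>j. if j \<in> J then c j else 0) 0"
      by (auto simp: rootsJ_def roots0_eq w)
    have "g = (\<lambda>j. if j \<in> J then c j else 0)"
      by (rule rt_inj) (use g J root_supp[OF g(1)] in \<open>auto simp: ar_def\<close>)
    then show "b \<in> {ar g 0 | g. g \<in> \<Delta> \<and> (\<forall>k. k \<notin> J \<longrightarrow> g k = 0)}" using g by auto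
  next
    fix b assume "b \<in> {ar g 0 | g. g \<in> \<Delta> \<and> (\<forall>k. k \<notin> J \<longrightarrow> g k = 0)}"
    then obtain g where g: "b = ar g 0" "g \<in> \<Delta>" "\<forall>k. k \<notin> J \<longrightarrow> g k = 0" by blast
    then have "g = (\<lambda>j. if j \<in> J then g j else 0)" by auto
    then have "b = wsum (\<lambda>j. wscale (of_int (g j)) (sroot n A j)) J" using w g(1) by metis
    then show "b \<in> rootsJ n A J" using g(1,2) unfolding rootsJ_def roots0_eq by blast
  qed
qed

lemma posrootsJ_eq: "J \<subseteq> I0 \<Longrightarrow> posrootsJ n A J = {ar g 0 | g. g \<in> \<Delta>p \<and> (\<forall>k. k \<notin> J \<longrightarrow> g k = 0)}"
proof (intro set_eqI iffI)
  assume J: "J \<subseteq> I0"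
  fix b
  { assume "b \<in> posrootsJ n A J"
    then obtain g h where "g \<in> \<Delta>" "\<forall>k. k \<notin> J \<longrightarrow> g k = 0" "b = ar g 0" "b = ar h 0" "h \<in> \<Delta>p"
      by (auto simp: posrootsJ_def rootsJ_eq[OF J] posroots0_eq)
    moreover from this have "g = h" using ar_inj[of g h 0 0] \<Delta>p_root by auto
    ultimately show "b \<in> {ar g 0 | g. g \<in> \<Delta>p \<and> (\<forall>k. k \<notin> J \<longrightarrow> g k = 0)}" by blast }
  { assume "b \<in> {ar g 0 | g. g \<in> \<Delta>p \<and> (\<forall>k. k \<notin> J \<longrightarrow> g k = 0)}"
    then show "b \<in> posrootsJ n A J"
      using \<Delta>p_root by (auto simp: posrootsJ_def rootsJ_eq[OF J] posroots0_eq) }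
qed

lemma dualmark_eq: "dualmark n A = (\<lambda>i. if i = 0 then 1 else if i \<in> I0 then of_int (fcoroot n A \<theta> i) else 0)"
  (is "_ = ?v")
  unfolding dualmark_def
proof (rule the_equality)
  have z: "(\<Sum>i\<in>II. ?v i * of_int (A i j)) = of_int (A 0 j) + (\<Sum>i\<in>I0. of_int (fcoroot n A \<theta> i) * of_int (A i j))" for j
    by (simp add: sum_II) (intro sum.cong, auto)
  have "(\<Sum>i\<in>II. ?v i * of_int (A i j)) = 0" if "j \<in> II" for j
  proof (cases "j = 0")
    case True
    have "(\<Sum>i\<in>I0. of_int (fcoroot n A \<theta> i) * of_int (A i 0)) = (\<Sum>i\<in>I0. of_int (fcoroot n A \<theta> i) * - rt \<theta> i)"
      by (intro sum.cong refl) (simp add: Aj0, simp add: rt_def I0_le)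
    also have "\<dots> = - pr (rt \<theta>) \<theta>" by (simp add: pr_coroot theta sum_negf)
    finally show ?thesis using True z[of 0] by (simp add: cf theta)
  next
    case False
    then have "j \<in> I0" using that II_eq by auto
    then show ?thesis using z[of j] by (simp add: A0j)
  qed
  moreover have "?v i = 0" if "n < i" for i using that by (auto simp: I0set_def)
  ultimately show "?v 0 = 1 \<and> (\<forall>i. n < i \<longrightarrow> ?v i = 0) \<and> (\<forall>j\<in>II. (\<Sum>i\<in>II. ?v i * of_int (A i j)) = 0)" by auto
  then have sol: "(\<Sum>i\<in>II. ?v i * of_int (A i j)) = 0" if "j \<in> II" for j using that by blast
  fix w assume w: "w 0 = 1 \<and> (\<forall>i. n < i \<longrightarrow> w i = (0::real)) \<and> (\<forall>j\<in>II. (\<Sum>i\<in>II. w i * of_int (A i j)) = 0)"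
  define x where "x i = w i - ?v i" for i
  have x0: "(\<Sum>i\<in>I0. x i * of_int (A i j)) = 0" if "j \<in> I0" for j
    using w sol[OF I0_II[OF that]] bspec[OF conjunct2[OF conjunct2[OF w]] I0_II[OF that]]
    by (simp add: sum_II x_def left_diff_distrib sum_subtractf)
  \<comment> \<open>Division by \<open>dd\<close> turns a vector in the left kernel into one on
    which the symmetric form vanishes. Its entries are real, so the lower bound is applied directly
    rather than through \<open>bil_pos\<close>.\<close>
  define y where "y i = x i / dd i" for i
  have xy: "x i = dd i * y i" if "i \<in> I0" for i using dd(1)[OF that] by (simp add: y_def)
  have "(\<Sum>i\<in>I0. (\<Sum>j\<in>I0. dd i * of_int (A i j) * uu j) / uu i * (y i)\<^sup>2) \<le> (\<Sum>i\<in>I0. \<Sum>j\<in>I0. dd i * of_int (A i j) * y i * y j)"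
    by (rule symmetrized_form_lower_bound)
      (use uu dd A_nonpos in \<open>auto simp: mult_nonneg_nonpos less_imp_le\<close>)
  also have "\<dots> = (\<Sum>j\<in>I0. y j * (\<Sum>i\<in>I0. x i * of_int (A i j)))"
    by (subst sum.swap) (simp add: xy sum_distrib_left mult_ac)
  also have "\<dots> = 0" by (simp add: x0)
  finally have le: "(\<Sum>i\<in>I0. eps i * (y i)\<^sup>2) \<le> 0" by (simp add: eps_def)
  have "y i = 0" if "i \<in> I0" for i
  proof -
    have "eps i * (y i)\<^sup>2 \<le> (\<Sum>i\<in>I0. eps i * (y i)\<^sup>2)"
      by (rule member_le_sum[where f="\<lambda>i. eps i * (y i)\<^sup>2"]) (use that eps_pos in \<open>auto simp: less_imp_le\<close>)
    then have "eps i * (y i)\<^sup>2 \<le> 0" using le by linarith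
    then show ?thesis using eps_pos[OF that] by (simp add: mult_le_0_iff)
  qed
  then have "w i = ?v i" if "i \<in> I0" for i using xy[OF that] that by (simp add: x_def)
  moreover have "w i = ?v i" if "i \<notin> I0" for i using that w by (cases "i = 0") (auto simp: I0set_def)
  ultimately show "w = ?v" by auto
qed

section \<open>The excess of an affine reflection\<close>

definition rw :: "(nat \<Rightarrow> int) \<Rightarrow> (nat \<Rightarrow> real) \<Rightarrow> nat \<Rightarrow> real" where
  "rw g v = (\<lambda>i. v i - pr v g * rt g i)"

lemma lz_rw: "lz v \<Longrightarrow> lz (rw g v)" by (simp add: rw_def lz_sub)

lemma pr_rw: "g \<in> \<Delta> \<Longrightarrow> c \<in> \<Delta> \<Longrightarrow> pr (rw g v) c = pr v (rf g c)"
  unfolding rw_def pr_vsub by (simp add: pr_rf)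

lemma pr_rw_rf: "g \<in> \<Delta> \<Longrightarrow> c \<in> \<Delta> \<Longrightarrow> pr (rw g v) (rf g c) = pr v c"
  by (simp add: pr_rw rf_root rf_invol)

lemma pr_rw_self: "g \<in> \<Delta> \<Longrightarrow> pr (rw g v) g = - pr v g"
  by (simp add: pr_rw rf_self pr_neg)

lemma rw_invol: "g \<in> \<Delta> \<Longrightarrow> rw g (rw g v) = v"
  by (subst rw_def) (simp add: pr_rw_self, simp add: rw_def)

lemma rw_neg: "rw (\<lambda>k. - g k) v = rw g v"
  by (simp add: rw_def pr_neg rt_neg)

lemma rw_conj: assumes "b \<in> \<Delta>" "g \<in> \<Delta>" shows "rw (rf b g) (rw b v) = rw b (rw g v)"
proof -
  have a: "pr (rw g v) b = pr v b - pr v g * pr (rt g) b" unfolding rw_def pr_vsub ..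
  have c: "rt (rf b g) = (\<lambda>i. rt g i - pr (rt g) b * rt b i)" using rt_rf[OF assms(1)] .
  have "rw (rf b g) (rw b v) = (\<lambda>i. rw b v i - pr v g * rt (rf b g) i)"
    unfolding rw_def[of "rf b g"] pr_rw_rf[OF assms] ..
  also have "\<dots> = (\<lambda>i. rw g v i - pr (rw g v) b * rt b i)"
    unfolding a c unfolding rw_def by (simp add: algebra_simps)
  finally show ?thesis by (simp add: rw_def[of b "rw g v"])
qed

lemma fst_sref: "lz (fst a) \<Longrightarrow> j \<in> II \<Longrightarrow> fst (sref n A j a) = rw (bb j) (fst a)"
  by (simp add: sref_eq rw_def lz_pr)

definition sg :: "real \<Rightarrow> int" where "sg x = (if x > 0 then 1 else if x < 0 then -1 else 0)"
definition ng :: "real \<Rightarrow> int" where "ng x = (if x < 0 then 1 else 0)"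

lemma sg_minus: "sg (- x) = - sg x" by (simp add: sg_def)
lemma sg_ng: "sg x = ng (- x) - ng x" by (simp add: sg_def ng_def)

text \<open>For \<open>v = w\<Lambda>\<close> with \<open>w\<close> minimal in its coset, \<open>N v\<close> is the length of \<open>w\<close>, and
  \<open>Sp v (w \<beta>)\<close> is \<open>\<langle>2\<rho> - 2\<rho>\<^sub>J, \<beta>\<^sup>\<or>\<rangle>\<close>.\<close>

definition N :: "(nat \<Rightarrow> real) \<Rightarrow> int" where "N v = (\<Sum>g\<in>\<Delta>p. ng (pr v g))"
definition Sp :: "(nat \<Rightarrow> real) \<Rightarrow> (nat \<Rightarrow> int) \<Rightarrow> int" where
  "Sp v g = (\<Sum>a\<in>{a\<in>\<Delta>. pr v a > 0}. cf a g)"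

text \<open>A simple reflection permutes the positive roots other than its own, so only the term of
  that root changes.\<close>

lemma N_refl: assumes j: "j \<in> I0" shows "N (rw (unitv j) v) = N v + sg (pr v (unitv j))"
proof -
  let ?e = "unitv j"
  have e: "?e \<in> \<Delta>p" "?e \<in> \<Delta>" using unitv_pos[OF j] unitv_root[OF j] by auto
  have mp: "rf ?e g \<in> \<Delta>p - {?e}" if "g \<in> \<Delta>p - {?e}" for g
  proof -
    have "rf ?e g \<in> \<Delta>p" using frefl_pos[of g j] that j by auto
    moreover have "rf ?e g \<noteq> ?e"
    proof
      assume "rf ?e g = ?e"
      then have "g = rf ?e ?e" using rf_invol[OF e(2)] by metis
      then have "g = (\<lambda>k. - ?e k)" using rf_self[OF e(2)] by simp
      then show False using \<Delta>p_exc[OF e(1)] that by auto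
    qed
    ultimately show ?thesis by auto
  qed
  have "(\<Sum>g\<in>\<Delta>p - {?e}. ng (pr (rw ?e v) g)) = (\<Sum>g\<in>\<Delta>p - {?e}. ng (pr v g))"
    by (rule sum.reindex_bij_witness[of _ "rf ?e" "rf ?e"])
      (use mp rf_invol[OF e(2)] pr_rw_rf[OF e(2)] pr_rw[OF e(2)] \<Delta>p_root in auto)
  then show ?thesis using e finite_\<Delta>p
    by (simp add: N_def sum.remove[of _ ?e] pr_rw_self sg_ng)
qed

lemma Sp_pos: "Sp v g = (\<Sum>a\<in>\<Delta>p. sg (pr v a) * cf a g)" if g: "g \<in> \<Delta>"
proof -
  let ?M = "(\<lambda>c k. - c k :: int) ` \<Delta>p"
  have u: "\<Delta> = \<Delta>p \<union> ?M"
  proof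
    show "\<Delta> \<subseteq> \<Delta>p \<union> ?M"
    proof
      fix c assume "c \<in> \<Delta>"
      then show "c \<in> \<Delta>p \<union> ?M" using \<Delta>p_cases[of c] by (auto intro!: image_eqI[of c _ "\<lambda>k. - c k"])
    qed
  qed (use \<Delta>p_root neg_root in auto)
  have d: "\<Delta>p \<inter> ?M = {}" using \<Delta>p_exc by auto
  have inj: "inj_on (\<lambda>c k. - c k :: int) \<Delta>p" by (rule inj_onI) (simp add: fun_eq_iff)
  let ?f = "\<lambda>a. if pr v a > 0 then cf a g else 0"
  have "Sp v g = (\<Sum>a\<in>\<Delta>. ?f a)"
    unfolding Sp_def using finite_roots by (simp add: sum.inter_filter)
  also have "\<dots> = (\<Sum>a\<in>\<Delta>p. ?f a) + (\<Sum>a\<in>?M. ?f a)"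
    by (subst (1) u) (rule sum.union_disjoint, use finite_\<Delta>p d in auto)
  also have "(\<Sum>a\<in>?M. ?f a) = (\<Sum>a\<in>\<Delta>p. ?f (\<lambda>k. - a k))"
    using inj by (simp add: sum.reindex)
  also have "(\<Sum>a\<in>\<Delta>p. ?f a) + \<dots> = (\<Sum>a\<in>\<Delta>p. sg (pr v a) * cf a g)"
    unfolding sum.distrib[symmetric] by (intro sum.cong) (auto simp: pr_neg cf_neg1[OF g] sg_def)
  finally show ?thesis .
qed

text \<open>The counterpart of \<open>N_refl\<close> for the node 0. The reflection fixes the
  positive roots orthogonal to \<open>\<theta>\<close> and sends each \<open>g\<close> with pairing
  1 to the negative of \<open>\<theta> - g\<close>; these changes of sign produce
  \<open>Sp v \<theta>\<close>.\<close>

lemma N_theta: "N (rw \<theta> v) = N v + Sp v \<theta> - sg (pr v \<theta>)"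
proof -
  have t: "\<theta> \<in> \<Delta>" "\<theta> \<in> \<Delta>p" using theta(1) theta_pos by auto
  define Q where "Q = {g \<in> \<Delta>p - {\<theta>}. cf g \<theta> = 1}"
  have fQ: "finite Q" using finite_\<Delta>p by (simp add: Q_def)
  have mp: "(\<lambda>k. \<theta> k - g k) \<in> Q" if "g \<in> Q" for g
  proof -
    have g: "g \<in> \<Delta>" "cf g \<theta> = 1" using that \<Delta>p_root by (auto simp: Q_def)
    have "(\<lambda>k. - rf \<theta> g k) \<in> \<Delta>" using neg_root rf_root t g by blast
    then have "(\<lambda>k. \<theta> k - g k) \<in> \<Delta>" using g by (simp add: rf_def)
    moreover have "cf (\<lambda>k. \<theta> k - 1 * g k) \<theta> = 1" unfolding cf_sub1[OF t(1)] using g t by simp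
    ultimately show ?thesis using theta_ge[OF g(1)] t by (auto simp: Q_def \<Delta>p_def)
  qed
  have refl: "rf \<theta> g = (\<lambda>k. - (\<theta> k - g k))" if "g \<in> Q" for g using that by (simp add: rf_def Q_def)
  have "(\<Sum>g\<in>Q. ng (pr (rw \<theta> v) g)) = (\<Sum>g\<in>Q. ng (- pr v g))"
  proof (rule sum.reindex_bij_witness[of _ "\<lambda>g k. \<theta> k - g k" "\<lambda>g k. \<theta> k - g k"])
    fix g assume g: "g \<in> Q"
    then have "g \<in> \<Delta>" using \<Delta>p_root by (auto simp: Q_def)
    then show "ng (- pr v (\<lambda>k. \<theta> k - g k)) = ng (pr (rw \<theta> v) g)"
      by (simp add: pr_rw t refl[OF g] pr_neg[of v "\<lambda>k. \<theta> k - g k", simplified])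
  qed (use mp in auto)
  then have 1: "(\<Sum>g\<in>Q. ng (pr (rw \<theta> v) g)) = (\<Sum>g\<in>Q. ng (pr v g)) + (\<Sum>g\<in>Q. sg (pr v g) * cf g \<theta>)"
    by (simp add: sg_ng sum_subtractf Q_def)
  have 2: "ng (pr (rw \<theta> v) g) = ng (pr v g)" "cf g \<theta> = 0" if "g \<in> \<Delta>p - {\<theta>} - Q" for g
  proof -
    have "g \<in> \<Delta>p" "g \<noteq> \<theta>" "cf g \<theta> \<noteq> 1" using that by (auto simp: Q_def)
    then show c: "cf g \<theta> = 0" using theta_cf_cases by blast
    then have "rf \<theta> g = g" by (simp add: rf_def)
    then show "ng (pr (rw \<theta> v) g) = ng (pr v g)" using that \<Delta>p_root t by (simp add: pr_rw)
  qed
  have split: "(\<Sum>g\<in>\<Delta>p. f g) = f \<theta> + (\<Sum>g\<in>Q. f g) + (\<Sum>g\<in>\<Delta>p - {\<theta>} - Q. f g)" for f :: "_ \<Rightarrow> int"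
  proof -
    have "(\<Sum>g\<in>\<Delta>p. f g) = f \<theta> + (\<Sum>g\<in>\<Delta>p - {\<theta>}. f g)" using finite_\<Delta>p t by (simp add: sum.remove)
    also have "(\<Sum>g\<in>\<Delta>p - {\<theta>}. f g) = (\<Sum>g\<in>\<Delta>p - {\<theta>} - Q. f g) + (\<Sum>g\<in>Q. f g)"
      using finite_\<Delta>p by (intro sum.subset_diff) (auto simp: Q_def)
    finally show ?thesis by simp
  qed
  have "Sp v \<theta> = 2 * sg (pr v \<theta>) + (\<Sum>g\<in>Q. sg (pr v g) * cf g \<theta>)"
    unfolding Sp_pos[OF t(1)] split using 2(2) t by simp
  moreover have "N (rw \<theta> v) = ng (- pr v \<theta>) + (\<Sum>g\<in>Q. ng (pr (rw \<theta> v) g)) + (\<Sum>g\<in>\<Delta>p - {\<theta>} - Q. ng (pr v g))"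
    unfolding N_def split using 2(1) t by (simp add: pr_rw_self)
  moreover have "N v = ng (pr v \<theta>) + (\<Sum>g\<in>Q. ng (pr v g)) + (\<Sum>g\<in>\<Delta>p - {\<theta>} - Q. ng (pr v g))"
    unfolding N_def split ..
  ultimately show ?thesis using 1 sg_ng[of "pr v \<theta>"] by linarith
qed

lemma cf_rf_rf: assumes "b \<in> \<Delta>" "g \<in> \<Delta>" shows "cf (rf b a) (rf b g) = cf a g"
proof -
  have "real_of_int (cf (rf b a) (rf b g)) = of_int (cf a g)"
    using assms by (simp add: cf_eq_bil rf_root bil_rf)
  then show ?thesis by linarith
qed

lemma cf_rf2: assumes "g \<in> \<Delta>" "c \<in> \<Delta>" shows "cf a (rf g c) = cf a c - cf g c * cf a g"
proof -
  have "real_of_int (cf a (rf g c)) = of_int (cf a c - cf g c * cf a g)"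
    using pr_rf[OF assms, of "rt a"] assms by (simp add: cf rf_root)
  then show ?thesis by linarith
qed

lemma Sp_equiv: assumes "b \<in> \<Delta>" "g \<in> \<Delta>" shows "Sp (rw b v) (rf b g) = Sp v g"
  unfolding Sp_def
  by (rule sum.reindex_bij_witness[of _ "rf b" "rf b"])
    (use assms in \<open>auto simp: rf_invol rf_root pr_rw cf_rf_rf, metis cf_rf_rf rf_invol\<close>)

lemma Sp_rf: assumes "g \<in> \<Delta>" "c \<in> \<Delta>" shows "Sp v (rf g c) = Sp v c - cf g c * Sp v g"
  unfolding Sp_def by (simp add: cf_rf2[OF assms] sum_subtractf sum_distrib_left)

text \<open>Among the roots pairing positively with \<open>v\<close>, the reflection in
  \<open>g\<close> maps those with negative \<open>cf a g\<close> injectively to others with the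
  opposite value, never to \<open>g\<close>. These contributions cancel, \<open>g\<close> adds 2,
  and the rest is nonnegative.\<close>

lemma Sp_ge: assumes g: "g \<in> \<Delta>" and p: "pr v g > 0" shows "Sp v g \<ge> 2"
proof -
  define P where "P = {a\<in>\<Delta>. pr v a > 0}"
  have fP: "finite P" using finite_roots by (simp add: P_def)
  define M where "M = {a\<in>P. cf a g < 0}"
  have inj: "inj_on (rf g) M" using rf_invol[OF g] by (metis inj_onI)
  have sub: "rf g ` M \<subseteq> {a\<in>P. cf a g > 0} - {g}"
  proof
    fix c assume "c \<in> rf g ` M"
    then obtain a where a: "a \<in> \<Delta>" "pr v a > 0" "cf a g < 0" "c = rf g a" by (auto simp: M_def P_def)
    have "cf g a < 0"
    proof -
      have "bil a g < 0" using bil_cf[OF g, of a] a(3) root_bil_pos[OF g] by (smt (verit) mult_neg_pos of_int_less_0_iff)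
      then have "real_of_int (cf g a) < 0" using root_bil_pos[OF a(1)] by (simp add: cf_eq_bil a bil_sym[of g a] divide_neg_pos)
      then show ?thesis by linarith
    qed
    then have "pr (rt g) a < 0" using cf[OF a(1), of g] by simp
    then have "pr (rt g) a * pr v g < 0" using p by (simp add: mult_neg_pos)
    then have "pr v c > 0" using a p by (simp add: pr_rf[OF g a(1)])
    moreover have "cf c g = - cf a g" unfolding a(4) rf_def cf_sub1[OF g] using g by simp
    moreover have "c \<noteq> g"
    proof
      assume "c = g"
      then have "a = rf g g" using a(4) rf_invol[OF g] by metis
      then have "pr v a = - pr v g" using rf_self[OF g] pr_neg by simp
      then show False using a(2) p by simp
    qed
    ultimately show "c \<in> {a\<in>P. cf a g > 0} - {g}" using a rf_root[OF g a(1)] by (auto simp: P_def)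
  qed
  have "(\<Sum>a\<in>M. cf a g) + (\<Sum>a\<in>rf g ` M. cf a g) = 0"
  proof -
    have "(\<Sum>a\<in>rf g ` M. cf a g) = (\<Sum>a\<in>M. cf (rf g a) g)" using inj by (simp add: sum.reindex)
    also have "\<dots> = (\<Sum>a\<in>M. - cf a g)" by (intro sum.cong refl) (unfold rf_def cf_sub1[OF g], use g in simp)
    finally show ?thesis by (simp add: sum_negf)
  qed
  moreover have "(\<Sum>a\<in>rf g ` M. cf a g) \<le> (\<Sum>a\<in>{a\<in>P. cf a g > 0} - {g}. cf a g)"
    by (rule sum_mono2) (use fP sub in auto)
  moreover have "(\<Sum>a\<in>P. cf a g) = (\<Sum>a\<in>M. cf a g) + (\<Sum>a\<in>{a\<in>P. cf a g > 0}. cf a g)"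
  proof -
    have "(\<Sum>a\<in>P. cf a g) = (\<Sum>a\<in>M \<union> {a\<in>P. cf a g > 0}. cf a g)"
      by (rule sum.mono_neutral_right) (use fP in \<open>auto simp: M_def\<close>)
    also have "\<dots> = (\<Sum>a\<in>M. cf a g) + (\<Sum>a\<in>{a\<in>P. cf a g > 0}. cf a g)"
      by (rule sum.union_disjoint) (use fP in \<open>auto simp: M_def\<close>)
    finally show ?thesis .
  qed
  moreover have "(\<Sum>a\<in>{a\<in>P. cf a g > 0}. cf a g) = 2 + (\<Sum>a\<in>{a\<in>P. cf a g > 0} - {g}. cf a g)"
    using finite_roots g p by (subst sum.remove[of _ g]) (auto simp: P_def)
  ultimately show ?thesis unfolding Sp_def P_def[symmetric] by linarith
qed

text \<open>\<open>D u g k\<close> plays the role of a difference of semi-infinite lengths. Its values \<open>1\<close> single out both the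
  cover relations of the level-zero order and the edges of the parabolic quantum Bruhat graph.\<close>

definition D :: "(nat \<Rightarrow> real) \<Rightarrow> (nat \<Rightarrow> int) \<Rightarrow> int \<Rightarrow> int" where
  "D u g k = N u - N (rw g u) + k * Sp (rw g u) g"

text \<open>For \<open>j = 0\<close> the counts \<open>N\<close> at the two ends also change by
  \<open>Sp u \<theta>\<close> and \<open>Sp (rw g u) \<theta>\<close>. These differ by a multiple
  \<open>cf g \<theta>\<close> of \<open>Sp (rw g u) g\<close>, which is cancelled by passing from
  \<open>k\<close> to \<open>rk 0 g k\<close>; this explains the term with \<open>k\<close> in
  \<open>D\<close>.\<close>

lemma D_refl:
  assumes "lz u" "g \<in> \<Delta>" "j \<in> II"
  shows "D u g k - D (rw (bb j) u) (rf (bb j) g) (rk j g k) = sg (rw g u j) - sg (u j)"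
proof -
  have b: "bb j \<in> \<Delta>" using bb_root assms by blast
  have c: "rw (rf (bb j) g) (rw (bb j) u) = rw (bb j) (rw g u)" using rw_conj[OF b assms(2)] .
  have S: "Sp (rw (bb j) (rw g u)) (rf (bb j) g) = Sp (rw g u) g" using Sp_equiv[OF b assms(2)] .
  have D': "D (rw (bb j) u) (rf (bb j) g) (rk j g k) = N (rw (bb j) u) - N (rw (bb j) (rw g u)) + rk j g k * Sp (rw g u) g"
    by (simp add: D_def c S)
  show ?thesis
  proof (cases "j = 0")
    case False
    then have j: "j \<in> I0" using assms(3) II_eq by auto
    then show ?thesis unfolding D' by (simp add: D_def rk_def N_refl pr_unitv)
  next
    case True
    have "Sp u \<theta> = Sp (rw g u) (rf g \<theta>)" using Sp_equiv[OF assms(2) theta(1)] by simp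
    then have "Sp u \<theta> = Sp (rw g u) \<theta> - cf g \<theta> * Sp (rw g u) g" using Sp_rf[OF assms(2) theta(1)] by simp
    moreover have "u 0 = - pr u \<theta>" "rw g u 0 = - pr (rw g u) \<theta>" using assms(1) lz_rw[of u g] by (auto simp: lz_def)
    ultimately show ?thesis unfolding D' using True
      by (simp add: D_def rk_def rw_neg N_theta sg_minus cf_neg2 theta algebra_simps)
  qed
qed

lemma D_simple:
  assumes "lz u" "j \<in> II" "u j < 0"
  shows "D u (bb j) (ee j) = 1"
proof (cases "j = 0")
  case False
  then have j: "j \<in> I0" using assms(2) II_eq by auto
  then show ?thesis using assms(3) by (simp add: D_def N_refl pr_unitv sg_def)
next
  case True
  have "Sp (rw \<theta> u) (\<lambda>k. - \<theta> k) = Sp u \<theta>" using Sp_equiv[OF theta(1) theta(1), of u] rf_self[OF theta(1)] by simp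
  moreover have "pr u \<theta> > 0" using assms True by (simp add: lz_def)
  ultimately show ?thesis using True by (simp add: D_def rw_neg N_theta sg_def)
qed

lemma rw_coord: "rt g j > 0 \<Longrightarrow> pr u g < 0 \<Longrightarrow> u j < rw g u j"
  by (simp add: rw_def mult_less_0_iff)

lemma sg_mono: "x \<le> y \<Longrightarrow> sg x \<le> sg y" by (auto simp: sg_def)

text \<open>Descending along \<open>rt g j > 0\<close>, the \<open>j\<close>-th coordinate grows
  from \<open>u\<close> to its reflection. So the correction in \<open>D_refl\<close> is
  nonnegative, and the value never falls below the one at a simple root.\<close>

lemma D_ge1: "apos g k \<Longrightarrow> lz u \<Longrightarrow> pr u g < 0 \<Longrightarrow> 1 \<le> D u g k"
proof (induction arbitrary: u rule: apos_induct)
  case (simple j) then show ?case using D_simple[of u j] by (simp add: lz_pr)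
next
  case (step g k j)
  have g: "g \<in> \<Delta>" and b: "bb j \<in> \<Delta>" using step apos_root bb_root by auto
  have "1 \<le> D (rw (bb j) u) (rf (bb j) g) (rk j g k)"
    using step.IH[of "rw (bb j) u"] step.prems lz_rw pr_rw_rf[OF b g] by simp
  moreover have "sg (u j) \<le> sg (rw g u j)" using rw_coord[OF step(4) step.prems(2)] sg_mono by simp
  ultimately show ?case using D_refl[OF step.prems(1) g step(2), of k] by linarith
qed

section \<open>Chains in the level-zero order\<close>

text \<open>The weight \<open>a\<close> is the greater one. At level zero \<open>k\<close> affects
  the positivity of the root and the new delta coefficient, but not the pairing.\<close>

definition stp :: "wt \<Rightarrow> wt \<Rightarrow> bool" where
  "stp a b \<longleftrightarrow> lz (fst a) \<and> (\<exists>g k. apos g k \<and> pr (fst a) g < 0 \<and> b = rr g k a)"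

lemma fst_rr: "lz (fst a) \<Longrightarrow> fst (rr g k a) = rw g (fst a)"
  by (simp add: rr_eq rw_def cp_lz)

lemma stp_lz: "stp a b \<Longrightarrow> lz (fst a)" "stp a b \<Longrightarrow> lz (fst b)"
  by (auto simp: stp_def fst_rr lz_rw)

lemma rk_rk: "j \<in> II \<Longrightarrow> rk j (rf (bb j) g) (rk j g k) = k"
  using bb_root[of j] by (simp add: rk_def cf_neg1) (simp add: rf_def cf_sub1)

lemma sref_rr:
  assumes "g \<in> \<Delta>" "j \<in> II"
  shows "sref n A j (rr g k a) = rr (rf (bb j) g) (rk j g k) (sref n A j a)"
proof -
  have b: "bb j \<in> \<Delta>" using bb_root assms by blast
  have c: "cp (fst (sref n A j a)) (rf (bb j) g) (rk j g k) = cp (fst a) g k"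
    using cp_sref[OF rf_root[OF b assms(1)] assms(2), of a "rk j g k"] rf_invol[OF b] rk_rk[OF assms(2)] by simp
  have "sref n A j (rr g k a) = wdiff (sref n A j a) (wscale (cp (fst a) g k) (sref n A j (ar g k)))"
    unfolding rr_def using wword_linear[of "[j]"] assms(2) by simp
  then show ?thesis unfolding rr_def c using sref_ar[OF assms(2)] by simp
qed

lemma rr_simple: "j \<in> II \<Longrightarrow> rr (bb j) (ee j) a = sref n A j a"
  using root_word[of "[]" j] ar_inj[OF bb_root] by (auto simp: rr_def sref_def sroot_eq)

lemma stp_simple: "lz (fst a) \<Longrightarrow> j \<in> II \<Longrightarrow> fst a j < 0 \<Longrightarrow> stp a (sref n A j a)"
  unfolding stp_def using apos_simple lz_pr rr_simple by metis

lemma sref_coord: "j \<in> II \<Longrightarrow> fst (sref n A j a) j = - fst a j"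
  by (simp add: sref_eq rt_bb)

lemma sref_fix: "j \<in> II \<Longrightarrow> fst a j = 0 \<Longrightarrow> sref n A j a = a"
  by (simp add: sref_eq)

lemma stp_simple': "lz (fst a) \<Longrightarrow> j \<in> II \<Longrightarrow> fst a j > 0 \<Longrightarrow> stp (sref n A j a) a"
  using stp_simple[of "sref n A j a" j] lz_sref sref_coord sref_invol by simp

lemma stp_sref:
  assumes "lz (fst a)" "apos g k" "pr (fst a) g < 0" "j \<in> II" "\<not> (g = bb j \<and> k = ee j)"
  shows "stp (sref n A j a) (sref n A j (rr g k a))"
proof -
  have g: "g \<in> \<Delta>" and b: "bb j \<in> \<Delta>" using assms apos_root bb_root by auto
  have "pr (fst (sref n A j a)) (rf (bb j) g) = pr (fst a) g"
    using fst_sref[OF assms(1,4)] pr_rw_rf[OF b g] by simp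
  then show ?thesis unfolding stp_def sref_rr[OF g assms(4)]
    using apos_refl[OF assms(2,4,5)] assms lz_sref by metis
qed

lemma stp_cases [consumes 2, case_names simple other]:
  assumes "stp a b" "j \<in> II"
  obtains "fst a j < 0" "fst b j > 0" "b = sref n A j a" | "stp (sref n A j a) (sref n A j b)"
proof -
  obtain g k where gk: "lz (fst a)" "apos g k" "pr (fst a) g < 0" "b = rr g k a"
    using assms(1) by (auto simp: stp_def)
  show ?thesis
  proof (cases "g = bb j \<and> k = ee j")
    case True
    then have "b = sref n A j a" using gk rr_simple assms(2) by simp
    moreover have "fst a j < 0" using gk True lz_pr assms(2) by simp
    ultimately show ?thesis using that(1) sref_coord assms(2) by simp
  next
    case False
    then show ?thesis using that(2) stp_sref[OF gk(1-3) assms(2)] gk by simp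
  qed
qed

lemma relpow2: "R a b \<Longrightarrow> R b c \<Longrightarrow> (R ^^ 2) a c" for R :: "wt \<Rightarrow> wt \<Rightarrow> bool"
  by (auto simp: numeral_2_eq_2)
lemma relpow3: "R a b \<Longrightarrow> R b c \<Longrightarrow> R c d \<Longrightarrow> (R ^^ 3) a d" for R :: "wt \<Rightarrow> wt \<Rightarrow> bool"
  by (auto simp: numeral_3_eq_3)
lemma relpow1: "R a b \<Longrightarrow> (R ^^ 1) a b" for R :: "wt \<Rightarrow> wt \<Rightarrow> bool" by (simp only: relpowp_1)

text \<open>Replacing every member of a chain by the smaller (larger) one of itself and its image under
  \<open>r\<^sub>j\<close> yields a chain again; the correction terms account for the steps along \<open>\<alpha>\<^sub>j\<close>.\<close>

definition fd :: "nat \<Rightarrow> wt \<Rightarrow> wt" where "fd j a = (if fst a j > 0 then sref n A j a else a)"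
definition fu :: "nat \<Rightarrow> wt \<Rightarrow> wt" where "fu j a = (if fst a j < 0 then sref n A j a else a)"

lemma fold_down_step:
  assumes s: "stp a b" and j: "j \<in> II"
  shows "\<exists>m. (stp ^^ m) (fd j a) (fd j b) \<and> m + of_bool (fst b j > 0) \<ge> 1 + of_bool (fst a j > 0)"
  using s j
proof (cases rule: stp_cases)
  case simple
  then have "fd j a = a" "fd j b = a" using sref_invol j by (auto simp: fd_def)
  then show ?thesis using simple by (intro exI[of _ 0]) auto
next
  case other
  note lz = stp_lz[OF s]
  consider "fst a j > 0" "fst b j > 0" | "fst a j > 0" "fst b j \<le> 0" | "fst a j \<le> 0" "fst b j \<le> 0"
    | "fst a j < 0" "fst b j > 0" | "fst a j = 0" "fst b j > 0" by linarith
  then show ?thesis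
  proof cases
    case 1 then show ?thesis using other by (intro exI[of _ 1]) (auto simp: fd_def)
  next
    case 2
    then show ?thesis using relpow2[of stp, OF stp_simple'[OF lz(1) j] s] by (intro exI[of _ 2]) (auto simp: fd_def)
  next
    case 3 then show ?thesis using s by (intro exI[of _ 1]) (auto simp: fd_def)
  next
    case 4
    then show ?thesis using relpow2[of stp, OF stp_simple[OF lz(1) j] other] by (intro exI[of _ 2]) (auto simp: fd_def)
  next
    case 5
    then show ?thesis using other sref_fix[OF j] by (intro exI[of _ 1]) (auto simp: fd_def)
  qed
qed

lemma fold_up_step:
  assumes s: "stp a b" and j: "j \<in> II"
  shows "\<exists>m. (stp ^^ m) (fu j a) (fu j b) \<and> m + of_bool (fst a j < 0) \<ge> 1 + of_bool (fst b j < 0)"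
  using s j
proof (cases rule: stp_cases)
  case simple
  then have "fu j a = b" "fu j b = b" by (auto simp: fu_def)
  then show ?thesis using simple by (intro exI[of _ 0]) auto
next
  case other
  note lz = stp_lz[OF s]
  consider "fst a j < 0" "fst b j < 0" | "fst a j \<ge> 0" "fst b j < 0" | "fst a j \<ge> 0" "fst b j \<ge> 0"
    | "fst a j < 0" "fst b j > 0" | "fst a j < 0" "fst b j = 0" by linarith
  then show ?thesis
  proof cases
    case 1 then show ?thesis using other by (intro exI[of _ 1]) (auto simp: fu_def)
  next
    case 2
    then show ?thesis using relpow2[of stp, OF s stp_simple[OF lz(2) j]] by (intro exI[of _ 2]) (auto simp: fu_def)
  next
    case 3 then show ?thesis using s by (intro exI[of _ 1]) (auto simp: fu_def)
  next
    case 4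
    then show ?thesis using relpow2[of stp, OF other stp_simple'[OF lz(2) j]] by (intro exI[of _ 2]) (auto simp: fu_def)
  next
    case 5
    then show ?thesis using other sref_fix[OF j, of b] by (intro exI[of _ 1]) (auto simp: fu_def)
  qed
qed

lemma fold_down:
  assumes j: "j \<in> II"
  shows "(stp ^^ l) a b \<Longrightarrow> \<exists>m. (stp ^^ m) (fd j a) (fd j b) \<and> m + of_bool (fst b j > 0) \<ge> l + of_bool (fst a j > 0)"
proof (induction l arbitrary: b)
  case 0 then show ?case by (intro exI[of _ 0]) auto
next
  case (Suc l)
  then obtain c where c: "(stp ^^ l) a c" "stp c b" by auto
  obtain m where m: "(stp ^^ m) (fd j a) (fd j c)" "m + of_bool (fst c j > 0) \<ge> l + of_bool (fst a j > 0)"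
    using Suc.IH[OF c(1)] by blast
  obtain m' where m': "(stp ^^ m') (fd j c) (fd j b)" "m' + of_bool (fst b j > 0) \<ge> 1 + of_bool (fst c j > 0)"
    using fold_down_step[OF c(2) j] by blast
  have "(stp ^^ (m + m')) (fd j a) (fd j b)" using m(1) m'(1) by (auto simp: relpowp_add)
  then show ?case using m(2) m'(2) by (intro exI[of _ "m + m'"]) linarith
qed

lemma fold_up:
  assumes j: "j \<in> II"
  shows "(stp ^^ l) a b \<Longrightarrow> \<exists>m. (stp ^^ m) (fu j a) (fu j b) \<and> m + of_bool (fst a j < 0) \<ge> l + of_bool (fst b j < 0)"
proof (induction l arbitrary: b)
  case 0 then show ?case by (intro exI[of _ 0]) auto
next
  case (Suc l)
  then obtain c where c: "(stp ^^ l) a c" "stp c b" by auto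
  obtain m where m: "(stp ^^ m) (fu j a) (fu j c)" "m + of_bool (fst a j < 0) \<ge> l + of_bool (fst c j < 0)"
    using Suc.IH[OF c(1)] by blast
  obtain m' where m': "(stp ^^ m') (fu j c) (fu j b)" "m' + of_bool (fst c j < 0) \<ge> 1 + of_bool (fst b j < 0)"
    using fold_up_step[OF c(2) j] by blast
  have "(stp ^^ (m + m')) (fu j a) (fu j b)" using m(1) m'(1) by (auto simp: relpowp_add)
  then show ?case using m(2) m'(2) by (intro exI[of _ "m + m'"]) linarith
qed

text \<open>A functional that is positive on all positive real roots; it shows that chains never return.\<close>

definition ff :: "(nat \<Rightarrow> real) \<Rightarrow> real" where "ff v = (\<Sum>i\<in>I0. dd i * uu i * v i)"
definition pot :: "wt \<Rightarrow> real" where "pot a = ff (fst a) + (ff (rt \<theta>) + 1) * snd a"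

text \<open>Symmetry of \<open>dd i * A i j\<close> moves \<open>A\<close> onto \<open>uu\<close>,
  and \<open>A uu\<close> is positive; hence the positive coefficients.\<close>

lemma ff_rt: "ff (rt g) = (\<Sum>j\<in>I0. eps j * uu j * of_int (g j))"
proof -
  have "ff (rt g) = (\<Sum>i\<in>I0. \<Sum>j\<in>I0. dd i * uu i * of_int (A i j) * of_int (g j))"
    unfolding ff_def by (intro sum.cong refl) (simp add: rt_def I0_le sum_distrib_left mult_ac)
  also have "\<dots> = (\<Sum>j\<in>I0. (\<Sum>i\<in>I0. dd j * of_int (A j i) * uu i) * of_int (g j))"
    by (subst sum.swap) (intro sum.cong refl, simp add: sum_distrib_right, intro sum.cong refl, use dd(2) in \<open>simp add: mult_ac\<close>)
  finally show ?thesis using uu(1) by (auto simp: eps_def intro!: sum.cong)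
qed

lemma ff_mono: "(\<And>k. g k \<le> h k) \<Longrightarrow> ff (rt g) \<le> ff (rt h)"
  unfolding ff_rt using eps_pos uu(1) by (intro sum_mono mult_left_mono) (auto simp: less_imp_le)

lemma ff_rt_pos: assumes "g \<in> \<Delta>p" shows "ff (rt g) > 0"
proof -
  obtain k where "k \<in> I0" "g k \<noteq> 0" using root_nz[OF \<Delta>p_root[OF assms]] by blast
  then show ?thesis unfolding ff_rt using assms eps_pos uu(1)
    by (intro sum_pos2[of _ k]) (auto simp: \<Delta>p_def order_less_le)
qed

text \<open>The weight of delta in \<open>pot\<close> exceeds \<open>ff\<close> of the highest root,
  so it outweighs the most negative value on a finite root.\<close>

lemma pot_ar: assumes "apos g k" shows "pot (ar g k) > 0"
proof (cases "k = 0")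
  case True then show ?thesis using assms ff_rt_pos by (simp add: apos_def pot_def ar_def)
next
  case False
  then have k: "k \<ge> 1" using assms by (auto simp: apos_def)
  have nn: "ff (rt (\<lambda>k. - c k)) = - ff (rt c)" for c by (simp add: ff_rt sum_negf)
  have "ff (rt (\<lambda>k. - \<theta> k)) \<le> ff (rt g)"
    using theta_ge[OF neg_root[OF apos_root[OF assms]]] by (intro ff_mono) (auto simp: minus_le_iff)
  moreover have "ff (rt \<theta>) + 1 \<le> (ff (rt \<theta>) + 1) * of_int k"
    using mult_left_mono[of 1 "real_of_int k" "ff (rt \<theta>) + 1"] k ff_rt_pos[OF theta_pos] by simp
  ultimately show ?thesis unfolding pot_def ar_def by (simp add: nn)
qed

lemma pot_rr: "pot (rr g k a) = pot a - cp (fst a) g k * pot (ar g k)"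
  by (simp add: pot_def rr_eq ff_def ar_def algebra_simps sum_subtractf sum_distrib_left)

lemma stp_pot: "stp a b \<Longrightarrow> pot a < pot b"
  by (auto simp: stp_def pot_rr cp_lz mult_neg_pos pot_ar)

lemma chain_pot: "(stp ^^ m) a b \<Longrightarrow> pot a \<le> pot b \<and> (0 < m \<longrightarrow> pot a < pot b)"
proof (induction m arbitrary: b)
  case (Suc m)
  then obtain c where "(stp ^^ m) a c" "stp c b" by auto
  then show ?case using Suc.IH[of c] stp_pot[of c b] by auto
qed auto

lemma chain_refl: "(stp ^^ m) a a \<Longrightarrow> m = 0"
  using chain_pot[of m a a] by auto

lemma sg_eq: "sg x = sg y \<Longrightarrow> x < y \<Longrightarrow> 0 < x \<or> y < 0" by (auto simp: sg_def split: if_splits)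

text \<open>If the signs at \<open>j\<close> differ at the two ends, simple steps added to the
  reflected step give a longer chain at once. If they agree, reflection preserves the excess, and
  the chain from the induction hypothesis is folded back without becoming shorter.\<close>

lemma excess_refinement:
  "apos g k \<Longrightarrow> lz (fst a) \<Longrightarrow> pr (fst a) g < 0 \<Longrightarrow> 2 \<le> D (fst a) g k \<Longrightarrow> \<exists>m\<ge>2. (stp ^^ m) a (rr g k a)"
proof (induction arbitrary: a rule: apos_induct)
  case (simple j)
  then show ?case using D_simple[of "fst a" j] by (simp add: lz_pr)
next
  case (step g k j)
  have g: "g \<in> \<Delta>" and b: "bb j \<in> \<Delta>" using step apos_root bb_root by auto
  note lz = step.prems(1) and j = step(2)
  let ?b = "rr g k a" and ?r = "sref n A j"
  have fb: "fst ?b = rw g (fst a)" using fst_rr[OF lz] .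
  have lzb: "lz (fst ?b)" using fb lz_rw[OF lz] by simp
  have lt: "fst a j < fst ?b j" using rw_coord[OF step(4) step.prems(2)] fb by simp
  have s: "stp (?r a) (?r ?b)" using stp_sref[OF lz step(1) step.prems(2) j step(3)] .
  have chain: "\<exists>m\<ge>2. (stp ^^ m) (?r a) (?r ?b)" if "sg (fst a j) = sg (fst ?b j)"
  proof -
    have "D (fst (?r a)) (rf (bb j) g) (rk j g k) = D (fst a) g k"
      using D_refl[OF lz g j, of k] fst_sref[OF lz j] fb that by simp
    moreover have "pr (fst (?r a)) (rf (bb j) g) < 0" using fst_sref[OF lz j] pr_rw_rf[OF b g] step.prems(2) by simp
    ultimately show ?thesis using step.IH[of "?r a"] lz_sref[OF lz j] step.prems(3) sref_rr[OF g j] by auto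
  qed
  consider "fst a j < 0" "fst ?b j > 0" | "fst a j < 0" "fst ?b j = 0" | "fst a j = 0" "fst ?b j > 0"
    | "fst a j > 0" "fst ?b j > 0" | "fst a j < 0" "fst ?b j < 0" using lt by linarith
  then show ?case
  proof cases
    case 1
    then have "(stp ^^ 3) a ?b" using relpow3[of stp, OF stp_simple[OF lz j] s stp_simple'[OF lzb j]] by simp
    then show ?thesis by (intro exI[of _ 3]) auto
  next
    case 2
    then have "(stp ^^ 2) a ?b" using relpow2[of stp, OF stp_simple[OF lz j] s] sref_fix[OF j, of ?b] by simp
    then show ?thesis by (intro exI[of _ 2]) auto
  next
    case 3
    then have "(stp ^^ 2) a ?b" using relpow2[of stp, OF s stp_simple'[OF lzb j]] sref_fix[OF j, of a] by simp
    then show ?thesis by (intro exI[of _ 2]) auto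
  next
    case 4
    then obtain m where m: "m \<ge> 2" "(stp ^^ m) (?r a) (?r ?b)" using chain by (auto simp: sg_def)
    obtain m' where m': "(stp ^^ m') (fu j (?r a)) (fu j (?r ?b))" "m' + of_bool (fst (?r a) j < 0) \<ge> m + of_bool (fst (?r ?b) j < 0)"
      using fold_up[OF j m(2)] by blast
    then have "m' \<ge> m" "(stp ^^ m') a ?b" using 4 by (auto simp: fu_def sref_coord[OF j] sref_invol[OF j])
    then show ?thesis using m(1) by (intro exI[of _ m']) auto
  next
    case 5
    then obtain m where m: "m \<ge> 2" "(stp ^^ m) (?r a) (?r ?b)" using chain by (auto simp: sg_def)
    obtain m' where m': "(stp ^^ m') (fd j (?r a)) (fd j (?r ?b))" "m' + of_bool (fst (?r ?b) j > 0) \<ge> m + of_bool (fst (?r a) j > 0)"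
      using fold_down[OF j m(2)] by blast
    then have "m' \<ge> m" "(stp ^^ m') a ?b" using 5 by (auto simp: fd_def sref_coord[OF j] sref_invol[OF j])
    then show ?thesis using m(1) by (intro exI[of _ m']) auto
  qed
qed

text \<open>Excess 1 leaves no room for a change of sign, so the reflected pair has excess 1 again.
  Any chain between the original ends folds to a chain between the reflected ends that is at least
  as long.\<close>

lemma excess_one_cover:
  "apos g k \<Longrightarrow> lz (fst a) \<Longrightarrow> pr (fst a) g < 0 \<Longrightarrow> D (fst a) g k = 1 \<Longrightarrow> (stp ^^ m) a (rr g k a) \<Longrightarrow> m \<le> 1"
proof (induction arbitrary: a m rule: apos_induct)
  case (simple j)
  have j: "j \<in> II" using simple by simp
  have b: "rr (bb j) (ee j) a = sref n A j a" using rr_simple[OF j] .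
  have neg: "fst a j < 0" using simple lz_pr by simp
  \<comment> \<open>Folding brings both ends to \<open>a\<close>. A closed chain is empty, and the
    correction term then allows at most one step.\<close>
  obtain m' where m': "(stp ^^ m') (fd j a) (fd j (sref n A j a))" "m' + of_bool (fst (sref n A j a) j > 0) \<ge> m + of_bool (fst a j > 0)"
    using fold_down[OF j simple(5)[unfolded b]] by blast
  then have c: "(stp ^^ m') a a" "m' + 1 \<ge> m" using neg by (auto simp: fd_def sref_coord[OF j] sref_invol[OF j])
  from chain_refl[OF c(1)] c(2) show ?case by simp
next
  case (step g k j)
  have g: "g \<in> \<Delta>" and b: "bb j \<in> \<Delta>" using step apos_root bb_root by auto
  note lz = step.prems(1) and j = step(2)
  let ?b = "rr g k a" and ?r = "sref n A j"
  have fb: "fst ?b = rw g (fst a)" using fst_rr[OF lz] .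
  have lt: "fst a j < fst ?b j" using rw_coord[OF step(4) step.prems(2)] fb by simp
  have p: "pr (fst (?r a)) (rf (bb j) g) < 0" using fst_sref[OF lz j] pr_rw_rf[OF b g] step.prems(2) by simp
  have "1 \<le> D (fst (?r a)) (rf (bb j) g) (rk j g k)"
    using D_ge1[OF step(5) lz_sref[OF lz j] p] .
  moreover have e: "D (fst a) g k - D (fst (?r a)) (rf (bb j) g) (rk j g k) = sg (fst ?b j) - sg (fst a j)"
    using D_refl[OF lz g j, of k] fst_sref[OF lz j] fb by simp
  moreover have "sg (fst a j) \<le> sg (fst ?b j)" using lt sg_mono by simp
  ultimately have D1: "D (fst (?r a)) (rf (bb j) g) (rk j g k) = 1" and sgeq: "sg (fst a j) = sg (fst ?b j)"
    using step.prems(3) by linarith+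
  have IH: "m' \<le> 1" if "(stp ^^ m') (?r a) (?r ?b)" for m'
    using step.IH[OF lz_sref[OF lz j] p D1] that sref_rr[OF g j] by simp
  from sg_eq[OF sgeq lt] show ?case
  proof
    assume pos: "0 < fst a j"
    obtain m' where m': "(stp ^^ m') (fd j a) (fd j ?b)" "m' + of_bool (fst ?b j > 0) \<ge> m + of_bool (fst a j > 0)"
      using fold_down[OF j step.prems(4)] by blast
    then show ?thesis using IH[of m'] pos lt by (auto simp: fd_def)
  next
    assume neg: "fst ?b j < 0"
    obtain m' where m': "(stp ^^ m') (fu j a) (fu j ?b)" "m' + of_bool (fst a j < 0) \<ge> m + of_bool (fst ?b j < 0)"
      using fold_up[OF j step.prems(4)] by blast
    then show ?thesis using IH[of m'] neg lt by (auto simp: fu_def)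
  qed
qed

section \<open>Minimal coset representatives and the quantum Bruhat graph\<close>

lemma fword_simps [simp]: "fword n A [] c = c" "fword n A (i # ws) c = frefl n A i (fword n A ws c)"
  by (simp_all add: fword_def)
lemma fword_append: "fword n A (xs @ ys) c = fword n A xs (fword n A ys c)"
  by (induction xs) auto

text \<open>At some letter \<open>j\<close> the root passes from positive to negative, so just
  before it is the simple root of \<open>j\<close>. Then \<open>sref n A j\<close> is the conjugate
  of \<open>sref n A i\<close> by the word to its right, and the two cancel.\<close>

lemma word_deletion:
  assumes "set ws \<subseteq> I0" "i \<in> I0" "fword n A ws (unitv i) \<notin> \<Delta>p"
  shows "\<exists>ws'. length ws = Suc (length ws') \<and> set ws' \<subseteq> set ws \<and> wword n A ws \<circ> sref n A i = wword n A ws'"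
  using assms
proof (induction ws)
  case Nil then show ?case using unitv_pos by auto
next
  case (Cons j ws)
  let ?c = "fword n A ws (unitv i)"
  have ws: "set ws \<subseteq> I0" and j: "j \<in> I0" using Cons by auto
  show ?case
  proof (cases "?c \<in> \<Delta>p")
    case False
    then obtain ws' where w: "length ws = Suc (length ws')" "set ws' \<subseteq> set ws" "wword n A ws \<circ> sref n A i = wword n A ws'"
      using Cons.IH ws Cons.prems(2) by blast
    show ?thesis
    proof (intro exI conjI)
      show "length (j # ws) = Suc (length (j # ws'))" "set (j # ws') \<subseteq> set (j # ws)" using w(1,2) by auto
      show "wword n A (j # ws) \<circ> sref n A i = wword n A (j # ws')"
        by (simp only: wword_Cons o_assoc[symmetric] w(3))
    qed
  next
    case True
    then have c: "?c = unitv j" using frefl_pos[OF True j] Cons.prems(3) frefl_eq[OF j] by auto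
    have "ar (unitv j) 0 = wword n A ws (sroot n A i)"
      using wword_ar0[OF ws, of "unitv i" 0] c Cons.prems(2) by (simp add: sroot_eq I0_II)
    then have "rr (unitv j) 0 = wword n A (ws @ i # rev ws)"
      using rr_word[OF I0_sub_II[OF ws] I0_II[OF Cons.prems(2)]] unitv_root[OF j] by blast
    moreover have "rr (unitv j) 0 = sref n A j" using rr_simple[OF I0_II[OF j]] j by auto
    ultimately have e: "sref n A j = wword n A (ws @ i # rev ws)" by simp
    have "(wword n A (j # ws) \<circ> sref n A i) mu = wword n A ws mu" for mu
      by (simp add: e wword_append wword_rev[OF I0_sub_II[OF ws]] sref_invol[OF I0_II[OF Cons.prems(2)]])
    then show ?thesis by (intro exI[of _ ws]) auto
  qed
qed

lemma fst_wword_pr: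
  assumes "set ws \<subseteq> I0" "lz (fst mu)" "c \<in> \<Delta>"
  shows "pr (fst (wword n A ws mu)) (fword n A ws c) = pr (fst mu) c"
  using assms
proof (induction ws)
  case (Cons j ws)
  then have j: "j \<in> I0" "j \<in> II" and ws: "set ws \<subseteq> I0" using I0_II by auto
  have "lz (fst (wword n A ws mu))" using lz_wword[OF I0_sub_II[OF ws]] Cons.prems by blast
  then show ?case using Cons j ws fword_root[OF ws Cons.prems(3)] bb_root[OF j(2)]
    by (simp add: fst_sref frefl_eq pr_rw_rf)
qed simp

lemma wword_rr:
  assumes "set ws \<subseteq> I0" "g \<in> \<Delta>" "lz (fst mu)"
  shows "wword n A ws (rr g 0 mu) = rr (fword n A ws g) 0 (wword n A ws mu)"
  unfolding rr_def wword_linear[OF I0_sub_II[OF assms(1)]]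
  by (simp add: wword_ar0 fst_wword_pr assms)

lemma root_refl_word: assumes "g \<in> \<Delta>" shows "\<exists>ws. set ws \<subseteq> I0 \<and> rr g 0 = wword n A ws"
proof -
  obtain ws i where w: "g = fword n A ws (unitv i)" "set ws \<subseteq> I0" "i \<in> I0"
    using assms by (auto simp: froots_def)
  have "ar g 0 = wword n A ws (sroot n A i)" using w by (simp add: sroot_eq I0_II wword_ar0)
  then have "rr g 0 = wword n A (ws @ i # rev ws)"
    using rr_word[OF I0_sub_II[OF w(2)] I0_II[OF w(3)]] assms by blast
  then show ?thesis using w by (intro exI[of _ "ws @ i # rev ws"]) auto
qed

lemma snd_wword: "set ws \<subseteq> I0 \<Longrightarrow> snd (wword n A ws mu) = snd mu"
  by (induction ws) (auto simp: sref_eq I0_II)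

lemma dom_pr: "(\<And>i. i \<in> I0 \<Longrightarrow> v i \<ge> 0) \<Longrightarrow> g \<in> \<Delta>p \<Longrightarrow> pr v g \<ge> 0"
  unfolding pr_def ip_def using root_bil_pos[OF \<Delta>p_root, of g] dd(1)
  by (intro divide_nonneg_pos mult_nonneg_nonneg sum_nonneg) (auto simp: \<Delta>p_def less_imp_le)

lemma N_nonneg: "N v \<ge> 0" unfolding N_def by (intro sum_nonneg) (auto simp: ng_def)

lemma N_dom: "(\<And>i. i \<in> I0 \<Longrightarrow> v i \<ge> 0) \<Longrightarrow> N v = 0"
  unfolding N_def using dom_pr[of v] by (intro sum.neutral) (fastforce simp: ng_def)

text \<open>Serves to turn an inclusion between two such sets of roots, for weights in one orbit,
  into an equality.\<close>

lemma card_pr_wword: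
  assumes "set ws \<subseteq> I0" "lz (fst mu)"
  shows "card {g \<in> \<Delta>. pr (fst (wword n A ws mu)) g > 0} = card {g \<in> \<Delta>. pr (fst mu) g > 0}"
  using assms
proof (induction ws)
  case (Cons j ws)
  let ?v = "fst (wword n A ws mu)"
  have j: "j \<in> II" and ws: "set ws \<subseteq> I0" using Cons I0_II by auto
  note j = j bb_root[OF j]
  have "lz ?v" using lz_wword[OF I0_sub_II[OF ws]] Cons.prems by blast
  then have "fst (wword n A (j # ws) mu) = rw (bb j) ?v" using fst_sref j by simp
  moreover have bij: "bij_betw (rf (bb j)) {g \<in> \<Delta>. pr (rw (bb j) ?v) g > 0} {g \<in> \<Delta>. pr ?v g > 0}"
    by (rule bij_betw_byWitness[where f' = "rf (bb j)"]) (use j in \<open>auto simp: pr_rw rf_root rf_invol\<close>)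
  ultimately show ?case using Cons ws bij_betw_same_card[OF bij] by simp
qed simp

end

section \<open>The finite orbit of the weight and its stabilizer\<close>

locale level_zero_weight = affine_cartan n A for n A +
  fixes m :: "nat \<Rightarrow> nat" and lam :: wt
  assumes lam: "lam = wsum (\<lambda>i. wscale (real (m i)) (lzfw n A i)) (I0set n)"
begin

abbreviation L :: "nat \<Rightarrow> real" where "L \<equiv> fst lam"
abbreviation J :: "nat set" where "J \<equiv> Jset n lam"

lemma lzfw_eq: "lzfw n A i = (\<lambda>k. (if k = i then 1 else 0) - dualmark n A i * (if k = 0 then 1 else 0), 0)"
  by (auto simp: lzfw_def wdiff_def wadd_def wscale_def fundw_def)

lemma lam_I0: "i \<in> I0 \<Longrightarrow> L i = real (m i)"
proof -
  assume i: "i \<in> I0"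
  have "L i = (\<Sum>l\<in>I0. real (m l) * (if i = l then 1 else 0))"
    unfolding lam wsum_def using I0_le(2)[OF i]
    by (auto simp: lzfw_eq wscale_def intro!: sum.cong)
  also have "\<dots> = (\<Sum>l\<in>I0. if i = l then real (m l) else 0)" by (intro sum.cong) auto
  finally show ?thesis using i by simp
qed

lemma lam_lz: "lz L"
proof -
  have "L 0 = (\<Sum>i\<in>I0. - (real (m i) * of_int (fcoroot n A \<theta> i)))"
    unfolding lam wsum_def using I0_le(2)
    by (auto simp: lzfw_eq wscale_def dualmark_eq intro!: sum.cong)
  also have "\<dots> = - pr L \<theta>" unfolding pr_coroot[OF theta(1)]
    by (simp add: lam_I0 sum_negf mult.commute)
  finally show ?thesis by (simp add: lz_def)
qed

lemma lam_snd: "snd lam = 0"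
  unfolding lam wsum_def by (simp add: lzfw_eq wscale_def)

lemma lam_dom: "i \<in> I0 \<Longrightarrow> L i \<ge> 0" by (simp add: lam_I0)

lemma J_I0: "J \<subseteq> I0" by (auto simp: Jset_def)
lemma J_iff: "j \<in> J \<longleftrightarrow> j \<in> I0 \<and> L j = 0" by (auto simp: Jset_def cl_def)

text \<open>Induction on the word. If its last letter \<open>i\<close> follows \<open>us\<close> and
  \<open>us alpha_i\<close> is negative, the word can be shortened. Otherwise dominance of the image
  forces \<open>L i = 0\<close>, so \<open>i\<close> lies in \<open>J\<close> and fixes
  \<open>lam\<close>. This gives both the unique dominant weight and the stabilizer.\<close>

lemma dominant_in_orbit:
  assumes "set ws \<subseteq> I0" "\<And>i. i \<in> I0 \<Longrightarrow> fst (wword n A ws lam) i \<ge> 0"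
  shows "wword n A ws lam = lam \<and> wword n A ws \<in> WeylJ n A J"
  using assms
proof (induction "length ws" arbitrary: ws rule: less_induct)
  case less
  show ?case
  proof (cases ws rule: rev_cases)
    case Nil
    then show ?thesis by (auto simp: WeylJ_def intro!: exI[of _ "[]"])
  next
    case (snoc us i)
    then have us: "set us \<subseteq> I0" and i: "i \<in> I0" using less.prems by auto
    let ?g = "fword n A us (unitv i)"
    show ?thesis
    proof (cases "?g \<in> \<Delta>p")
      case False
      then obtain ws' where w: "length us = Suc (length ws')" "set ws' \<subseteq> set us" "wword n A us \<circ> sref n A i = wword n A ws'"
        using word_deletion[OF us i] by blast
      then have "wword n A ws = wword n A ws'" using snoc by (simp add: wword_append)
      then show ?thesis using less.hyps[of ws'] less.prems(2) w us snoc by auto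
    next
      case True
      have "pr (fst (wword n A ws lam)) ?g = - L i"
        using fst_wword_pr[OF us lz_sref[OF lam_lz I0_II[OF i]] unitv_root[OF i]] snoc i
        by (simp add: wword_append pr_unitv sref_coord I0_II)
      moreover have "pr (fst (wword n A ws lam)) ?g \<ge> 0" using dom_pr[OF less.prems(2) True] .
      ultimately have Li: "L i = 0" using lam_dom[OF i] by simp
      have f: "wword n A ws lam = wword n A us lam" using snoc sref_fix[OF I0_II[OF i] Li] by (simp add: wword_append)
      have "wword n A us lam = lam \<and> wword n A us \<in> WeylJ n A J"
        using less.hyps[of us] us less.prems(2) f snoc by auto
      moreover from this obtain vs where "set vs \<subseteq> J" "wword n A us = wword n A vs" by (auto simp: WeylJ_def)
      then have "wword n A ws = wword n A (vs @ [i])" "set (vs @ [i]) \<subseteq> J"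
        using snoc i Li by (auto simp: wword_append J_iff)
      then have "wword n A ws \<in> WeylJ n A J" unfolding WeylJ_def by blast
      ultimately show ?thesis using f by simp
    qed
  qed
qed

definition V :: "(nat \<Rightarrow> real) set" where "V = {fst (wword n A ws lam) | ws. set ws \<subseteq> I0}"

lemma V_lz: "v \<in> V \<Longrightarrow> lz v" using lz_wword[OF I0_sub_II lam_lz] unfolding V_def by blast

lemma L_V: "L \<in> V" unfolding V_def by (auto intro!: exI[of _ "[]"])

lemma V_rw: assumes "v \<in> V" "g \<in> \<Delta>" shows "rw g v \<in> V"
proof -
  obtain ws where ws: "v = fst (wword n A ws lam)" "set ws \<subseteq> I0" using assms by (auto simp: V_def)
  obtain us where us: "set us \<subseteq> I0" "rr g 0 = wword n A us" using root_refl_word[OF assms(2)] by blast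
  have "rw g v = fst (rr g 0 (wword n A ws lam))" using fst_rr V_lz[OF assms(1)] ws by simp
  also have "\<dots> = fst (wword n A (us @ ws) lam)" by (simp add: us wword_append)
  finally show ?thesis using us ws unfolding V_def by (auto intro!: exI[of _ "us @ ws"])
qed

lemma N_length: "set ws \<subseteq> I0 \<Longrightarrow> N (fst (wword n A ws lam)) \<le> int (length ws)"
proof (induction ws)
  case Nil then show ?case using N_dom lam_dom by simp
next
  case (Cons i ws)
  then have i: "i \<in> I0" and ws: "set ws \<subseteq> I0" by auto
  have "lz (fst (wword n A ws lam))" using lz_wword[OF I0_sub_II[OF ws] lam_lz] .
  then have "fst (wword n A (i # ws) lam) = rw (unitv i) (fst (wword n A ws lam))"
    using fst_sref I0_II[OF i] i by simp
  then show ?case using Cons N_refl[OF i] by (simp add: sg_def)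
qed

text \<open>Reflecting at a negative coordinate lowers \<open>N\<close> by exactly 1, and the
  descent ends at the only dominant weight of the orbit.\<close>

lemma V_word: "v \<in> V \<Longrightarrow> \<exists>ws. set ws \<subseteq> I0 \<and> fst (wword n A ws lam) = v \<and> int (length ws) = N v"
proof (induction "nat (N v)" arbitrary: v rule: less_induct)
  case less
  show ?case
  proof (cases "\<forall>i\<in>I0. v i \<ge> 0")
    case True
    obtain ws where ws: "set ws \<subseteq> I0" "v = fst (wword n A ws lam)" using less.prems by (auto simp: V_def)
    then have "v = L" using True dominant_in_orbit[OF ws(1)] by simp
    then show ?thesis using N_dom[of v] True by (intro exI[of _ "[]"]) auto
  next
    case False
    then obtain i where i: "i \<in> I0" "v i < 0" by force
    have N: "N (rw (unitv i) v) = N v - 1" using N_refl[OF i(1), of v] i by (simp add: pr_unitv sg_def)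
    then have "nat (N (rw (unitv i) v)) < nat (N v)" using N_nonneg[of "rw (unitv i) v"] by linarith
    then obtain ws where ws: "set ws \<subseteq> I0" "fst (wword n A ws lam) = rw (unitv i) v" "int (length ws) = N (rw (unitv i) v)"
      using less.hyps[OF _ V_rw[OF less.prems unitv_root[OF i(1)]]] by blast
    have "fst (wword n A (i # ws) lam) = v"
      using fst_sref[of "wword n A ws lam" i] ws i lz_wword[OF I0_sub_II[OF ws(1)] lam_lz] I0_II rw_invol[OF unitv_root[OF i(1)]] by simp
    then show ?thesis using ws i N by (intro exI[of _ "i # ws"]) auto
  qed
qed

text \<open>By \<open>minreps_unique\<close> and \<open>V_minrep\<close> this is a bijection from
  the vertices of the graph onto \<open>V\<close>.\<close>

definition q :: "(wt \<Rightarrow> wt) \<Rightarrow> nat \<Rightarrow> real" where "q x = fst (x lam)"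

lemma cl_act_q: "cl_act x (cl lam) = q x"
  using lam_snd by (simp add: cl_act_def cl_def q_def) (metis prod.collapse)

lemma q_V: "x \<in> Weyl0 n A \<Longrightarrow> q x \<in> V" by (auto simp: Weyl0_def V_def q_def)

lemma wlen_word: assumes "x \<in> Weyl0 n A"
  shows "\<exists>ws. length ws = wlen n A x \<and> set ws \<subseteq> I0 \<and> x = wword n A ws"
proof -
  have "\<exists>k ws. length ws = k \<and> set ws \<subseteq> I0 \<and> x = wword n A ws" using assms by (auto simp: Weyl0_def)
  from LeastI_ex[OF this] show ?thesis unfolding wlen_def .
qed

lemma wlen_le: "set ws \<subseteq> I0 \<Longrightarrow> wlen n A (wword n A ws) \<le> length ws"
  unfolding wlen_def by (rule Least_le) blast

lemma N_wlen: "x \<in> Weyl0 n A \<Longrightarrow> N (q x) \<le> int (wlen n A x)"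
  using wlen_word[of x] N_length unfolding q_def by metis

lemma WeylJ_fix: "u \<in> WeylJ n A J \<Longrightarrow> u lam = lam"
proof -
  have "set ws \<subseteq> J \<Longrightarrow> wword n A ws lam = lam" for ws
    by (induction ws) (auto simp: J_iff sref_fix I0_II)
  then show "u \<in> WeylJ n A J \<Longrightarrow> u lam = lam" by (auto simp: WeylJ_def)
qed

lemma WeylJ_Weyl0: "u \<in> WeylJ n A J \<Longrightarrow> u \<in> Weyl0 n A" using J_I0 by (auto simp: WeylJ_def Weyl0_def)

lemma Weyl0_comp: "x \<in> Weyl0 n A \<Longrightarrow> y \<in> Weyl0 n A \<Longrightarrow> x \<circ> y \<in> Weyl0 n A"
proof -
  assume "x \<in> Weyl0 n A" "y \<in> Weyl0 n A"
  then obtain xs ys where "set xs \<subseteq> I0" "x = wword n A xs" "set ys \<subseteq> I0" "y = wword n A ys"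
    by (auto simp: Weyl0_def)
  then have "set (xs @ ys) \<subseteq> I0" "x \<circ> y = wword n A (xs @ ys)" by (auto simp: wword_append)
  then show ?thesis unfolding Weyl0_def by blast
qed

lemma Weyl0_snd: "x \<in> Weyl0 n A \<Longrightarrow> snd (x lam) = 0" using snd_wword[of _ lam] lam_snd unfolding Weyl0_def by force

lemma q_eq: "x \<in> Weyl0 n A \<Longrightarrow> y \<in> Weyl0 n A \<Longrightarrow> q x = q y \<Longrightarrow> x lam = y lam"
  using Weyl0_snd by (simp add: q_def prod_eq_iff)

lemma stabilizer:
  assumes "x \<in> Weyl0 n A" "y \<in> Weyl0 n A" "q x = q y"
  shows "\<exists>u\<in>WeylJ n A J. y = x \<circ> u"
proof -
  obtain xs ys where w: "set xs \<subseteq> I0" "x = wword n A xs" "set ys \<subseteq> I0" "y = wword n A ys"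
    using assms by (auto simp: Weyl0_def)
  have "wword n A (rev xs @ ys) lam = lam"
    using q_eq[OF assms] w wword_rev[OF I0_sub_II[OF w(1)]] by (simp add: wword_append) metis
  then have "wword n A (rev xs @ ys) \<in> WeylJ n A J"
    using dominant_in_orbit[of "rev xs @ ys"] w lam_dom by auto
  moreover have "y = x \<circ> wword n A (rev xs @ ys)"
    using wword_rev2[OF I0_sub_II[OF w(1)]] by (intro ext) (simp add: wword_append w(2,4))
  ultimately show ?thesis by blast
qed

text \<open>\<open>N\<close> bounds the length from below on the whole coset, and
  \<open>V_word\<close> attains the bound by an element which \<open>stabilizer\<close> places in
  the same coset.\<close>

lemma minreps_iff: "x \<in> minreps n A J \<longleftrightarrow> x \<in> Weyl0 n A \<and> int (wlen n A x) = N (q x)"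
proof
  assume x: "x \<in> minreps n A J"
  then have xW: "x \<in> Weyl0 n A" by (simp add: minreps_def)
  obtain ws where ws: "set ws \<subseteq> I0" "fst (wword n A ws lam) = q x" "int (length ws) = N (q x)"
    using V_word[OF q_V[OF xW]] by blast
  have "wword n A ws \<in> Weyl0 n A" using ws by (auto simp: Weyl0_def)
  moreover have "q x = q (wword n A ws)" using ws(2) by (simp add: q_def)
  ultimately obtain u where u: "u \<in> WeylJ n A J" "wword n A ws = x \<circ> u" using stabilizer[OF xW] by metis
  then have "wlen n A x \<le> wlen n A (wword n A ws)" using x by (simp add: minreps_def)
  then have "int (wlen n A x) \<le> N (q x)" using wlen_le[OF ws(1)] ws(3) by linarith
  then show "x \<in> Weyl0 n A \<and> int (wlen n A x) = N (q x)" using N_wlen[OF xW] xW by simp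
next
  assume x: "x \<in> Weyl0 n A \<and> int (wlen n A x) = N (q x)"
  have "wlen n A x \<le> wlen n A (x \<circ> u)" if u: "u \<in> WeylJ n A J" for u
  proof -
    have "q (x \<circ> u) = q x" using WeylJ_fix[OF u] by (simp add: q_def)
    then show ?thesis using N_wlen[OF Weyl0_comp[of x u]] x WeylJ_Weyl0[OF u] by simp
  qed
  then show "x \<in> minreps n A J" using x by (simp add: minreps_def)
qed

text \<open>Exchange argument: minimality makes the common weight negative at the first letter
  \<open>i\<close>, so deletion in the inverse of the other word removes a letter there and moves
  \<open>i\<close> to its front.\<close>

lemma minimal_words_unique:
  assumes "set xs \<subseteq> I0" "set ys \<subseteq> I0" "wword n A xs lam = wword n A ys lam"
    "int (length xs) = N (fst (wword n A xs lam))" "length ys = length xs"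
  shows "wword n A xs = wword n A ys"
  using assms
proof (induction xs arbitrary: ys)
  case Nil then show ?case by simp
next
  case (Cons i xs)
  let ?mu = "wword n A xs lam" and ?nu = "wword n A ys lam"
  have i: "i \<in> I0" "i \<in> II" and xs: "set xs \<subseteq> I0" and ys: "set ys \<subseteq> I0" using Cons I0_II by auto
  have nu: "?nu = sref n A i ?mu" using Cons.prems(3) by simp
  have lzm: "lz (fst ?mu)" using lz_wword[OF I0_sub_II[OF xs] lam_lz] .
  have lzn: "lz (fst ?nu)" using lz_wword[OF I0_sub_II[OF ys] lam_lz] .
  have fn: "fst ?nu = rw (unitv i) (fst ?mu)" using fst_sref[OF lzm i(2)] i nu by simp
  have "N (fst ?mu) \<le> int (length xs)" using N_length[OF xs] .
  moreover have NN: "N (fst ?nu) = N (fst ?mu) + sg (fst ?mu i)" using N_refl[OF i(1)] fn by (simp add: pr_unitv i)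
  moreover have "N (fst ?nu) = int (length xs) + 1" using Cons.prems(3,4) by simp
  ultimately have sp: "fst ?mu i > 0" and Nm: "int (length xs) = N (fst ?mu)" by (auto simp: sg_def split: if_splits)
  have neg: "fst ?nu i < 0" using sp nu sref_coord[OF i(2)] by simp
  have "pr L (fword n A (rev ys) (unitv i)) = fst ?nu i"
    using fst_wword_pr[of "rev ys" ?nu "unitv i"] ys lzn unitv_root[OF i(1)] wword_rev[OF I0_sub_II[OF ys]] pr_unitv[OF i(1)] by simp
  then have "fword n A (rev ys) (unitv i) \<notin> \<Delta>p" using neg dom_pr[OF lam_dom] by fastforce
  then obtain us where us: "length (rev ys) = Suc (length us)" "set us \<subseteq> set (rev ys)" "wword n A (rev ys) \<circ> sref n A i = wword n A us"
    using word_deletion[of "rev ys" i] ys i by auto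
  have usI: "set us \<subseteq> I0" using us ys by auto
  \<comment> \<open>So \<open>rev us\<close> represents \<open>sref n A i\<close> composed with
    \<open>ys\<close>, with one letter less than \<open>ys\<close>.\<close>
  have z: "wword n A (rev us) kap = sref n A i (wword n A ys kap)" for kap
  proof -
    have "wword n A us (sref n A i (wword n A ys kap)) = kap"
      unfolding us(3)[symmetric] using sref_invol[OF i(2)] wword_rev[OF I0_sub_II[OF ys]] by simp
    then show ?thesis using wword_rev[OF I0_sub_II[OF usI]] by metis
  qed
  have "wword n A xs = wword n A (rev us)"
    by (rule Cons.IH[OF xs]) (use usI z nu sref_invol[OF i(2)] Nm us(1) Cons.prems(5) in auto)
  then have "wword n A (i # xs) kap = wword n A ys kap" for kap using z sref_invol[OF i(2)] by simp
  then show ?case by auto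
qed

lemma minreps_unique:
  assumes "x \<in> minreps n A J" "y \<in> minreps n A J" "q x = q y" shows "x = y"
proof -
  have W: "x \<in> Weyl0 n A" "y \<in> Weyl0 n A" "int (wlen n A x) = N (q x)" "int (wlen n A y) = N (q y)"
    using assms by (auto simp: minreps_iff)
  obtain xs where xs: "length xs = wlen n A x" "set xs \<subseteq> I0" "x = wword n A xs" using wlen_word[OF W(1)] by blast
  obtain ys where ys: "length ys = wlen n A y" "set ys \<subseteq> I0" "y = wword n A ys" using wlen_word[OF W(2)] by blast
  show ?thesis using minimal_words_unique[OF xs(2) ys(2)] q_eq[OF W(1,2) assms(3)] xs ys W assms(3)
    by (auto simp: q_def)
qed

lemma V_minrep: "v \<in> V \<Longrightarrow> \<exists>x\<in>minreps n A J. q x = v"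
proof -
  assume "v \<in> V"
  then obtain ws where ws: "set ws \<subseteq> I0" "fst (wword n A ws lam) = v" "int (length ws) = N v" using V_word by blast
  have "wword n A ws \<in> Weyl0 n A" using ws by (auto simp: Weyl0_def)
  then have "wword n A ws \<in> minreps n A J" using N_wlen wlen_le[OF ws(1)] ws by (fastforce simp: minreps_iff q_def)
  then show ?thesis using ws by (auto simp: q_def)
qed

lemma floorJ_eq:
  assumes w: "w \<in> Weyl0 n A" and u: "u \<in> minreps n A J" and e: "q u = q w"
  shows "floorJ n A J w = u"
  unfolding floorJ_def
proof (rule the_equality)
  have "u \<in> Weyl0 n A" using u by (simp add: minreps_iff)
  then show "u \<in> minreps n A J \<and> (\<exists>v\<in>WeylJ n A J. u = w \<circ> v)" using stabilizer[OF w _ e[symmetric]] u by blast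
next
  fix z assume z: "z \<in> minreps n A J \<and> (\<exists>v\<in>WeylJ n A J. z = w \<circ> v)"
  then obtain v where "v \<in> WeylJ n A J" "z = w \<circ> v" by blast
  then have "q z = q w" using WeylJ_fix[of v] by (simp add: q_def)
  then show "z = u" using minreps_unique z u e by metis
qed

lemma floorJ: assumes "w \<in> Weyl0 n A" shows "floorJ n A J w \<in> minreps n A J" "q (floorJ n A J w) = q w"
  using V_minrep[OF q_V[OF assms]] floorJ_eq[OF assms] by auto

text \<open>Removes \<open>J\<close> from the edge condition: the admissible labels are the roots
  that pair positively with \<open>L\<close>.\<close>

lemma pr_L_pos_iff: assumes "b \<in> \<Delta>" shows "pr L b > 0 \<longleftrightarrow> b \<in> \<Delta>p \<and> (\<exists>k. k \<notin> J \<and> b k \<noteq> 0)"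
proof
  assume p: "pr L b > 0"
  have "b \<in> \<Delta>p"
  proof (rule ccontr)
    assume "b \<notin> \<Delta>p"
    then have "(\<lambda>k. - b k) \<in> \<Delta>p" using \<Delta>p_cases[OF assms] by blast
    then have "pr L (\<lambda>k. - b k) \<ge> 0" using dom_pr[of L] lam_dom by blast
    then show False using p by (simp add: pr_neg)
  qed
  moreover have "\<exists>k. k \<notin> J \<and> b k \<noteq> 0"
  proof (rule ccontr)
    assume "\<not> ?thesis"
    then have "ip L b = 0" unfolding ip_def by (intro sum.neutral) (auto simp: J_iff)
    then show False using p by (simp add: pr_def)
  qed
  ultimately show "b \<in> \<Delta>p \<and> (\<exists>k. k \<notin> J \<and> b k \<noteq> 0)" by blast
next
  assume b: "b \<in> \<Delta>p \<and> (\<exists>k. k \<notin> J \<and> b k \<noteq> 0)"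
  then obtain k where k: "k \<notin> J" "b k \<noteq> 0" by blast
  then have kI: "k \<in> I0" using root_supp[OF assms] by blast
  have "L k > 0" using k kI lam_dom[OF kI] by (simp add: J_iff)
  moreover have "b k > 0" using k b by (auto simp: \<Delta>p_def order_less_le)
  ultimately have "ip L b > 0" unfolding ip_def
    using kI b dd(1) lam_dom by (intro sum_pos2[of _ k]) (auto simp: \<Delta>p_def less_imp_le)
  then show "pr L b > 0" using root_bil_pos[OF assms] by (simp add: pr_def)
qed

lemma posroot_outside_J: "b \<in> posroots0 n A - posrootsJ n A J \<longleftrightarrow> (\<exists>g\<in>\<Delta>. b = ar g 0 \<and> pr L g > 0)"
proof
  assume b: "b \<in> posroots0 n A - posrootsJ n A J"
  then obtain g where "g \<in> \<Delta>p" "b = ar g 0" by (auto simp: posroots0_eq)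
  then show "\<exists>g\<in>\<Delta>. b = ar g 0 \<and> pr L g > 0" using b pr_L_pos_iff \<Delta>p_root
    by (auto simp: posrootsJ_eq[OF J_I0])
next
  assume "\<exists>g\<in>\<Delta>. b = ar g 0 \<and> pr L g > 0"
  then obtain g where g: "g \<in> \<Delta>" "b = ar g 0" "g \<in> \<Delta>p" "\<exists>k. k \<notin> J \<and> g k \<noteq> 0" using pr_L_pos_iff by blast
  then show "b \<in> posroots0 n A - posrootsJ n A J"
    using ar_inj[OF g(1) \<Delta>p_root] by (auto simp: posrootsJ_eq[OF J_I0] posroots0_eq)
qed

lemma pr_sum: "finite F \<Longrightarrow> pr (\<lambda>k. c * (\<Sum>a\<in>F. h a k)) g = c * (\<Sum>a\<in>F. pr (h a) g)"
  unfolding pr_def ip_def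
  by (simp add: sum_distrib_left sum_divide_distrib mult_ac, subst sum.swap, simp)

lemma rho_pairing:
  assumes "g \<in> \<Delta>"
  shows "2 * copair n A (wdiff (rho0 n A) (rhoJ n A J)) (ar g 0) = of_int (Sp L g)"
proof -
  let ?E = "\<lambda>g. ar g 0"
  define QJ where "QJ = {g \<in> \<Delta>p. \<forall>k. k \<notin> J \<longrightarrow> g k = 0}"
  have inj: "inj_on ?E \<Delta>p" using ar_inj \<Delta>p_root by (auto intro!: inj_onI)
  have p0: "posroots0 n A = ?E ` \<Delta>p" by (auto simp: posroots0_eq)
  have pJ: "posrootsJ n A J = ?E ` QJ" by (auto simp: posrootsJ_eq[OF J_I0] QJ_def)
  have QJ: "QJ \<subseteq> \<Delta>p" "finite QJ" using finite_\<Delta>p by (auto simp: QJ_def)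
  have s0: "fst (wsum id (posroots0 n A)) k = (\<Sum>a\<in>\<Delta>p. rt a k)" for k
    unfolding p0 wsum_def using inj by (simp add: sum.reindex ar_def)
  have sJ: "fst (wsum id (posrootsJ n A J)) k = (\<Sum>a\<in>QJ. rt a k)" for k
    unfolding pJ wsum_def using inj_on_subset[OF inj QJ(1)] by (simp add: sum.reindex ar_def)
  \<comment> \<open>So \<open>2 rho - 2 rho_J\<close> is the sum of all roots pairing positively
    with \<open>L\<close>.\<close>
  have d: "\<Delta>p - QJ = {a\<in>\<Delta>. pr L a > 0}" using pr_L_pos_iff \<Delta>p_root by (auto simp: QJ_def)
  have "fst (wdiff (rho0 n A) (rhoJ n A J)) k = 1/2 * (\<Sum>a\<in>\<Delta>p - QJ. rt a k)" for k
  proof -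
    have "fst (wdiff (rho0 n A) (rhoJ n A J)) k = fst (rho0 n A) k - fst (rhoJ n A J) k"
      by (simp add: wdiff_def wadd_def wscale_def)
    then show ?thesis using s0 sJ QJ finite_\<Delta>p by (simp add: rho0_def rhoJ_def wscale_def sum_diff)
  qed
  then have f: "fst (wdiff (rho0 n A) (rhoJ n A J)) = (\<lambda>k. 1/2 * (\<Sum>a\<in>\<Delta>p - QJ. rt a k))" by auto
  have "copair n A (wdiff (rho0 n A) (rhoJ n A J)) (ar g 0) = pr (\<lambda>k. 1/2 * (\<Sum>a\<in>\<Delta>p - QJ. rt a k)) g"
    unfolding copair_eq[OF ar0_real[OF assms] assms] f by simp
  also have "\<dots> = 1/2 * (\<Sum>a\<in>\<Delta>p - QJ. of_int (cf a g))"
    using finite_\<Delta>p by (subst pr_sum) (simp_all add: cf assms)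
  finally show ?thesis by (simp add: Sp_def d)
qed

text \<open>The edge \<open>v \<rightarrow> u\<close> of the parabolic quantum Bruhat graph, transported to the orbit \<open>W\<^sub>0\<Lambda>\<close>; the
  affine root \<open>g + k\<delta>\<close> realises the corresponding cover relation above it.\<close>

definition ed :: "real \<Rightarrow> (nat \<Rightarrow> real) \<Rightarrow> (nat \<Rightarrow> real) \<Rightarrow> bool" where
  "ed s v u \<longleftrightarrow> lz u \<and> (\<exists>g k. apos g k \<and> pr u g < 0 \<and> D u g k = 1 \<and> v = rw g u \<and> s * pr u g \<in> \<int>)"

lemma D_shift: "D u g k = D u g l + (k - l) * Sp (rw g u) g" by (simp add: D_def algebra_simps)

text \<open>As \<open>Sp (rw g u) g\<close> is at least 2, \<open>D u g k\<close> grows strictly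
  with \<open>k\<close>, and only the least \<open>k\<close> with \<open>apos g k\<close> can give
  1. It is 0 for positive \<open>g\<close>, a Bruhat edge, and 1 for negative \<open>g\<close>, a
  quantum edge.\<close>

lemma excess_one_iff:
  assumes u: "lz u" and g: "g \<in> \<Delta>" and p: "pr u g < 0"
  shows "(\<exists>k. apos g k \<and> D u g k = 1) \<longleftrightarrow>
     N u = N (rw g u) + 1 \<or> N u = N (rw g u) - Sp (rw g u) g + 1"
proof -
  have S: "Sp (rw g u) g \<ge> 2" using Sp_ge[OF g, of "rw g u"] pr_rw_self[OF g] p by simp
  show ?thesis
  proof (cases "g \<in> \<Delta>p")
    case True
    have a: "apos g k \<longleftrightarrow> k \<ge> 0" for k using True g by (auto simp: apos_def)
    have D0: "D u g 0 \<ge> 1" using D_ge1[of g 0 u] a u p by simp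
    have c: "D u g k = 1 \<longleftrightarrow> k = 0 \<and> D u g 0 = 1" if "k \<ge> 0" for k
    proof -
      have "D u g k = D u g 0 + k * Sp (rw g u) g" using D_shift[of u g k 0] by simp
      moreover have "k = 0 \<or> k * Sp (rw g u) g > 0" using S \<open>k \<ge> 0\<close> by (auto simp: zero_less_mult_iff)
      ultimately show ?thesis using D0 by auto
    qed
    have "(\<exists>k. apos g k \<and> D u g k = 1) \<longleftrightarrow> D u g 0 = 1" using a c by (metis order_refl)
    then show ?thesis using D0 S by (auto simp: D_def)
  next
    case False
    then have ng: "(\<lambda>k. - g k) \<in> \<Delta>p" using \<Delta>p_cases[OF g] by blast
    have a: "apos g k \<longleftrightarrow> k \<ge> 1" for k using False g by (auto simp: apos_def)
    have D0: "D u g 1 \<ge> 1" using D_ge1[of g 1 u] a u p by simp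
    have c: "D u g k = 1 \<longleftrightarrow> k = 1 \<and> D u g 1 = 1" if "k \<ge> 1" for k
    proof -
      have "D u g k = D u g 1 + (k - 1) * Sp (rw g u) g" using D_shift[of u g k 1] by simp
      moreover have "k = 1 \<or> (k - 1) * Sp (rw g u) g > 0" using S \<open>k \<ge> 1\<close> by (auto simp: zero_less_mult_iff)
      ultimately show ?thesis using D0 by auto
    qed
    have "(\<exists>k. apos g k \<and> D u g k = 1) \<longleftrightarrow> D u g 1 = 1" using a c by (metis order_refl)
    \<comment> \<open>Read from the other end, the reflection belongs to the positive root
      \<open>- g\<close>; the bound there excludes the Bruhat equation.\<close>
    moreover have "apos (\<lambda>k. - g k) 0" using ng \<Delta>p_root by (simp add: apos_def)
    from D_ge1[OF this lz_rw[OF u], of g] have "N (rw g u) - N u \<ge> 1"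
      using p by (simp add: D_def rw_neg rw_invol[OF g] pr_neg pr_rw_self[OF g])
    ultimately show ?thesis by (auto simp: D_def)
  qed
qed

text \<open>A label \<open>b\<close> at \<open>w\<close> becomes \<open>g = w b\<close> at the
  weights, with \<open>pr L b = - pr (q u) g\<close>. The label is always positive, whereas the sign
  of \<open>g\<close> distinguishes Bruhat from quantum edges.\<close>

lemma qbg_edge_iff:
  assumes w: "w \<in> minreps n A J" and u: "u \<in> minreps n A J"
  shows "(\<exists>b. qbg_edge n A J w b u \<and> s * copair n A lam b \<in> \<int>) \<longleftrightarrow> ed s (q w) (q u)"
proof -
  have W: "w \<in> Weyl0 n A" "u \<in> Weyl0 n A" "int (wlen n A w) = N (q w)" "int (wlen n A u) = N (q u)"
    using w u by (auto simp: minreps_iff)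
  obtain ws where ws: "set ws \<subseteq> I0" "w = wword n A ws" using W(1) by (auto simp: Weyl0_def)
  have lzw: "lz (q w)" "lz (q u)" using V_lz q_V W by auto
  have cpl: "copair n A lam (ar b 0) = pr L b" if "b \<in> \<Delta>" for b
    using copair_eq[OF ar0_real[OF that] that, of lam] by simp
  have qrr: "q (w \<circ> rrefl n A (ar b 0)) = rw (fword n A ws b) (q w)" "w \<circ> rrefl n A (ar b 0) \<in> Weyl0 n A"
    if b: "b \<in> \<Delta>" for b
  proof -
    have r: "rrefl n A (ar b 0) = rr b 0" using rrefl_eq[OF ar0_real[OF b] b] .
    show "q (w \<circ> rrefl n A (ar b 0)) = rw (fword n A ws b) (q w)"
      unfolding r q_def ws(2) o_apply wword_rr[OF ws(1) b lam_lz]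
      by (rule fst_rr) (rule lz_wword[OF I0_sub_II[OF ws(1)] lam_lz])
    show "w \<circ> rrefl n A (ar b 0) \<in> Weyl0 n A"
      unfolding r using root_refl_word[OF b] Weyl0_comp[OF W(1)] by (auto simp: Weyl0_def)
  qed
  have prb: "pr (q w) (fword n A ws b) = pr L b" if "b \<in> \<Delta>" for b
    using fst_wword_pr[OF ws(1) lam_lz that] ws(2) by (simp add: q_def)
  have Spb: "Sp (q w) (fword n A ws b) = Sp L b" if "b \<in> \<Delta>" for b
  proof -
    have "Sp (fst (wword n A us lam)) (fword n A us b) = Sp L b" if "set us \<subseteq> I0" for us
      using that
    proof (induction us)
      case (Cons j us)
      then have j: "j \<in> I0" "j \<in> II" and us: "set us \<subseteq> I0" using I0_II by auto
      have "lz (fst (wword n A us lam))" using lz_wword[OF I0_sub_II[OF us] lam_lz] .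
      then show ?case using Cons j us fword_root[OF us \<open>b \<in> \<Delta>\<close>] bb_root[OF j(2)] unitv_root[OF j(1)]
        by (simp add: fst_sref frefl_eq Sp_equiv)
    qed simp
    then show ?thesis using ws by (simp add: q_def)
  qed
  have lens: "(wlen n A u = wlen n A w + 1 \<or>
      real (wlen n A u) = real (wlen n A w) - 2 * copair n A (wdiff (rho0 n A) (rhoJ n A J)) (ar b 0) + 1)
    \<longleftrightarrow> N (q u) = N (q w) + 1 \<or> N (q u) = N (q w) - Sp (q w) (fword n A ws b) + 1" if b: "b \<in> \<Delta>" for b
    unfolding rho_pairing[OF b] Spb[OF b] using W(3,4) by linarith
  show ?thesis
  proof
    assume "\<exists>b. qbg_edge n A J w b u \<and> s * copair n A lam b \<in> \<int>"
    then obtain b' where e: "qbg_edge n A J w b' u" "s * copair n A lam b' \<in> \<int>" by blast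
    then obtain b where b: "b \<in> \<Delta>" "b' = ar b 0" "pr L b > 0"
      using posroot_outside_J[of b'] unfolding qbg_edge_def by blast
    let ?g = "fword n A ws b"
    have g: "?g \<in> \<Delta>" using fword_root ws b by blast
    have qu: "q u = rw ?g (q w)" using e(1) floorJ(2) qrr[OF b(1)] b(2) by (simp add: qbg_edge_def)
    then have qw: "q w = rw ?g (q u)" using rw_invol[OF g] by simp
    have p: "pr (q u) ?g = - pr L b" unfolding qu pr_rw_self[OF g] prb[OF b(1)] ..
    have "N (q u) = N (q w) + 1 \<or> N (q u) = N (q w) - Sp (q w) ?g + 1"
      using e(1)[unfolded b(2) qbg_edge_def] lens[OF b(1)] by blast
    then have "\<exists>k. apos ?g k \<and> D (q u) ?g k = 1"
      using excess_one_iff[OF lzw(2) g] p b(3) qw[symmetric] by simp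
    then show "ed s (q w) (q u)" unfolding ed_def using lzw qw p b e(2) cpl[OF b(1)] by fastforce
  next
    assume "ed s (q w) (q u)"
    then obtain g k where g: "apos g k" "pr (q u) g < 0" "D (q u) g k = 1" "q w = rw g (q u)" "s * pr (q u) g \<in> \<int>"
      by (auto simp: ed_def)
    have gR: "g \<in> \<Delta>" using apos_root g by blast
    define b where "b = fword n A (rev ws) g"
    have bR: "b \<in> \<Delta>" unfolding b_def using fword_root[of "rev ws"] ws gR by simp
    have gb: "fword n A ws b = g"
    proof -
      have "set us \<subseteq> I0 \<Longrightarrow> fword n A us (fword n A (rev us) c) = c" for us c
        by (induction us arbitrary: c) (auto simp: fword_append frefl_invol)
      then show ?thesis using ws b_def by simp
    qed
    have p: "pr L b = - pr (q u) g" using prb[OF bR] g(4) pr_rw_self[OF gR] by (simp add: gb)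
    have o: "ar b 0 \<in> posroots0 n A - posrootsJ n A J" using posroot_outside_J bR p g(2) by auto
    have qu: "q u = q (w \<circ> rrefl n A (ar b 0))" using qrr[OF bR] gb g(4) rw_invol[OF gR] by simp
    have f: "floorJ n A J (w \<circ> rrefl n A (ar b 0)) = u" using floorJ_eq[OF qrr(2)[OF bR] u qu] .
    have "N (q u) = N (q w) + 1 \<or> N (q u) = N (q w) - Sp (q w) g + 1"
      using excess_one_iff[OF lzw(2) gR g(2)] g by auto
    then have "qbg_edge n A J w (ar b 0) u" unfolding qbg_edge_def using w o f lens[OF bR] gb by simp
    moreover have "s * copair n A lam (ar b 0) \<in> \<int>" using g(5) by (simp add: cpl[OF bR] p)
    ultimately show "\<exists>b. qbg_edge n A J w b u \<and> s * copair n A lam b \<in> \<int>" by blast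
  qed
qed

section \<open>Shortest directed paths\<close>

lemma ed_lz: "ed s v u \<Longrightarrow> lz u" "ed s v u \<Longrightarrow> lz v"
  by (auto simp: ed_def lz_rw)

lemma ed_simple:
  assumes "lz v" "j \<in> II" "v j > 0" "s * v j \<in> \<int>" shows "ed s v (rw (bb j) v)"
proof -
  let ?u = "rw (bb j) v"
  have b: "bb j \<in> \<Delta>" using bb_root assms by blast
  have u: "lz ?u" "pr ?u (bb j) = - v j" using lz_rw[OF assms(1)] pr_rw_self[OF b] lz_pr[OF assms(1,2)] by auto
  then have "?u j < 0" using lz_pr[OF u(1) assms(2)] assms(3) by simp
  then have "D ?u (bb j) (ee j) = 1" using D_simple[OF u(1) assms(2)] by blast
  then show ?thesis unfolding ed_def using u apos_simple[OF assms(2)] rw_invol[OF b] assms by fastforce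
qed

text \<open>Unless the edge is along \<open>alpha_j\<close>, its affine root stays positive under
  reflection, so the reflected excess is at least 1. As the original excess is 1,
  \<open>D_refl\<close> bounds the signs, and equal signs give excess 1 again.\<close>

lemma ed_refl_cases [consumes 2, case_names simple other]:
  assumes "ed s v u" "j \<in> II"
  obtains "v j > 0" "u = rw (bb j) v" "u j < 0" "s * v j \<in> \<int>"
  | "sg (v j) \<le> sg (u j)" "sg (v j) = sg (u j) \<Longrightarrow> ed s (rw (bb j) v) (rw (bb j) u)"
proof -
  obtain g k where gk: "apos g k" "pr u g < 0" "D u g k = 1" "v = rw g u" "s * pr u g \<in> \<int>" and lzu: "lz u"
    using assms(1) by (auto simp: ed_def)
  have g: "g \<in> \<Delta>" and b: "bb j \<in> \<Delta>" using gk apos_root bb_root assms by auto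
  show ?thesis
  proof (cases "g = bb j \<and> k = ee j")
    case True
    then have "u j < 0" "s * u j \<in> \<int>" using gk lz_pr[OF lzu assms(2)] by auto
    moreover have "v j = - u j" using gk(4) True lz_pr[OF ed_lz(2)[OF assms(1)] assms(2)] lz_pr[OF lzu assms(2)] pr_rw_self[OF b] by simp
    moreover have "u = rw (bb j) v" using gk(4) True rw_invol[OF b] by simp
    ultimately show ?thesis using that(1) by simp
  next
    case False
    have p: "pr (rw (bb j) u) (rf (bb j) g) = pr u g" using pr_rw_rf[OF b g] .
    have ap: "apos (rf (bb j) g) (rk j g k)" using apos_refl[OF gk(1) assms(2) False] .
    have ge: "1 \<le> D (rw (bb j) u) (rf (bb j) g) (rk j g k)" using D_ge1[OF ap lz_rw[OF lzu]] p gk(2) by simp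
    have e: "D u g k - D (rw (bb j) u) (rf (bb j) g) (rk j g k) = sg (v j) - sg (u j)"
      using D_refl[OF lzu g assms(2)] gk(4) by simp
    show ?thesis
    proof (rule that(2))
      show "sg (v j) \<le> sg (u j)" using ge e gk(3) by linarith
      assume "sg (v j) = sg (u j)"
      then have "D (rw (bb j) u) (rf (bb j) g) (rk j g k) = 1" using e gk(3) by linarith
      then show "ed s (rw (bb j) v) (rw (bb j) u)"
        unfolding ed_def using ap p gk lz_rw[OF lzu] rw_conj[OF b g] by fastforce
    qed
  qed
qed

lemma sg_pos: "sg x \<le> sg y \<Longrightarrow> x > 0 \<Longrightarrow> y > 0 \<and> sg x = sg y" by (auto simp: sg_def split: if_splits)
lemma sg_neg: "sg x \<le> sg y \<Longrightarrow> y < 0 \<Longrightarrow> x < 0 \<and> sg x = sg y" by (auto simp: sg_def split: if_splits)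

text \<open>Makes \<open>s * u j\<close> constant modulo integers along a path, which supplies the
  integrality condition for steps inserted elsewhere.\<close>

lemma ed_int: assumes "ed s v u" "j \<in> II" shows "s * u j - s * v j \<in> \<int>"
proof -
  obtain g k where g: "apos g k" "v = rw g u" "s * pr u g \<in> \<int>" using assms(1) by (auto simp: ed_def)
  have "s * u j - s * v j = s * pr u g * of_int (cf g (bb j))"
    using g(2) rt_cf[OF assms(2), of g] by (simp add: rw_def algebra_simps)
  then show ?thesis using g(3) by simp
qed

lemma path_int: "(ed s ^^ k) v u \<Longrightarrow> j \<in> II \<Longrightarrow> s * u j - s * v j \<in> \<int>"
proof (induction k arbitrary: u)
  case (Suc k)
  then obtain z where z: "(ed s ^^ k) v z" "ed s z u" by auto
  have "(s * z j - s * v j) + (s * u j - s * z j) \<in> \<int>"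
    using Suc.IH[OF z(1) Suc.prems(2)] ed_int[OF z(2) Suc.prems(2)] by (rule Ints_add)
  then show ?case by simp
qed simp

lemma Ints_iff_diff: "a - b \<in> \<int> \<Longrightarrow> a \<in> \<int> \<longleftrightarrow> b \<in> \<int>" for a b :: real
  using Ints_diff[of a "a - b"] Ints_add[of "a - b" b] by auto

text \<open>A path from a weight on the positive side of \<open>\<alpha>\<^sub>j\<close> to one on the other side contains a step along
  \<open>\<alpha>\<^sub>j\<close>, since the sign of the \<open>j\<close>-th coordinate increases along all other edges; reflecting the part
  before the first such step (after the last one) moves it to the front (to the end).\<close>

lemma path_front:
  assumes j: "j \<in> II"
  shows "(ed s ^^ k) y x \<Longrightarrow> y j > 0 \<Longrightarrow> x j \<le> 0 \<Longrightarrow>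
    \<exists>l. k = Suc l \<and> (ed s ^^ l) (rw (bb j) y) x \<and> s * y j \<in> \<int>"
proof (induction k arbitrary: y)
  case 0 then show ?case by simp
next
  case (Suc k)
  obtain y1 where y1: "ed s y y1" "(ed s ^^ k) y1 x" using Suc.prems(1) by (rule relpowp_Suc_E2)
  from y1(1) j show ?case
  proof (cases rule: ed_refl_cases)
    case simple then show ?thesis using y1(2) by auto
  next
    case other
    have p: "y1 j > 0" "sg (y j) = sg (y1 j)" using sg_pos[OF other(1) Suc.prems(2)] by auto
    obtain l where l: "k = Suc l" "(ed s ^^ l) (rw (bb j) y1) x" "s * y1 j \<in> \<int>"
      using Suc.IH[OF y1(2) p(1) Suc.prems(3)] by blast
    have "(ed s ^^ Suc l) (rw (bb j) y) x" using other(2)[OF p(2)] l(2) by (rule relpowp_Suc_I2)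
    moreover have "s * y j \<in> \<int>" using Ints_iff_diff[OF ed_int[OF y1(1) j]] l(3) by simp
    ultimately show ?thesis using l(1) by blast
  qed
qed

lemma path_end:
  assumes j: "j \<in> II"
  shows "(ed s ^^ k) y x \<Longrightarrow> y j \<ge> 0 \<Longrightarrow> x j < 0 \<Longrightarrow>
    \<exists>l. k = Suc l \<and> (ed s ^^ l) y (rw (bb j) x) \<and> s * x j \<in> \<int>"
proof (induction k arbitrary: x)
  case 0 then show ?case by simp
next
  case (Suc k)
  obtain x1 where x1: "(ed s ^^ k) y x1" "ed s x1 x" using Suc.prems(1) by auto
  from x1(2) j show ?case
  proof (cases rule: ed_refl_cases)
    case simple
    then have "rw (bb j) x = x1" using rw_invol[OF bb_root[OF j]] by simp
    moreover have "s * x j \<in> \<int>"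
    proof -
      have "x j = - x1 j" using simple(2) lz_pr[OF ed_lz(2)[OF x1(2)] j] lz_pr[OF ed_lz(1)[OF x1(2)] j] pr_rw_self[OF bb_root[OF j]] by simp
      then show ?thesis using simple(4) by simp
    qed
    ultimately show ?thesis using x1(1) by blast
  next
    case other
    have p: "x1 j < 0" "sg (x1 j) = sg (x j)" using sg_neg[OF other(1) Suc.prems(3)] by auto
    obtain l where l: "k = Suc l" "(ed s ^^ l) y (rw (bb j) x1)" "s * x1 j \<in> \<int>"
      using Suc.IH[OF x1(1) Suc.prems(2) p(1)] by blast
    have "(ed s ^^ Suc l) y (rw (bb j) x)" using l(2) other(2)[OF p(2)] by auto
    moreover have "s * x j \<in> \<int>" using Ints_iff_diff[OF ed_int[OF x1(2) j]] l(3) by simp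
    ultimately show ?thesis using l(1) by blast
  qed
qed

lemma rw_coord_neg: "lz v \<Longrightarrow> j \<in> II \<Longrightarrow> rw (bb j) v j = - v j"
  using lz_pr[OF lz_rw] lz_pr pr_rw_self[OF bb_root] by metis

text \<open>If a step along \<open>alpha_j\<close> occurs, the edges before the first one are
  reflected, the step is dropped and a step along \<open>alpha_j\<close> is appended at the end.
  Hence the length is preserved.\<close>

lemma path_reflect_pos:
  assumes j: "j \<in> II" and lzx: "lz x"
  shows "(ed s ^^ k) y x \<Longrightarrow> y j > 0 \<Longrightarrow> x j > 0 \<Longrightarrow> (ed s ^^ k) (rw (bb j) y) (rw (bb j) x)"
proof (induction k arbitrary: y)
  case 0 then show ?case by simp
next
  case (Suc k)
  obtain y1 where y1: "ed s y y1" "(ed s ^^ k) y1 x" using Suc.prems(1) by (rule relpowp_Suc_E2)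
  from y1(1) j show ?case
  proof (cases rule: ed_refl_cases)
    case simple
    have "s * x j \<in> \<int>" using Ints_iff_diff[OF path_int[OF Suc.prems(1) j]] simple(4) by simp
    then have "ed s x (rw (bb j) x)" using ed_simple[OF lzx j Suc.prems(3)] by blast
    then show ?thesis using y1(2) simple(2) by auto
  next
    case other
    have p: "y1 j > 0" "sg (y j) = sg (y1 j)" using sg_pos[OF other(1) Suc.prems(2)] by auto
    show ?thesis using other(2)[OF p(2)] Suc.IH[OF y1(2) p(1) Suc.prems(3)] by (rule relpowp_Suc_I2)
  qed
qed

lemma path_reflect_neg:
  assumes j: "j \<in> II" and lzy: "lz y"
  shows "(ed s ^^ k) y x \<Longrightarrow> y j < 0 \<Longrightarrow> x j < 0 \<Longrightarrow> (ed s ^^ k) (rw (bb j) y) (rw (bb j) x)"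
proof (induction k arbitrary: x)
  case 0 then show ?case by simp
next
  case (Suc k)
  obtain x1 where x1: "(ed s ^^ k) y x1" "ed s x1 x" using Suc.prems(1) by auto
  from x1(2) j show ?case
  proof (cases rule: ed_refl_cases)
    case simple
    let ?y = "rw (bb j) y"
    have yj: "?y j = - y j" using rw_coord_neg[OF lzy j] .
    have "s * y j \<in> \<int>" using Ints_iff_diff[OF path_int[OF x1(1) j]] simple(4) by simp
    then have "ed s ?y (rw (bb j) ?y)"
      using yj Suc.prems(2) by (intro ed_simple[OF lz_rw[OF lzy] j]) auto
    then have "ed s ?y y" using rw_invol[OF bb_root[OF j]] by simp
    then have "(ed s ^^ Suc k) ?y x1" using x1(1) by (rule relpowp_Suc_I2)
    then show ?thesis using simple(2) rw_invol[OF bb_root[OF j]] by simp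
  next
    case other
    have p: "x1 j < 0" "sg (x1 j) = sg (x j)" using sg_neg[OF other(1) Suc.prems(3)] by auto
    show ?thesis using Suc.IH[OF x1(1) Suc.prems(2) p(1)] other(2)[OF p(2)] by auto
  qed
qed

text \<open>If no root separates \<open>y\<close> from \<open>x\<close>, the Weyl group element carrying \<open>y\<close> to \<open>\<Lambda>\<close> makes \<open>x\<close> dominant too.\<close>

lemma separating_root:
  assumes x: "x \<in> V" and y: "y \<in> V" and ne: "x \<noteq> y"
  shows "\<exists>g\<in>\<Delta>. pr y g > 0 \<and> pr x g \<le> 0"
proof (rule ccontr)
  assume "\<not> ?thesis"
  then have sub: "pr x g > 0" if "g \<in> \<Delta>" "pr y g > 0" for g using that by force
  obtain xs where xs: "set xs \<subseteq> I0" "x = fst (wword n A xs lam)" using x by (auto simp: V_def)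
  obtain ys where ys: "set ys \<subseteq> I0" "y = fst (wword n A ys lam)" using y by (auto simp: V_def)
  let ?ws = "rev ys @ xs"
  have ws: "set ?ws \<subseteq> I0" using xs ys by auto
  let ?v = "fst (wword n A ?ws lam)"
  have cancel: "fword n A (rev ys) (fword n A ys g) = g" for g
  proof -
    have "set us \<subseteq> I0 \<Longrightarrow> fword n A (rev us) (fword n A us c) = c" for us c
      by (induction us arbitrary: c) (auto simp: fword_append frefl_invol)
    then show ?thesis using ys by blast
  qed
  have lzx: "lz (fst (wword n A xs lam))" using lz_wword[OF I0_sub_II[OF xs(1)] lam_lz] .
  have P: "pr ?v g > 0" if g: "g \<in> \<Delta>" "pr L g > 0" for g
  proof -
    have "pr y (fword n A ys g) > 0" using fst_wword_pr[OF ys(1) lam_lz g(1)] ys(2) g(2) by simp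
    then have "pr x (fword n A ys g) > 0" using sub fword_root[OF ys(1) g(1)] by blast
    then show ?thesis
      using fst_wword_pr[of "rev ys" "wword n A xs lam" "fword n A ys g"] ys xs lzx fword_root[OF ys(1) g(1)] cancel
      by (simp add: wword_append)
  qed
  \<comment> \<open>Both weights lie in one orbit, so the two sets have equal cardinality and the
    inclusion \<open>P\<close> is an equality.\<close>
  have "{g \<in> \<Delta>. pr L g > 0} = {g \<in> \<Delta>. pr ?v g > 0}"
    by (rule card_subset_eq) (use finite_roots P card_pr_wword[OF ws lam_lz] in auto)
  then have eq: "pr ?v g > 0 \<Longrightarrow> pr L g > 0" if "g \<in> \<Delta>" for g using that by blast
  have "?v i \<ge> 0" if i: "i \<in> I0" for i
  proof (rule ccontr)
    assume "\<not> ?thesis"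
    then have "pr ?v (\<lambda>k. - unitv i k) > 0" using i by (simp add: pr_neg pr_unitv)
    then have "pr L (\<lambda>k. - unitv i k) > 0" using eq neg_root[OF unitv_root[OF i]] by blast
    then show False using lam_dom[OF i] i by (simp add: pr_neg pr_unitv)
  qed
  then have "wword n A ?ws lam = lam" using dominant_in_orbit[OF ws] by blast
  then have "wword n A ys (wword n A (rev ys) (wword n A xs lam)) = wword n A ys lam" by (simp add: wword_append)
  then show False using ne xs ys wword_rev2[OF I0_sub_II[OF ys(1)]] by simp
qed

text \<open>For \<open>s = 0\<close> the integrality condition is void, so \<open>ed 0\<close>
  describes all edges of the graph.\<close>

lemma path_plain: "(ed s ^^ k) y x \<Longrightarrow> (ed 0 ^^ k) y x"
proof -
  have "ed s v u \<Longrightarrow> ed 0 v u" for v u by (fastforce simp: ed_def)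
  then show "(ed s ^^ k) y x \<Longrightarrow> (ed 0 ^^ k) y x" by (rule relpowp_mono)
qed

text \<open>The inner induction lowers the height of an affine root separating \<open>y\<close> from \<open>x\<close>; when it is
  simple, the length of the plain path drops.\<close>

lemma shorten_sigma_path:
  "x \<in> V \<Longrightarrow> y \<in> V \<Longrightarrow> (ed s ^^ k) y x \<Longrightarrow> (ed 0 ^^ M) y x \<Longrightarrow> \<exists>k'\<le>M. (ed s ^^ k') y x"
proof (induction M arbitrary: x y k rule: less_induct)
  case (less M)
  \<comment> \<open>Both the sigma-path and the plain path contain a step along
    \<open>alpha_j\<close> that can be moved to the front. Removing it from both lowers
    \<open>M\<close>; it satisfies the integrality condition, so it can be put back.\<close>
  have front: "\<exists>k'\<le>M. (ed s ^^ k') y x"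
    if xy: "x \<in> V" "y \<in> V" "(ed s ^^ k) y x" "(ed 0 ^^ M) y x" and j: "j \<in> II" "y j > 0" "x j \<le> 0" for x y k j
  proof -
    obtain l where l: "(ed s ^^ l) (rw (bb j) y) x" "s * y j \<in> \<int>" using path_front[OF j(1) xy(3) j(2,3)] by blast
    obtain M' where M': "M = Suc M'" "(ed 0 ^^ M') (rw (bb j) y) x" using path_front[OF j(1) xy(4) j(2,3)] by blast
    obtain k' where k': "k' \<le> M'" "(ed s ^^ k') (rw (bb j) y) x"
      using less.IH[OF _ xy(1) V_rw[OF xy(2) bb_root[OF j(1)]] l(1) M'(2)] M'(1) by auto
    have "(ed s ^^ Suc k') y x" using ed_simple[OF V_lz[OF xy(2)] j(1,2) l(2)] k'(2) by (rule relpowp_Suc_I2)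
    then show ?thesis using k'(1) M'(1) by (intro exI[of _ "Suc k'"]) auto
  qed
  have last: "\<exists>k'\<le>M. (ed s ^^ k') y x"
    if xy: "x \<in> V" "y \<in> V" "(ed s ^^ k) y x" "(ed 0 ^^ M) y x" and j: "j \<in> II" "y j \<ge> 0" "x j < 0" for x y k j
  proof -
    obtain l where l: "(ed s ^^ l) y (rw (bb j) x)" "s * x j \<in> \<int>" using path_end[OF j(1) xy(3) j(2,3)] by blast
    obtain M' where M': "M = Suc M'" "(ed 0 ^^ M') y (rw (bb j) x)" using path_end[OF j(1) xy(4) j(2,3)] by blast
    have xV: "rw (bb j) x \<in> V" using V_rw[OF xy(1) bb_root[OF j(1)]] .
    obtain k' where k': "k' \<le> M'" "(ed s ^^ k') y (rw (bb j) x)"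
      using less.IH[OF _ xV xy(2) l(1) M'(2)] M'(1) by auto
    have "rw (bb j) x j = - x j" using rw_coord_neg[OF V_lz[OF xy(1)] j(1)] .
    then have "ed s (rw (bb j) x) (rw (bb j) (rw (bb j) x))" using j l(2) by (intro ed_simple[OF V_lz[OF xV]]) auto
    then have "(ed s ^^ Suc k') y x" using k'(2) rw_invol[OF bb_root[OF j(1)]] by auto
    then show ?thesis using k'(1) M'(1) by (intro exI[of _ "Suc k'"]) auto
  qed
  have "\<exists>k'\<le>M. (ed s ^^ k') y x"
    if "apos g l" "x \<in> V" "y \<in> V" "(ed s ^^ k) y x" "(ed 0 ^^ M) y x" "pr y g > 0" "pr x g \<le> 0" for g l x y k
    using that
  proof (induction arbitrary: x y k rule: apos_induct)
    case (simple j)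
    then show ?case using front[OF simple(2-5) simple(1)] lz_pr V_lz by simp
  next
    case (step g l j)
    note xy = step.prems(1-4) and j = step(2)
    have g: "g \<in> \<Delta>" and b: "bb j \<in> \<Delta>" using step(1) apos_root bb_root[OF j] by auto
    have lzx: "lz x" "lz y" using V_lz xy by auto
    have rV: "rw (bb j) x \<in> V" "rw (bb j) y \<in> V" using V_rw xy b by auto
    have lzr: "lz (rw (bb j) x)" "lz (rw (bb j) y)" using V_lz rV by auto
    have pr_refl: "pr (rw (bb j) y) (rf (bb j) g) > 0" "pr (rw (bb j) x) (rf (bb j) g) \<le> 0"
      using pr_rw_rf[OF b g] step.prems(5,6) by auto
    have co: "rw (bb j) x j = - x j" "rw (bb j) y j = - y j" using rw_coord_neg[OF _ j] lzx by auto
    consider "y j > 0" "x j \<le> 0" | "y j \<ge> 0" "x j < 0" | "y j > 0" "x j > 0" | "y j < 0" "x j < 0" | "y j \<le> 0" "x j \<ge> 0"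
      by linarith
    then show ?case
    proof cases
      case 1 then show ?thesis using front[OF xy j] by blast
    next
      case 2 then show ?thesis using last[OF xy j] by blast
    next
      case 3
      obtain k' where k': "k' \<le> M" "(ed s ^^ k') (rw (bb j) y) (rw (bb j) x)"
        using step.IH[OF rV path_reflect_pos[OF j lzx(1) xy(3) 3] path_reflect_pos[OF j lzx(1) xy(4) 3] pr_refl] by blast
      have "(ed s ^^ k') (rw (bb j) (rw (bb j) y)) (rw (bb j) (rw (bb j) x))"
        by (rule path_reflect_neg[OF j lzr(2) k'(2)]) (use co 3 in auto)
      then show ?thesis using k'(1) rw_invol[OF b] by auto
    next
      case 4
      obtain k' where k': "k' \<le> M" "(ed s ^^ k') (rw (bb j) y) (rw (bb j) x)"
        using step.IH[OF rV path_reflect_neg[OF j lzx(2) xy(3) 4] path_reflect_neg[OF j lzx(2) xy(4) 4] pr_refl] by blast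
      have "(ed s ^^ k') (rw (bb j) (rw (bb j) y)) (rw (bb j) (rw (bb j) x))"
        by (rule path_reflect_pos[OF j lzr(1) k'(2)]) (use co 4 in auto)
      then show ?thesis using k'(1) rw_invol[OF b] by auto
    next
      \<comment> \<open>Here the weights are kept and only the root is lowered: the signs of
        \<open>y j\<close> and \<open>x j\<close> ensure that \<open>rf (bb j) g\<close> still
        separates them.\<close>
      case 5
      have "bil (bb j) g > 0"
      proof -
        have "cf g (bb j) > 0" using step(4) rt_cf[OF j, of g] by simp
        then have "real_of_int (cf g (bb j)) * bil (bb j) (bb j) > 0" using root_bil_pos[OF b] by simp
        then show ?thesis using bil_cf[OF b, of g] bil_sym[of g "bb j"] by simp
      qed
      then have pb: "pr (rt (bb j)) g > 0" using root_bil_pos[OF g] by (simp add: pr_def bil_def)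
      have "pr y (rf (bb j) g) > 0" "pr x (rf (bb j) g) \<le> 0"
        unfolding pr_rf[OF b g] lz_pr[OF lzx(1) j] lz_pr[OF lzx(2) j]
        using 5 pb step.prems(5,6) mult_nonneg_nonpos[of "pr (rt (bb j)) g" "y j"] mult_nonneg_nonneg[of "pr (rt (bb j)) g" "x j"]
        by linarith+
      then show ?thesis using step.IH[OF xy] by blast
    qed
  qed
  note key = this
  show ?case
  proof (cases "x = y")
    case True then show ?thesis by (intro exI[of _ 0]) auto
  next
    case False
    obtain g where g: "g \<in> \<Delta>" "pr y g > 0" "pr x g \<le> 0" using separating_root[OF less.prems(1,2) False] by blast
    \<comment> \<open>With \<open>k = 1\<close> the affine root is positive whatever the sign of
      \<open>g\<close>, and level-zero pairings ignore \<open>k\<close>.\<close>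
    then have "apos g 1" by (simp add: apos_def)
    from key[OF this less.prems g(2,3)] show ?thesis .
  qed
qed

section \<open>Directed paths in the graph as paths in the orbit\<close>

lemma sigma_path_0: "sigma_path n A lam J s x y 0 \<longleftrightarrow> x = y"
  by (auto simp: sigma_path_def qbg_path_def intro!: exI[of _ "\<lambda>_. x"])

lemma sigma_path_Suc: "sigma_path n A lam J s x y (Suc k) \<longleftrightarrow>
    (\<exists>z. sigma_path n A lam J s x z k \<and> (\<exists>b. qbg_edge n A J y b z \<and> s * copair n A lam b \<in> \<int>))"
proof
  assume "sigma_path n A lam J s x y (Suc k)"
  then obtain ws bs where w: "ws 0 = x" "ws (Suc k) = y"
    "\<And>t. t \<in> {1..Suc k} \<Longrightarrow> qbg_edge n A J (ws t) (bs t) (ws (t - 1)) \<and> s * copair n A lam (bs t) \<in> \<int>"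
    unfolding sigma_path_def qbg_path_def by blast
  have "sigma_path n A lam J s x (ws k) k"
    unfolding sigma_path_def qbg_path_def using w by (intro exI[of _ ws] exI[of _ bs]) auto
  moreover have "qbg_edge n A J y (bs (Suc k)) (ws k) \<and> s * copair n A lam (bs (Suc k)) \<in> \<int>"
    using w(2) w(3)[of "Suc k"] by simp
  ultimately show "\<exists>z. sigma_path n A lam J s x z k \<and> (\<exists>b. qbg_edge n A J y b z \<and> s * copair n A lam b \<in> \<int>)" by blast
next
  assume "\<exists>z. sigma_path n A lam J s x z k \<and> (\<exists>b. qbg_edge n A J y b z \<and> s * copair n A lam b \<in> \<int>)"
  then obtain z b ws bs where w: "ws 0 = x" "ws k = z"
    "\<And>t. t \<in> {1..k} \<Longrightarrow> qbg_edge n A J (ws t) (bs t) (ws (t - 1)) \<and> s * copair n A lam (bs t) \<in> \<int>"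
    and b: "qbg_edge n A J y b z" "s * copair n A lam b \<in> \<int>"
    unfolding sigma_path_def qbg_path_def by blast
  let ?ws = "ws(Suc k := y)" and ?bs = "bs(Suc k := b)"
  have "qbg_edge n A J (?ws t) (?bs t) (?ws (t - 1)) \<and> s * copair n A lam (?bs t) \<in> \<int>" if "t \<in> {1..Suc k}" for t
  proof (cases "t = Suc k")
    case True then show ?thesis using b w(2) by simp
  next
    case False
    then have t: "t \<in> {1..k}" using that by auto
    then have "?ws (t - 1) = ws (t - 1)" by auto
    then show ?thesis using w(3)[OF t] False by simp
  qed
  then show "sigma_path n A lam J s x y (Suc k)"
    unfolding sigma_path_def qbg_path_def using w(1) by (intro exI[of _ ?ws] exI[of _ ?bs]) auto
qed

lemma sigma_path_iff:
  assumes "x \<in> minreps n A J"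
  shows "y \<in> minreps n A J \<Longrightarrow> sigma_path n A lam J s x y k \<longleftrightarrow> (ed s ^^ k) (q y) (q x)"
proof (induction k arbitrary: y)
  case 0 then show ?case using minreps_unique[OF assms 0] by (auto simp: sigma_path_0)
next
  case (Suc k)
  have yV: "q y \<in> V" using q_V Suc.prems by (simp add: minreps_iff)
  show ?case
  proof
    assume "sigma_path n A lam J s x y (Suc k)"
    then obtain z b where z: "sigma_path n A lam J s x z k" "qbg_edge n A J y b z" "s * copair n A lam b \<in> \<int>"
      by (auto simp: sigma_path_Suc)
    have zm: "z \<in> minreps n A J"
    proof -
      obtain g where g: "g \<in> \<Delta>" "b = ar g 0" using z(2) posroot_outside_J[of b] unfolding qbg_edge_def by blast
      have "rrefl n A b \<in> Weyl0 n A"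
        using g rrefl_eq[OF ar0_real[OF g(1)]] root_refl_word[OF g(1)] by (auto simp: Weyl0_def)
      then have "y \<circ> rrefl n A b \<in> Weyl0 n A" using Weyl0_comp Suc.prems by (simp add: minreps_iff)
      then show ?thesis using z(2) floorJ(1) by (simp add: qbg_edge_def)
    qed
    have "ed s (q y) (q z)" using qbg_edge_iff[OF Suc.prems zm] z by blast
    moreover have "(ed s ^^ k) (q z) (q x)" using Suc.IH[OF zm] z(1) by blast
    ultimately show "(ed s ^^ Suc k) (q y) (q x)" by (rule relpowp_Suc_I2)
  next
    assume "(ed s ^^ Suc k) (q y) (q x)"
    then obtain v where v: "ed s (q y) v" "(ed s ^^ k) v (q x)" by (rule relpowp_Suc_E2)
    have "v \<in> V"
    proof -
      obtain g k where g: "apos g k" "q y = rw g v" using v(1) by (auto simp: ed_def)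
      then have "v = rw g (q y)" using rw_invol apos_root by metis
      then show ?thesis using V_rw[OF yV] apos_root g by blast
    qed
    then obtain z where z: "z \<in> minreps n A J" "q z = v" using V_minrep by blast
    then show "sigma_path n A lam J s x y (Suc k)"
      using v qbg_edge_iff[OF Suc.prems z(1)] Suc.IH[OF z(1)] by (auto simp: sigma_path_Suc)
  qed
qed

lemma qbg_path_sigma: "(\<exists>ws bs. qbg_path n A J x y k ws bs) \<longleftrightarrow> sigma_path n A lam J 0 x y k"
  by (simp add: sigma_path_def)

text \<open>The bound \<open>M\<close> is the distance itself, and a sigma-path is in particular a
  plain path, so the path found has exactly that length.\<close>

lemma shortest_sigma_path:
  assumes x: "x \<in> minreps n A J" and y: "y \<in> minreps n A J" and p: "sigma_path n A lam J s x y k"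
  shows "sigma_path n A lam J s x y (qbg_dist n A J x y)"
proof -
  let ?d = "qbg_dist n A J x y"
  have V: "q x \<in> V" "q y \<in> V" using q_V x y by (auto simp: minreps_iff)
  have e: "(ed s ^^ k) (q y) (q x)" using p sigma_path_iff[OF x y] by blast
  have "sigma_path n A lam J 0 x y k" using path_plain[OF e] sigma_path_iff[OF x y] by blast
  then have "sigma_path n A lam J 0 x y ?d" unfolding qbg_dist_def qbg_path_sigma by (rule LeastI)
  then have "(ed 0 ^^ ?d) (q y) (q x)" using sigma_path_iff[OF x y] by blast
  from shorten_sigma_path[OF V e this] obtain k' where k': "k' \<le> ?d" "(ed s ^^ k') (q y) (q x)" by blast
  have "sigma_path n A lam J 0 x y k'" using path_plain[OF k'(2)] sigma_path_iff[OF x y] by blast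
  then have "?d \<le> k'" unfolding qbg_dist_def qbg_path_sigma by (rule Least_le)
  then show ?thesis using k' sigma_path_iff[OF x y] by simp
qed

lemma QLS_tilde_hat: "QLS_tilde n A lam = QLS_hat n A lam"
proof -
  have "(\<exists>len. sigma_path n A lam J s x y len) \<longleftrightarrow> sigma_path n A lam J s x y (qbg_dist n A J x y)"
    if "x \<in> minreps n A J" "y \<in> minreps n A J" for s x y
    using shortest_sigma_path[OF that] by blast
  then show ?thesis unfolding QLS_tilde_def QLS_hat_def by (intro Collect_cong) (auto simp: less_imp_diff_less)
qed

section \<open>Lakshmibai-Seshadri chains and quantum Bruhat paths\<close>

lemma orbit_sref: "a \<in> orbit n A lam \<Longrightarrow> j \<in> II \<Longrightarrow> sref n A j a \<in> orbit n A lam"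
proof -
  assume "a \<in> orbit n A lam" "j \<in> II"
  then obtain ws where "set ws \<subseteq> II" "a = wword n A ws lam" by (auto simp: orbit_def Weyl_def)
  then have "sref n A j a = wword n A (j # ws) lam" "set (j # ws) \<subseteq> II" using \<open>j \<in> II\<close> by auto
  then show ?thesis unfolding orbit_def Weyl_def by blast
qed

lemma orbit_wword: "set ws \<subseteq> II \<Longrightarrow> a \<in> orbit n A lam \<Longrightarrow> wword n A ws a \<in> orbit n A lam"
  by (induction ws) (auto simp: orbit_sref)

lemma orbit_V: assumes "a \<in> orbit n A lam" shows "fst a \<in> V"
proof -
  have "set ws \<subseteq> II \<Longrightarrow> fst (wword n A ws lam) \<in> V" for ws
    by (induction ws) (use L_V V_rw bb_root V_lz fst_sref in auto)
  then show ?thesis using assms by (auto simp: orbit_def Weyl_def)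
qed

lemma orbit_rr: "apos g k \<Longrightarrow> a \<in> orbit n A lam \<Longrightarrow> rr g k a \<in> orbit n A lam"
proof -
  assume g: "apos g k" and a: "a \<in> orbit n A lam"
  obtain ws i where w: "ar g k = wword n A ws (sroot n A i)" "set ws \<subseteq> II" "i \<in> II"
    using apos_real[OF g] by (auto simp: realroots_def)
  then show ?thesis using rr_word[OF w(2,3,1) apos_root[OF g]] orbit_wword[of "ws @ i # rev ws"] a by auto
qed

lemma orbit_lz: "a \<in> orbit n A lam \<Longrightarrow> lz (fst a)" using orbit_V V_lz by blast

lemma orbit_chain: "(stp ^^ k) a b \<Longrightarrow> a \<in> orbit n A lam \<Longrightarrow> b \<in> orbit n A lam"
proof (induction k arbitrary: b)
  case (Suc k)
  then obtain c where c: "(stp ^^ k) a c" "stp c b" by auto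
  obtain g l where "apos g l" "b = rr g l c" using c(2) by (auto simp: stp_def)
  then show ?case using orbit_rr Suc.IH[OF c(1) Suc.prems(2)] by blast
qed simp

lemma posroot_action:
  assumes "apos g k" "a \<in> orbit n A lam"
  shows "rrefl n A (ar g k) a = rr g k a" "copair n A a (ar g k) = pr (fst a) g"
  using assms apos_real apos_root orbit_lz by (auto simp: rrefl_eq copair_eq cp_lz)

lemma stp_iff: assumes "a \<in> orbit n A lam"
  shows "stp a b \<longleftrightarrow> (\<exists>r\<in>posroots n A. b = rrefl n A r a \<and> copair n A a r < 0)"
proof
  assume "stp a b"
  then obtain g k where "apos g k" "pr (fst a) g < 0" "b = rr g k a" by (auto simp: stp_def)
  then show "\<exists>r\<in>posroots n A. b = rrefl n A r a \<and> copair n A a r < 0"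
    using posroot_action[OF _ assms] posroots_eq by (intro bexI[of _ "ar g k"]) auto
next
  assume "\<exists>r\<in>posroots n A. b = rrefl n A r a \<and> copair n A a r < 0"
  then obtain g k where "apos g k" "b = rrefl n A (ar g k) a" "copair n A a (ar g k) < 0" by (auto simp: posroots_eq)
  then show "stp a b" using posroot_action[OF _ assms] orbit_lz[OF assms] unfolding stp_def by metis
qed

lemma ls_chain_iff: "ls_chain n A lam a b k \<longleftrightarrow> a \<in> orbit n A lam \<and> (stp ^^ k) a b"
proof
  assume "ls_chain n A lam a b k"
  then obtain ms bs where ms: "ms 0 = a" "ms k = b" "\<And>t. t \<le> k \<Longrightarrow> ms t \<in> orbit n A lam"
    "\<And>t. t \<in> {1..k} \<Longrightarrow> bs t \<in> posroots n A \<and> ms t = rrefl n A (bs t) (ms (t - 1)) \<and> copair n A (ms (t - 1)) (bs t) < 0"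
    unfolding ls_chain_def by blast
  have "stp (ms i) (ms (Suc i))" if "i < k" for i
    using ms(3)[of i] ms(4)[of "Suc i"] that stp_iff[of "ms i"] by auto
  then show "a \<in> orbit n A lam \<and> (stp ^^ k) a b" using ms(1-3) by (auto simp: relpowp_fun_conv intro!: exI[of _ ms])
next
  assume a: "a \<in> orbit n A lam \<and> (stp ^^ k) a b"
  then obtain ms where ms: "ms 0 = a" "ms k = b" "\<And>i. i < k \<Longrightarrow> stp (ms i) (ms (Suc i))"
    by (auto simp: relpowp_fun_conv)
  have o: "t \<le> k \<Longrightarrow> ms t \<in> orbit n A lam" for t
  proof (induction t)
    case 0 then show ?case using a ms by simp
  next
    case (Suc t)
    then show ?case using orbit_chain[OF relpow1, of "ms t" "ms (Suc t)"] ms(3)[of t] by simp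
  qed
  have "\<exists>r. r \<in> posroots n A \<and> ms t = rrefl n A r (ms (t - 1)) \<and> copair n A (ms (t - 1)) r < 0" if "t \<in> {1..k}" for t
  proof -
    have "t - 1 < k" "t - 1 \<le> k" "Suc (t - 1) = t" using that by auto
    then show ?thesis using stp_iff[OF o[of "t - 1"], of "ms t"] ms(3)[of "t - 1"] by (simp only:) blast
  qed
  then obtain bs where "\<And>t. t \<in> {1..k} \<Longrightarrow> bs t \<in> posroots n A \<and> ms t = rrefl n A (bs t) (ms (t - 1)) \<and> copair n A (ms (t - 1)) (bs t) < 0"
    by metis
  then show "ls_chain n A lam a b k" unfolding ls_chain_def using ms(1,2) o by blast
qed

lemma ls_dist1_iff: "ls_dist1 n A lam a b \<longleftrightarrow> a \<in> orbit n A lam \<and> stp a b \<and> (\<forall>k. (stp ^^ k) a b \<longrightarrow> k \<le> 1)"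
  unfolding ls_dist1_def ls_chain_iff by (auto simp: relpowp_1)

lemma ls_gt_iff: "ls_gt n A lam a b \<longleftrightarrow> a \<in> orbit n A lam \<and> a \<noteq> b \<and> (\<exists>k. (stp ^^ k) a b)"
  unfolding ls_gt_def ls_ge_def ls_chain_iff using orbit_chain by blast

text \<open>A step of excess at least 2 could be refined, so distance 1 forces excess 1. The path
  runs against the chain.\<close>

lemma sigma_chain_projects:
  assumes "sigma_chain n A lam s a b" "s > 0"
  shows "\<exists>k. (ed s ^^ k) (fst b) (fst a)"
  using conjunct2[OF assms(1)[unfolded sigma_chain_def]]
proof (elim exE conjE)
  fix k and ms bs :: "nat \<Rightarrow> wt"
  assume ms: "ms 0 = a" "ms k = b"
    "\<forall>t\<in>{1..k}. ls_gt n A lam (ms (t - 1)) (ms t) \<and> ls_dist1 n A lam (ms (t - 1)) (ms t) \<and>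
        bs t \<in> posroots n A \<and> rrefl n A (bs t) (ms (t - 1)) = ms t \<and>
        s * copair n A (ms (t - 1)) (bs t) \<in> \<int> \<and> s * copair n A (ms (t - 1)) (bs t) < 0"
  have e: "ed s (fst (ms (Suc i))) (fst (ms i))" if "i < k" for i
  proof -
    have h: "ls_dist1 n A lam (ms i) (ms (Suc i))" "bs (Suc i) \<in> posroots n A" "rrefl n A (bs (Suc i)) (ms i) = ms (Suc i)"
      "s * copair n A (ms i) (bs (Suc i)) \<in> \<int>" "s * copair n A (ms i) (bs (Suc i)) < 0"
      using bspec[OF ms(3), of "Suc i"] that by auto
    have o: "ms i \<in> orbit n A lam" and mx: "\<And>k. (stp ^^ k) (ms i) (ms (Suc i)) \<Longrightarrow> k \<le> 1" using h(1) by (auto simp: ls_dist1_iff)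
    obtain g l where g: "apos g l" "bs (Suc i) = ar g l" using h(2) posroots_eq by blast
    note act = posroot_action[OF g(1) o]
    have p: "pr (fst (ms i)) g < 0" using h(5) act(2) g(2) assms(2) by (simp add: mult_less_0_iff)
    have r: "ms (Suc i) = rr g l (ms i)" using h(3) act(1) g(2) by simp
    have lz: "lz (fst (ms i))" using orbit_lz[OF o] .
    have "D (fst (ms i)) g l = 1"
    proof (rule ccontr)
      assume "D (fst (ms i)) g l \<noteq> 1"
      then have "2 \<le> D (fst (ms i)) g l" using D_ge1[OF g(1) lz p] by linarith
      from excess_refinement[OF g(1) lz p this] show False using mx r by fastforce
    qed
    then show ?thesis unfolding ed_def using lz g(1) p r fst_rr[OF lz] h(4) act(2) g(2) by (auto intro!: exI[of _ g] exI[of _ l])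
  qed
  have "(ed s ^^ k) (fst b) (fst a)"
    unfolding relpowp_fun_conv
  proof (intro exI[of _ "\<lambda>i. fst (ms (k - i))"] conjI allI impI)
    fix i assume "i < k"
    then show "ed s (fst (ms (k - i))) (fst (ms (k - Suc i)))" using e[of "k - Suc i"] by (simp add: Suc_diff_Suc)
  qed (use ms in auto)
  then show ?thesis by blast
qed

text \<open>The edges are followed backwards from the end of the path, each lifted by the affine
  root of excess 1; \<open>excess_one_cover\<close> makes every lifted step a cover.\<close>

lemma sigma_chain_lift:
  assumes "(ed s ^^ k) v (fst a)" "a \<in> orbit n A lam" "s > 0" "v \<noteq> fst a"
  shows "\<exists>b. fst b = v \<and> b \<in> orbit n A lam \<and> sigma_chain n A lam s a b"
proof -
  define cst where "cst a b \<longleftrightarrow> a \<in> orbit n A lam \<and> (\<exists>g l. apos g l \<and> pr (fst a) g < 0 \<and> D (fst a) g l = 1 \<and>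
     s * pr (fst a) g \<in> \<int> \<and> b = rr g l a)" for a b
  have "\<exists>b. (cst ^^ k) a b \<and> fst b = v \<and> b \<in> orbit n A lam"
    using assms(1,2)
  proof (induction k arbitrary: a)
    case 0 then show ?case by (intro exI[of _ a]) auto
  next
    case (Suc k)
    then obtain z where z: "(ed s ^^ k) v z" "ed s z (fst a)" by auto
    obtain g l where g: "apos g l" "pr (fst a) g < 0" "D (fst a) g l = 1" "z = rw g (fst a)" "s * pr (fst a) g \<in> \<int>"
      using z(2) by (auto simp: ed_def)
    have c: "cst a (rr g l a)" unfolding cst_def using g Suc.prems(2) by blast
    have "fst (rr g l a) = z" using fst_rr[OF orbit_lz[OF Suc.prems(2)]] g(4) by simp
    then obtain b where b: "(cst ^^ k) (rr g l a) b" "fst b = v" "b \<in> orbit n A lam"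
      using Suc.IH[of "rr g l a"] z(1) orbit_rr[OF g(1) Suc.prems(2)] by auto
    have "(cst ^^ Suc k) a b" using c b(1) by (rule relpowp_Suc_I2)
    then show ?case using b by blast
  qed
  then obtain b where b: "(cst ^^ k) a b" "fst b = v" "b \<in> orbit n A lam" by blast
  obtain ms where ms: "ms 0 = a" "ms k = b" "\<And>i. i < k \<Longrightarrow> cst (ms i) (ms (Suc i))"
    using b(1) by (auto simp: relpowp_fun_conv)
  have cs: "cst c d \<Longrightarrow> stp c d" for c d using orbit_lz by (auto simp: cst_def stp_def)
  have step: "\<exists>r. ls_gt n A lam (ms (t - 1)) (ms t) \<and> ls_dist1 n A lam (ms (t - 1)) (ms t) \<and>
           r \<in> posroots n A \<and> rrefl n A r (ms (t - 1)) = ms t \<and>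
           s * copair n A (ms (t - 1)) r \<in> \<int> \<and> s * copair n A (ms (t - 1)) r < 0" if "t \<in> {1..k}" for t
  proof -
    have "t - 1 < k" "Suc (t - 1) = t" using that by auto
    then have c: "cst (ms (t - 1)) (ms t)" using ms(3)[of "t - 1"] by simp
    then obtain g l where g: "ms (t - 1) \<in> orbit n A lam" "apos g l" "pr (fst (ms (t - 1))) g < 0" "D (fst (ms (t - 1))) g l = 1"
      "s * pr (fst (ms (t - 1))) g \<in> \<int>" "ms t = rr g l (ms (t - 1))" unfolding cst_def by blast
    note act = posroot_action[OF g(2,1)]
    have st: "(stp ^^ 1) (ms (t - 1)) (ms t)" using cs[OF c] by (simp only: relpowp_1)
    have "ms (t - 1) \<noteq> ms t" using stp_pot[OF cs[OF c]] by auto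
    then have "ls_gt n A lam (ms (t - 1)) (ms t)" using g(1) st unfolding ls_gt_iff by blast
    moreover have "ls_dist1 n A lam (ms (t - 1)) (ms t)"
      unfolding ls_dist1_iff using g(1) cs[OF c] excess_one_cover[OF g(2) orbit_lz[OF g(1)] g(3,4)]
      unfolding g(6)[symmetric] by blast
    ultimately show ?thesis using g act posroots_eq assms(3)
      by (intro exI[of _ "ar g l"]) (auto simp: mult_pos_neg)
  qed
  then obtain bs where bs: "\<And>t. t \<in> {1..k} \<Longrightarrow> ls_gt n A lam (ms (t - 1)) (ms t) \<and> ls_dist1 n A lam (ms (t - 1)) (ms t) \<and>
           bs t \<in> posroots n A \<and> rrefl n A (bs t) (ms (t - 1)) = ms t \<and>
           s * copair n A (ms (t - 1)) (bs t) \<in> \<int> \<and> s * copair n A (ms (t - 1)) (bs t) < 0" by metis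
  have "(stp ^^ k) a b" using cs relpowp_mono[of cst stp, OF _ b(1)] by blast
  then have "ls_gt n A lam a b" using assms b by (auto simp: ls_gt_iff)
  then have "sigma_chain n A lam s a b" unfolding sigma_chain_def using ms bs by blast
  then show ?thesis using b by blast
qed

end

section \<open>Piecewise-linear paths\<close>

lemma breaks_mono: "breaks_ok s sig \<Longrightarrow> i \<le> j \<Longrightarrow> j \<le> s \<Longrightarrow> sig ! i \<le> sig ! j"
proof (induction j)
  case (Suc j)
  then show ?case
  proof (cases "i = Suc j")
    case False
    then have "sig ! i \<le> sig ! j" using Suc by simp
    moreover have "sig ! j < sig ! (j + 1)" using Suc.prems by (auto simp: breaks_ok_def)
    ultimately show ?thesis by simp
  qed simp
qed simp

lemma breaks_pos: "breaks_ok s sig \<Longrightarrow> 1 \<le> k \<Longrightarrow> k \<le> s \<Longrightarrow> sig ! k > 0"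
proof -
  assume a: "breaks_ok s sig" "1 \<le> k" "k \<le> s"
  have "sig ! 0 < sig ! (0 + 1)" "sig ! 0 = 0" using a by (auto simp: breaks_ok_def)
  then show ?thesis using breaks_mono[OF a(1,2,3)] by simp
qed

lemma breaks_Least:
  assumes b: "breaks_ok s sig" and t: "0 \<le> t" "t \<le> (1::real)"
  defines "k \<equiv> LEAST k. 1 \<le> k \<and> t \<le> sig ! k"
  shows "1 \<le> k" "k \<le> s" "t \<le> sig ! k" "sig ! (k - 1) \<le> t"
proof -
  have s: "1 \<le> s \<and> t \<le> sig ! s" using b t by (auto simp: breaks_ok_def)
  show k: "1 \<le> k" "t \<le> sig ! k" using LeastI[of "\<lambda>k. 1 \<le> k \<and> t \<le> sig ! k", OF s] by (auto simp: k_def)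
  show "k \<le> s" unfolding k_def by (rule Least_le[of "\<lambda>k. 1 \<le> k \<and> t \<le> sig ! k", OF s])
  show "sig ! (k - 1) \<le> t"
  proof (cases "k = 1")
    case True then show ?thesis using b t by (simp add: breaks_ok_def)
  next
    case False
    then have "\<not> (1 \<le> k - 1 \<and> t \<le> sig ! (k - 1))" using k not_less_Least[of "k - 1"] unfolding k_def
      by (metis (no_types, lifting) diff_less k_def less_le_trans zero_less_one)
    then show ?thesis using False k by auto
  qed
qed

text \<open>Each segment contributes the length of its part before \<open>t\<close>. The index of
  the current segment disappears, so that merging two segments amounts to adding two
  summands.\<close>

lemma clpath_sum:
  assumes b: "breaks_ok (length vs) sig" and t: "0 \<le> t" "t \<le> 1"
  shows "clpath vs sig t = (\<lambda>j. \<Sum>l<length vs. (min t (sig ! Suc l) - min t (sig ! l)) * (vs ! l) j)"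
proof
  fix j
  let ?s = "length vs"
  define k where "k = (LEAST k. 1 \<le> k \<and> t \<le> sig ! k)"
  note kk = breaks_Least[OF b t, folded k_def]
  obtain k' where k': "k = Suc k'" using kk(1) by (cases k) auto
  define f where "f l = (min t (sig ! Suc l) - min t (sig ! l)) * (vs ! l) j" for l
  have "clpath vs sig t j = (\<Sum>l\<in>{1..<k}. (sig ! l - sig ! (l - 1)) * (vs ! (l - 1)) j) + (t - sig ! (k - 1)) * (vs ! (k - 1)) j"
    using t by (simp add: clpath_def k_def Let_def)
  also have "(\<Sum>l\<in>{1..<k}. (sig ! l - sig ! (l - 1)) * (vs ! (l - 1)) j) = (\<Sum>l<k'. (sig ! Suc l - sig ! l) * (vs ! l) j)"
    unfolding k' One_nat_def sum.shift_bounds_Suc_ivl by (simp add: atLeast0LessThan)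
  also have "\<dots> = (\<Sum>l<k'. f l)"
  proof (intro sum.cong refl)
    fix l assume l: "l \<in> {..<k'}"
    have "sig ! Suc l \<le> sig ! k'" "sig ! l \<le> sig ! k'" using l kk(2) k' by (auto intro!: breaks_mono[OF b])
    then have "sig ! Suc l \<le> t" "sig ! l \<le> t" using kk(4) k' by auto
    then show "(sig ! Suc l - sig ! l) * (vs ! l) j = f l" by (simp add: f_def min_def)
  qed
  also have "(t - sig ! (k - 1)) * (vs ! (k - 1)) j = f k'"
    using kk(3,4) k' by (simp add: f_def min_def)
  also have "(\<Sum>l<k'. f l) + f k' = (\<Sum>l<k. f l)" by (simp add: k')
  also have "\<dots> = (\<Sum>l<?s. f l)"
  proof (rule sum.mono_neutral_left)
    show "\<forall>l\<in>{..<?s} - {..<k}. f l = 0"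
    proof
      fix l assume l: "l \<in> {..<?s} - {..<k}"
      have "sig ! k \<le> sig ! l" "sig ! k \<le> sig ! Suc l" using l by (auto intro!: breaks_mono[OF b])
      then show "f l = 0" using kk(3) by (simp add: f_def min_def)
    qed
  qed (use kk(2) in auto)
  finally show "clpath vs sig t j = (\<Sum>l<?s. (min t (sig ! Suc l) - min t (sig ! l)) * (vs ! l) j)" by (simp add: f_def)
qed

lemma cl_wtpath:
  assumes b: "breaks_ok (length nus) sig"
  shows "cl (wtpath nus sig t) = clpath (map fst nus) sig t"
proof (cases "0 \<le> t \<and> t \<le> 1")
  case True
  note kk = breaks_Least[OF b True[THEN conjunct1] True[THEN conjunct2]]
  define k where "k = (LEAST k. 1 \<le> k \<and> t \<le> sig ! k)"
  have k: "1 \<le> k" "k \<le> length nus" using kk(1,2) by (simp_all add: k_def)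
  have "(\<Sum>l\<in>{1..<k}. (sig ! l - sig ! (l - 1)) * fst (nus ! (l - 1)) j)
      = (\<Sum>l\<in>{1..<k}. (sig ! l - sig ! (l - 1)) * (map fst nus ! (l - 1)) j)" for j
    by (intro sum.cong refl) (use k in auto)
  moreover have "map fst nus ! (k - 1) = fst (nus ! (k - 1))" using k by simp
  ultimately show ?thesis using True
    unfolding wtpath_def clpath_def Let_def k_def[symmetric] cl_def wadd_def wsum_def wscale_def by simp
next
  case False
  then show ?thesis by (auto simp: wtpath_def clpath_def cl_def wzero_def)
qed

definition remove_nth :: "nat \<Rightarrow> 'a list \<Rightarrow> 'a list" where
  "remove_nth k xs = take k xs @ drop (Suc k) xs"

lemma length_remove_nth: "k < length xs \<Longrightarrow> length (remove_nth k xs) = length xs - 1"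
  by (simp add: remove_nth_def)

lemma nth_remove_nth: "k < length xs \<Longrightarrow> remove_nth k xs ! i = (if i < k then xs ! i else xs ! Suc i)"
  by (simp add: remove_nth_def nth_append)

lemma set_remove_nth: "set (remove_nth k xs) \<subseteq> set xs"
  by (auto simp: remove_nth_def dest: in_set_takeD in_set_dropD)

lemma merge_breaks:
  assumes b: "breaks_ok (length vs) sig" and k: "1 \<le> k" "k < length vs" and eq: "vs ! (k - 1) = vs ! k"
  shows "breaks_ok (length (remove_nth k vs)) (remove_nth k sig)"
    and "clpath (remove_nth k vs) (remove_nth k sig) = clpath vs sig"
proof -
  have ls: "length sig = length vs + 1" using b by (simp add: breaks_ok_def)
  have kl: "k < length sig" using ls k by simp
  let ?vs = "remove_nth k vs" and ?sig = "remove_nth k sig"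
  have lv: "length ?vs = length vs - 1" using length_remove_nth[OF k(2)] .
  note nth = nth_remove_nth[OF k(2)] nth_remove_nth[OF kl]
  have up: "i < length vs \<Longrightarrow> sig ! i < sig ! Suc i" for i using b by (simp add: breaks_ok_def)
  show b': "breaks_ok (length ?vs) ?sig"
    unfolding breaks_ok_def lv
  proof (intro conjI allI impI)
    show "1 \<le> length vs - 1" using k by simp
    show "length ?sig = length vs - 1 + 1" using length_remove_nth[OF kl] ls k by simp
    show "?sig ! 0 = 0" using b k by (simp add: nth breaks_ok_def)
    have "\<not> length vs - 1 < k" "Suc (length vs - 1) = length vs" using k by auto
    then show "?sig ! (length vs - 1) = 1" using b by (simp only: nth breaks_ok_def if_False)
    fix i
    show "?sig ! i < ?sig ! (i + 1)" if "i < length vs - 1"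
    proof -
      consider "i + 1 < k" | "i + 1 = k" | "k \<le> i" by linarith
      then show ?thesis
      proof cases
        case 1 then show ?thesis using up[of i] k by (simp add: nth)
      next
        case 2 then show ?thesis using up[of i] up[of k] k by (auto simp: nth)
      next
        case 3 then show ?thesis using up[of "Suc i"] that by (simp add: nth)
      qed
    qed
    show "?sig ! i \<in> \<rat>" if "i \<le> length vs - 1" using b that k by (simp add: nth breaks_ok_def)
  qed
  show "clpath ?vs ?sig = clpath vs sig"
  proof
    fix t
    show "clpath ?vs ?sig t = clpath vs sig t"
    proof (cases "0 \<le> t \<and> t \<le> 1")
      case False then show ?thesis by (auto simp: clpath_def)
    next
      case True
      obtain r where r: "length vs = Suc r" using k by (cases "length vs") auto
      obtain k' where k': "k = Suc k'" using k by (cases k) auto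
      have "(\<Sum>l<r. (min t (?sig ! Suc l) - min t (?sig ! l)) * (?vs ! l) j)
          = (\<Sum>l<Suc r. (min t (sig ! Suc l) - min t (sig ! l)) * (vs ! l) j)" (is "sum ?f' _ = sum ?f _") for j
      proof -
        have "sum ?f' {..<r} = sum ?f' {..<k} + sum ?f' {k..<r}"
          using k r by (simp add: sum.atLeastLessThan_concat lessThan_atLeast0)
        also have "sum ?f' {..<k} = sum ?f' {..<k'} + ?f' k'" by (simp add: k')
        also have "sum ?f' {..<k'} = sum ?f {..<k'}" by (intro sum.cong) (auto simp: nth[unfolded k'] k')
        also have "?f' k' = ?f k' + ?f k"
          using eq by (simp add: nth[unfolded k'] k' algebra_simps)
        also have "sum ?f' {k..<r} = (\<Sum>l\<in>{k..<r}. ?f (Suc l))" by (intro sum.cong) (auto simp: nth)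
        also have "\<dots> = sum ?f {Suc k..<Suc r}" by (rule sum.shift_bounds_Suc_ivl[symmetric])
        also have "sum ?f {..<k'} + (?f k' + ?f k) + sum ?f {Suc k..<Suc r} = sum ?f {..<Suc k} + sum ?f {Suc k..<Suc r}"
          by (simp add: k')
        also have "\<dots> = sum ?f {..<Suc r}"
          using k r by (simp add: sum.atLeastLessThan_concat lessThan_atLeast0 del: sum.lessThan_Suc sum.op_ivl_Suc)
        finally show ?thesis .
      qed
      then show ?thesis using clpath_sum[OF b] clpath_sum[OF b'] True lv r by simp
    qed
  qed
qed

section \<open>Comparison of quantum LS paths and LS paths\<close>

context level_zero_weight
begin

text \<open>Neighbouring directions may coincide, since \<open>cl\<close> can identify successive
  weights of an LS path.\<close>

definition cl_paths :: "((nat \<Rightarrow> real) list \<times> real list) set" where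
  "cl_paths = {(vs, sig). breaks_ok (length vs) sig \<and> set vs \<subseteq> V \<and>
     (\<forall>k\<in>{1..<length vs}. \<exists>l. (ed (sig ! k) ^^ l) (vs ! k) (vs ! (k - 1)))}"

text \<open>Merging discards the condition at the removed break; all others keep their neighbours
  because the two merged directions agree.\<close>

lemma merge_cl_paths:
  "(vs, sig) \<in> cl_paths \<Longrightarrow> \<exists>vs' sig'. (vs', sig') \<in> cl_paths \<and> clpath vs' sig' = clpath vs sig \<and>
     (\<forall>k. k + 1 < length vs' \<longrightarrow> vs' ! k \<noteq> vs' ! (k + 1))"
proof (induction "length vs" arbitrary: vs sig rule: less_induct)
  case less
  show ?case
  proof (cases "\<forall>k. k + 1 < length vs \<longrightarrow> vs ! k \<noteq> vs ! (k + 1)")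
    case True then show ?thesis using less.prems by blast
  next
    case False
    then obtain i where i: "i + 1 < length vs" "vs ! i = vs ! (i + 1)" by blast
    define k where "k = i + 1"
    have k: "1 \<le> k" "k < length vs" "vs ! (k - 1) = vs ! k" using i by (auto simp: k_def)
    have b: "breaks_ok (length vs) sig" "set vs \<subseteq> V"
      and e: "\<And>k. k \<in> {1..<length vs} \<Longrightarrow> \<exists>l. (ed (sig ! k) ^^ l) (vs ! k) (vs ! (k - 1))"
      using less.prems by (auto simp: cl_paths_def)
    have kl: "k < length sig" using b(1) k(2) by (simp add: breaks_ok_def)
    note nth = nth_remove_nth[OF k(2)] nth_remove_nth[OF kl]
    let ?vs = "remove_nth k vs" and ?sig = "remove_nth k sig"
    note mb = merge_breaks[OF b(1) k]
    have "\<exists>l. (ed (?sig ! t) ^^ l) (?vs ! t) (?vs ! (t - 1))" if t: "t \<in> {1..<length ?vs}" for t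
    proof -
      have tl: "1 \<le> t" "t < length vs - 1" using t length_remove_nth[OF k(2)] by auto
      consider "t < k" | "t = k" | "k < t" by linarith
      then show ?thesis
      proof cases
        case 1 then show ?thesis using e[of t] tl by (auto simp: nth)
      next
        case 2 then show ?thesis using e[of "Suc t"] tl k by (auto simp: nth)
      next
        case 3
        then have "\<not> t - 1 < k" "Suc (t - 1) = t" by auto
        then show ?thesis using 3 e[of "Suc t"] tl by (auto simp: nth)
      qed
    qed
    then have "(?vs, ?sig) \<in> cl_paths" using mb(1) b(2) set_remove_nth[of k vs] by (auto simp: cl_paths_def)
    then show ?thesis using less.hyps[of ?vs ?sig] length_remove_nth[OF k(2)] k(2) mb(2) by auto
  qed
qed

lemma QLS_tilde_cl_eq:
  "QLS_tilde_cl n A lam = {clpath vs sig | vs sig. (vs, sig) \<in> cl_paths \<and> (\<forall>k. k + 1 < length vs \<longrightarrow> vs ! k \<noteq> vs ! (k + 1))}"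
    (is "_ = ?R")
proof (intro set_eqI iffI)
  fix p assume "p \<in> QLS_tilde_cl n A lam"
  then obtain xs sig where p: "p = clpath (map q xs) sig" and x: "(xs, sig) \<in> QLS_tilde n A lam"
    by (auto simp: QLS_tilde_cl_def cl_act_q)
  have m: "k < length xs \<Longrightarrow> xs ! k \<in> minreps n A J" for k using x by (simp add: QLS_tilde_def)
  have ex: "\<forall>k\<in>{1..<length xs}. \<exists>len. sigma_path n A lam J (sig ! k) (xs ! (k - 1)) (xs ! k) len"
    using x unfolding QLS_tilde_def mem_Collect_eq split by (elim conjE)
  have "(map q xs, sig) \<in> cl_paths"
  proof -
    have "set (map q xs) \<subseteq> V" using m q_V by (fastforce simp: in_set_conv_nth minreps_iff)
    moreover have "\<exists>l. (ed (sig ! k) ^^ l) (q (xs ! k)) (q (xs ! (k - 1)))" if "k \<in> {1..<length xs}" for k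
    proof -
      have kl: "k - 1 < length xs" "k < length xs" using that by auto
      obtain l where "sigma_path n A lam J (sig ! k) (xs ! (k - 1)) (xs ! k) l"
        using bspec[OF ex \<open>k \<in> {1..<length xs}\<close>] by (elim exE)
      then show ?thesis unfolding sigma_path_iff[OF m[OF kl(1)] m[OF kl(2)]] by blast
    qed
    moreover have "breaks_ok (length xs) sig" using x by (simp add: QLS_tilde_def)
    ultimately show ?thesis unfolding cl_paths_def
      by (simp only: mem_Collect_eq split length_map) (metis (no_types, lifting) atLeastLessThan_iff less_imp_diff_less nth_map)
  qed
  moreover have "q (xs ! k) \<noteq> q (xs ! (k + 1))" if "k + 1 < length xs" for k
    using x that minreps_unique[OF m m, of k "k + 1"] by (auto simp: QLS_tilde_def)
  ultimately show "p \<in> ?R" using p by (auto intro!: exI[of _ "map q xs"] exI[of _ sig])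
next
  fix p assume "p \<in> ?R"
  then obtain vs sig where p: "p = clpath vs sig" and z: "(vs, sig) \<in> cl_paths"
    and d: "\<And>k. k + 1 < length vs \<Longrightarrow> vs ! k \<noteq> vs ! (k + 1)" by blast
  obtain f where f: "\<And>v. v \<in> V \<Longrightarrow> f v \<in> minreps n A J \<and> q (f v) = v" using V_minrep by metis
  have vV: "vs ! k \<in> V" if "k < length vs" for k using z that by (auto simp: cl_paths_def)
  let ?xs = "map f vs"
  have "map q ?xs = vs" using vV f by (auto intro!: nth_equalityI)
  moreover have "(?xs, sig) \<in> QLS_tilde n A lam"
  proof -
    have "\<exists>l. sigma_path n A lam J (sig ! k) (?xs ! (k - 1)) (?xs ! k) l" if k: "k \<in> {1..<length vs}" for k
    proof -
      have k': "k < length vs" "k - 1 < length vs" using k by auto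
      obtain l where "(ed (sig ! k) ^^ l) (vs ! k) (vs ! (k - 1))" using z k unfolding cl_paths_def by blast
      then have "sigma_path n A lam J (sig ! k) (f (vs ! (k - 1))) (f (vs ! k)) l"
        using sigma_path_iff f[OF vV[OF k'(1)]] f[OF vV[OF k'(2)]] by auto
      then show ?thesis using k' by auto
    qed
    moreover have "f (vs ! k) \<noteq> f (vs ! (k + 1))" if "k + 1 < length vs" for k
      using d[OF that] f[OF vV] that by (metis add_lessD1)
    ultimately show ?thesis using z f vV by (auto simp: QLS_tilde_def cl_paths_def)
  qed
  ultimately show "p \<in> QLS_tilde_cl n A lam" unfolding QLS_tilde_cl_def cl_act_q p by (auto intro!: exI[of _ ?xs] exI[of _ sig])
qed

lemma LS_cl_subset: "LS_cl n A lam \<subseteq> QLS_tilde_cl n A lam"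
proof
  fix p assume "p \<in> LS_cl n A lam"
  then obtain nus sig where p: "p = (\<lambda>t. cl (wtpath nus sig t))" and x: "(nus, sig) \<in> LS n A lam"
    by (auto simp: LS_cl_def)
  have b: "breaks_ok (length nus) sig" using x by (simp add: LS_def)
  have "(map fst nus, sig) \<in> cl_paths"
  proof -
    have "set (map fst nus) \<subseteq> V" using x orbit_V by (fastforce simp: in_set_conv_nth LS_def)
    moreover have "\<exists>l. (ed (sig ! k) ^^ l) (fst (nus ! k)) (fst (nus ! (k - 1)))" if "k \<in> {1..<length nus}" for k
      using x that sigma_chain_projects breaks_pos[OF b, of k] by (auto simp: LS_def)
    ultimately show ?thesis using b by (auto simp: cl_paths_def)
  qed
  from merge_cl_paths[OF this] obtain vs sig' where vs: "(vs, sig') \<in> cl_paths"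
    "clpath vs sig' = clpath (map fst nus) sig" "\<forall>k. k + 1 < length vs \<longrightarrow> vs ! k \<noteq> vs ! (k + 1)" by blast
  have "p = clpath vs sig'" using p cl_wtpath[OF b] vs(2) by auto
  then show "p \<in> QLS_tilde_cl n A lam" unfolding QLS_tilde_cl_eq using vs(1,3) by blast
qed

text \<open>The LS path is built from its greatest direction downwards, the end of each lifted chain
  being the start of the next.\<close>

lemma QLS_tilde_cl_subset: "QLS_tilde_cl n A lam \<subseteq> LS_cl n A lam"
proof
  fix p assume "p \<in> QLS_tilde_cl n A lam"
  then obtain vs sig where p: "p = clpath vs sig" and z: "(vs, sig) \<in> cl_paths"
    and d: "\<And>k. k + 1 < length vs \<Longrightarrow> vs ! k \<noteq> vs ! (k + 1)" unfolding QLS_tilde_cl_eq by blast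
  have b: "breaks_ok (length vs) sig" using z by (simp add: cl_paths_def)
  have vV: "vs ! k \<in> V" if "k < length vs" for k using z that by (auto simp: cl_paths_def)
  have ch0: "\<exists>l. (ed (sig ! k) ^^ l) (vs ! k) (vs ! (k - 1))" if "k \<in> {1..<length vs}" for k
    using z that unfolding cl_paths_def by blast
  \<comment> \<open>The guards make \<open>P\<close> and \<open>Q\<close> hold trivially beyond the
    list, so that dependent choice over all natural numbers applies.\<close>
  define P where "P i a \<longleftrightarrow> (i < length vs \<longrightarrow> a \<in> orbit n A lam \<and> fst a = vs ! i)" for i and a :: wt
  define Q where "Q i a c \<longleftrightarrow> (Suc i < length vs \<longrightarrow> sigma_chain n A lam (sig ! Suc i) a c)" for i a c
  have "\<exists>f. \<forall>i. P i (f i) \<and> Q i (f i) (f (Suc i))"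
  proof (rule dependent_nat_choice)
    have "0 < length vs" using b by (auto simp: breaks_ok_def)
    then obtain ws where "set ws \<subseteq> I0" "vs ! 0 = fst (wword n A ws lam)" using vV[of 0] by (auto simp: V_def)
    moreover from this have "wword n A ws lam \<in> orbit n A lam"
      using I0_sub_II[of ws] unfolding orbit_def Weyl_def by blast
    ultimately show "\<exists>a. P 0 a" unfolding P_def by metis
  next
    fix a i assume a: "P i a"
    show "\<exists>c. P (Suc i) c \<and> Q i a c"
    proof (cases "Suc i < length vs")
      case True
      then have "a \<in> orbit n A lam" "fst a = vs ! i" using a by (auto simp: P_def)
      moreover obtain l where "(ed (sig ! Suc i) ^^ l) (vs ! Suc i) (vs ! i)"
        using ch0[of "Suc i"] True by auto
      moreover have "sig ! Suc i > 0" using breaks_pos[OF b, of "Suc i"] True by simp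
      moreover have "vs ! Suc i \<noteq> vs ! i" using d[of i] True by simp
      ultimately obtain c where "fst c = vs ! Suc i" "c \<in> orbit n A lam" "sigma_chain n A lam (sig ! Suc i) a c"
        using sigma_chain_lift by metis
      then show ?thesis unfolding P_def Q_def by blast
    qed (simp add: P_def Q_def)
  qed
  then obtain f where f: "\<And>i. P i (f i)" "\<And>i. Q i (f i) (f (Suc i))" by blast
  let ?nus = "map f [0..<length vs]"
  have ch: "sigma_chain n A lam (sig ! k) (f (k - 1)) (f k)" if "k \<in> {1..<length vs}" for k
    using f(2)[of "k - 1"] that by (auto simp: Q_def)
  have "(?nus, sig) \<in> LS n A lam"
  proof -
    have "ls_gt n A lam (f k) (f (Suc k))" if "Suc k < length vs" for k
      using ch[of "Suc k"] that by (auto simp: sigma_chain_def)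
    moreover have "f k \<in> orbit n A lam" if "k < length vs" for k using f(1)[of k] that by (simp add: P_def)
    ultimately show ?thesis using b ch by (auto simp: LS_def less_imp_diff_less)
  qed
  moreover have "map fst ?nus = vs" using f(1) by (auto simp: P_def intro!: nth_equalityI)
  then have "p = (\<lambda>t. cl (wtpath ?nus sig t))" using cl_wtpath[of ?nus sig] b p by auto
  ultimately show "p \<in> LS_cl n A lam" unfolding LS_cl_def by blast
qed

end

theorem theorem4p1:
  fixes n :: nat and A :: "nat \<Rightarrow> nat \<Rightarrow> int" and m :: "nat \<Rightarrow> nat" and lam :: wt
  assumes "untwisted_affine n A"
    and "lam = wsum (\<lambda>i. wscale (real (m i)) (lzfw n A i)) (I0set n)"
  shows "QLS_tilde_cl n A lam = QLS_hat_cl n A lam \<and> QLS_hat_cl n A lam = LS_cl n A lam"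
proof -
  interpret level_zero_weight n A m lam
    using assms by unfold_locales
  have "QLS_tilde_cl n A lam = QLS_hat_cl n A lam"
    unfolding QLS_tilde_cl_def QLS_hat_cl_def QLS_tilde_hat ..
  then show ?thesis using LS_cl_subset QLS_tilde_cl_subset by auto
qed

end
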